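(* For every $n\ge1$ there exists a constant $c_n>1$, depending only on $n$, such that for any $\mathbb C$-convex domain $D\subset\mathbb C^n$ containing no complex lines, any $z\in D$ and any $X\in\mathbb C^n\setminus\{0\}$ one has $$c_n^{-1}\le F_D(z;X)\left(\sum_{j=1}^n\frac{|X_j(z)|}{d_{j,D}(z)}\right)^{-1}\le c_n,$$ where $F_D$ denotes any of the Carathéodory metric $\gamma_D$, the Kobayashi metric $\kappa_D$, or the Bergman metric $B_D$.
   Context: A domain $D\subset\mathbb C^n$ is $\mathbb C$-convex if every non-empty intersection of $D$ with a complex (affine) line is a simply connected domain (in particular connected). "Containing no complex lines" means $D$ contains no complex affine line. Definition of $d_{j,D}(z)$ and $X_j(z)$ for $z\in D$: set $H_0=\mathbb C^n$, $D_0=D$. Inductively for $j=1,\dots,n$, let $d_{j,D}(z)$ be the distance from $z$ to the boundary of $D_{j-1}$ relative to the affine space $z+H_{j-1}$; choose a point $a^j$ in that relative boundary with $\|a^j-z\|=d_{j,D}(z)$; let $V_j=\mathbb C(a^j-z)$, $H_j=V_j^\perp\cap H_{j-1}$ (orthogonal complement for the standard Hermitian product), and $D_j=D_{j-1}\cap(z+H_j)$. The unit vectors $(a^j-z)/\|a^j-z\|$, $j=1,\dots,n$, form an orthonormal basis of $\mathbb C^n$, and $X_1(z),\dots,X_n(z)$ are the coordinates of $X$ with respect to this basis. The choices of the $a^j$ are arbitrary and fixed; the statement holds for any such choices. Let $\mathbb D\subset\mathbb C$ be the unit disc and $\mathcal O(A,B)$ the set of holomorphic maps $A\to B$. $\gamma_D(z;X)=\sup\{|f'(z)X|: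 f\in\mathcal O(D,\mathbb D),\ f(z)=0\}$; $\kappa_D(z;X)=\inf\{\alpha\ge0:\exists\varphi\in\mathcal O(\mathbb D,D):\varphi(0)=z,\ \alpha\varphi'(0)=X\}$. With $L^2_h(D)$ the space of square-integrable holomorphic functions on $D$ and $\|\cdot\|_D$ the $L^2$-norm, $K_D(z)=\sup\{|f(z)|^2: f\in L^2_h(D),\ \|f\|_D\le1\}$, $M_D(z;X)=\sup\{|f'(z)X|: f\in L^2_h(D),\ \|f\|_D=1,\ f(z)=0\}$ and $B_D(z;X)=M_D(z;X)/\sqrt{K_D(z)}$ (well-defined since a $\mathbb C$-convex domain containing no complex lines is biholomorphic to a bounded domain). *)

theory Defs
  imports "HOL-Complex_Analysis.Complex_Analysis"
begin

section \<open>Complex geometry of \<open>complex ^ 'n\<close>\<close>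

text \<open>The norm and the measure \<^const>\<open>lborel\<close> on \<open>complex ^ 'n\<close> are those of the
  underlying real Euclidean space of dimension \<open>2 * CARD('n)\<close>.  The library inner product on this
  type is the real one (the real part of \<open>cinner\<close>); complex scalar multiplication is \<open>*s\<close>, so that
  complex spans and coordinates are \<^term>\<open>vec.span\<close> and \<^term>\<open>vec.representation\<close>.\<close>

definition cinner :: "complex ^ 'n \<Rightarrow> complex ^ 'n \<Rightarrow> complex" where
  "cinner x y = (\<Sum>i\<in>UNIV. x $ i * cnj (y $ i))"

definition corth_compl :: "(complex ^ 'n) set \<Rightarrow> (complex ^ 'n) set" where
  "corth_compl V = {x. \<forall>y\<in>V. cinner x y = 0}"

definition complex_line :: "(complex ^ 'n) set \<Rightarrow> bool" where
  "complex_line L \<longleftrightarrow> (\<exists>p v. v \<noteq> 0 \<and> L = range (\<lambda>t::complex. p + t *s v))"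

definition domain_in :: "(complex ^ 'n) set \<Rightarrow> bool" where
  "domain_in D \<longleftrightarrow> open D \<and> connected D \<and> D \<noteq> {}"

text \<open>\<^const>\<open>simply_connected\<close> entails path-connectedness, and the intersection of an open set with
  a line is open in that line, so \<open>D \<inter> L\<close> below is a simply connected domain.\<close>

definition C_convex :: "(complex ^ 'n) set \<Rightarrow> bool" where
  "C_convex D \<longleftrightarrow> domain_in D \<and>
     (\<forall>L. complex_line L \<and> D \<inter> L \<noteq> {} \<longrightarrow> simply_connected (D \<inter> L))"

definition contains_no_complex_lines :: "(complex ^ 'n) set \<Rightarrow> bool" where
  "contains_no_complex_lines D \<longleftrightarrow> \<not> (\<exists>L. complex_line L \<and> L \<subseteq> D)"

section \<open>The successive distances and the adapted basis\<close>

text \<open>A family \<open>a 1, \<dots>, a n\<close> of candidate boundary points is a function on \<^typ>\<open>nat\<close> whose value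
  at \<open>0\<close> is irrelevant.  The objects with index \<open>j\<close> depend only on \<open>a 1, \<dots>, a j\<close> (and the
  distance \<open>bd_dist D z a j\<close> only on \<open>a 1, \<dots>, a (j - 1)\<close>).\<close>

fun Hsp :: "complex ^ 'n \<Rightarrow> (nat \<Rightarrow> complex ^ 'n) \<Rightarrow> nat \<Rightarrow> (complex ^ 'n) set" where
  "Hsp z a 0 = UNIV"
| "Hsp z a (Suc j) = corth_compl (vec.span {a (Suc j) - z}) \<inter> Hsp z a j"

fun Dslice :: "(complex ^ 'n) set \<Rightarrow> complex ^ 'n \<Rightarrow> (nat \<Rightarrow> complex ^ 'n) \<Rightarrow> nat \<Rightarrow> (complex ^ 'n) set"
  where
  "Dslice D z a 0 = D"
| "Dslice D z a (Suc j) = Dslice D z a j \<inter> (+) z ` Hsp z a (Suc j)"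

definition rel_bd :: "(complex ^ 'n) set \<Rightarrow> complex ^ 'n \<Rightarrow> (nat \<Rightarrow> complex ^ 'n) \<Rightarrow> nat \<Rightarrow> (complex ^ 'n) set"
  where
  "rel_bd D z a j = (top_of_set ((+) z ` Hsp z a (j - 1))) frontier_of (Dslice D z a (j - 1))"

definition bd_dist :: "(complex ^ 'n) set \<Rightarrow> complex ^ 'n \<Rightarrow> (nat \<Rightarrow> complex ^ 'n) \<Rightarrow> nat \<Rightarrow> real" where
  "bd_dist D z a j = infdist z (rel_bd D z a j)"

definition adapted :: "(complex ^ 'n) set \<Rightarrow> complex ^ 'n \<Rightarrow> (nat \<Rightarrow> complex ^ 'n) \<Rightarrow> bool" where
  "adapted D z a \<longleftrightarrow>
     (\<forall>j\<in>{1..CARD('n)}. a j \<in> rel_bd D z a j \<and> norm (a j - z) = bd_dist D z a j)"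

definition unit_dir :: "complex ^ 'n \<Rightarrow> (nat \<Rightarrow> complex ^ 'n) \<Rightarrow> nat \<Rightarrow> complex ^ 'n" where
  "unit_dir z a j = (a j - z) /\<^sub>R norm (a j - z)"

definition coord :: "complex ^ 'n \<Rightarrow> (nat \<Rightarrow> complex ^ 'n) \<Rightarrow> complex ^ 'n \<Rightarrow> nat \<Rightarrow> complex" where
  "coord z a X j = vec.representation (unit_dir z a ` {1..CARD('n)}) X (unit_dir z a j)"

section \<open>Invariant metrics\<close>

definition holo_fun_on :: "(complex ^ 'n \<Rightarrow> complex) \<Rightarrow> (complex ^ 'n) set \<Rightarrow> bool" where
  "holo_fun_on f D \<longleftrightarrow>
     (\<forall>x\<in>D. \<exists>f'. (f has_derivative f') (at x) \<and> Vector_Spaces.linear (*s) (*) f')"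

definition holo_map_on :: "(complex \<Rightarrow> complex ^ 'n) \<Rightarrow> complex set \<Rightarrow> bool" where
  "holo_map_on \<phi> S \<longleftrightarrow> (\<forall>i. (\<lambda>t. \<phi> t $ i) holomorphic_on S)"

definition caratheodory_metric :: "(complex ^ 'n) set \<Rightarrow> complex ^ 'n \<Rightarrow> complex ^ 'n \<Rightarrow> real" where
  "caratheodory_metric D z X =
     Sup {cmod (frechet_derivative f (at z) X) | f.
            holo_fun_on f D \<and> f ` D \<subseteq> ball 0 1 \<and> f z = 0}"

definition kobayashi_metric :: "(complex ^ 'n) set \<Rightarrow> complex ^ 'n \<Rightarrow> complex ^ 'n \<Rightarrow> real" where
  "kobayashi_metric D z X =
     Inf {\<alpha>. \<alpha> \<ge> 0 \<and> (\<exists>\<phi>. holo_map_on \<phi> (ball 0 1) \<and> \<phi> ` ball 0 1 \<subseteq> D \<and> \<phi> 0 = z \<and>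
                 \<alpha> *\<^sub>R (\<chi> i. deriv (\<lambda>t. \<phi> t $ i) 0) = X)}"

definition L2h :: "(complex ^ 'n) set \<Rightarrow> (complex ^ 'n \<Rightarrow> complex) set" where
  "L2h D = {f. holo_fun_on f D \<and> set_integrable lborel D (\<lambda>x. (cmod (f x))\<^sup>2)}"

definition L2norm :: "(complex ^ 'n) set \<Rightarrow> (complex ^ 'n \<Rightarrow> complex) \<Rightarrow> real" where
  "L2norm D f = sqrt (set_lebesgue_integral lborel D (\<lambda>x. (cmod (f x))\<^sup>2))"

definition bergman_kernel :: "(complex ^ 'n) set \<Rightarrow> complex ^ 'n \<Rightarrow> real" where
  "bergman_kernel D z = Sup {(cmod (f z))\<^sup>2 | f. f \<in> L2h D \<and> L2norm D f \<le> 1}"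

definition bergman_M :: "(complex ^ 'n) set \<Rightarrow> complex ^ 'n \<Rightarrow> complex ^ 'n \<Rightarrow> real" where
  "bergman_M D z X =
     Sup {cmod (frechet_derivative f (at z) X) | f. f \<in> L2h D \<and> L2norm D f = 1 \<and> f z = 0}"

definition bergman_metric :: "(complex ^ 'n) set \<Rightarrow> complex ^ 'n \<Rightarrow> complex ^ 'n \<Rightarrow> real" where
  "bergman_metric D z X = bergman_M D z X / sqrt (bergman_kernel D z)"

end

theory Submission
  imports Defs
begin

text \<open>An open \<open>\<complex>\<close>-convex set \<open>D\<close> is linearly convex: through each point outside \<open>D\<close> there is a complex
  hyperplane missing \<open>D\<close>.  Applied at the points \<open>a j\<close> this yields functionals \<open>l j\<close> with
  \<open>l j (a j - z) = 1\<close> and \<open>l j \<noteq> 1\<close> on \<open>D - z\<close>; since \<open>D\<close> contains balls in the successive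
  orthogonal complements, they are triangular in the adapted basis, so \<open>max\<^sub>j \<bar>l j X\<bar>\<close> is comparable to
  \<open>S X = \<Sum>\<^sub>j \<bar>X\<^sub>j\<bar> / d\<^sub>j\<close>.  Applied at an arbitrary point it yields \<open>{z + x. S x < 1} \<subseteq> D\<close>, hence the upper
  bounds.  For the lower bounds, \<open>1 - l j\<close> has a holomorphic square root \<open>\<sigma> j\<close> on \<open>D\<close> that stays away
  from \<open>- 1\<close>: bounded test functions are built from \<open>1 / (1 + \<sigma> j)\<close>, and powers of their product are
  square integrable with energy comparable to the volume of \<open>{S < 1}\<close>, which controls the Bergman
  kernel from below.\<close>

section \<open>Complex lines through an open set\<close>

text \<open>Only slices by complex lines are known to be simply connected, so every topological step
  is run on lines: zero-free functions have logarithms on each slice, and comparing the increments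
  of these logarithms replaces homotopies in \<open>D\<close>. Linear convexity comes from a
  smallest finite family of linear functionals without common zero on \<open>D\<close>: two members
  \<open>a\<close>, \<open>b\<close> would map a linear section of \<open>D\<close> onto the whole
  projective line, which is impossible. Square roots enter because \<open>1 - l j\<close> merely
  omits 0 on \<open>D\<close>: its values need not lie in a half plane, so a Cayley transform gives
  no bounded function, whereas a square root covering a neighbourhood of 1 omits the opposite one.
  The two Bergman bounds differ in nature. The lower one compares numerator and kernel directly, by
  multiplying competitors for the kernel by the Caratheodory test function; the upper one needs the
  kernel bounded from below, hence square-integrable functions. The volume of
  \<open>{S < 1}\<close>, which depends on \<open>D\<close>, cancels in the quotient.\<close>

abbreviation clinear_fun :: "(complex ^ 'n \<Rightarrow> complex) \<Rightarrow> bool" where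
  "clinear_fun l \<equiv> Vector_Spaces.linear (*s) (*) l"

lemma clinear_fun_add: "clinear_fun l \<Longrightarrow> l (x + y) = l x + l y"
  by (simp add: Vector_Spaces.linear_def module_hom_def module_hom_axioms_def)

lemma clinear_fun_scale: "clinear_fun l \<Longrightarrow> l (c *s x) = c * l x"
  by (simp add: Vector_Spaces.linear_def module_hom_def module_hom_axioms_def)

lemma clinear_fun_0: "clinear_fun l \<Longrightarrow> l 0 = 0"
  using clinear_fun_scale[of l 0 0] by simp

lemma clinear_fun_diff: "clinear_fun l \<Longrightarrow> l (x - y) = l x - l y"
  using clinear_fun_add[of l "x - y" y] by simp

lemma clinear_funI:
  fixes l :: "complex ^ 'n \<Rightarrow> complex"
  assumes "\<And>x y. l (x + y) = l x + l y" "\<And>c x. l (c *s x) = c * l x"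
  shows "clinear_fun l"
  using assms
  by unfold_locales (auto simp: algebra_simps vector_space_over_itself.scale_left_distrib)

lemma scaleR_vec_eq: "r *\<^sub>R x = complex_of_real r *s x" for x :: "complex ^ 'n"
  unfolding vec_eq_iff
  by (simp only: vector_scaleR_component vector_smult_component) (simp add: scaleR_conv_of_real)

lemma norm_vec_scale: "norm (c *s x) = cmod c * norm x" for x :: "complex ^ 'n"
  by (simp add: norm_vec_def L2_set_def norm_mult power_mult_distrib
      flip: sum_distrib_left) (simp add: real_sqrt_mult)

lemma bounded_bilinear_vec_scale:
  "bounded_bilinear ((*s) :: complex \<Rightarrow> complex ^ 'n \<Rightarrow> complex ^ 'n)"
  by (unfold_locales)
    (auto simp: vec_eq_iff algebra_simps norm_vec_scale intro!: exI[of _ 1])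

lemmas continuous_on_vec_scale [continuous_intros] =
  bounded_bilinear.continuous_on[OF bounded_bilinear_vec_scale]

lemma clinear_fun_bounded_linear:
  fixes l :: "complex ^ 'n \<Rightarrow> complex"
  assumes "clinear_fun l"
  shows "bounded_linear l"
proof -
  have "linear l"
    by (rule linearI)
      (simp_all add: clinear_fun_add[OF assms] scaleR_vec_eq clinear_fun_scale[OF assms] scaleR_conv_of_real)
  then show ?thesis
    by (simp add: linear_conv_bounded_linear)
qed

text \<open>C-convexity moved to the parameter plane, where simple connectivity of an open set
  yields continuous logarithms of zero-free functions. Admitting \<open>v = 0\<close> makes the
  degenerate line with \<open>x = y\<close> harmless later: its trace is the whole plane.\<close>

definition lineconv :: "(complex ^ 'n) set \<Rightarrow> bool" where
  "lineconv D \<longleftrightarrow> open D \<and> (\<forall>w\<in>D. \<forall>v. simply_connected {t::complex. w + t *s v \<in> D})"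

lemma C_convex_imp_lineconv:
  fixes D :: "(complex ^ 'n) set"
  assumes "C_convex D"
  shows "lineconv D"
  unfolding lineconv_def
proof (intro conjI ballI allI)
  show "open D" using assms by (simp add: C_convex_def domain_in_def)
  fix w v :: "complex ^ 'n" assume w: "w \<in> D"
  show "simply_connected {t::complex. w + t *s v \<in> D}"
  proof (cases "v = 0")
    case True
    then have "{t::complex. w + t *s v \<in> D} = UNIV" using w by auto
    then show ?thesis by (simp add: convex_imp_simply_connected)
  next
    case False
    define L where "L = range (\<lambda>t::complex. w + t *s v)"
    have "complex_line L" using False by (auto simp: complex_line_def L_def)
    moreover have "w \<in> D \<inter> L" using w by (auto simp: L_def intro!: range_eqI[of _ _ 0])
    ultimately have sc: "simply_connected (D \<inter> L)"
      using assms by (auto simp: C_convex_def)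
    obtain i where i: "v $ i \<noteq> 0" using False by (auto simp: vec_eq_iff)
    let ?T = "{t::complex. w + t *s v \<in> D}"
    have "homeomorphism (D \<inter> L) ?T (\<lambda>x. (x $ i - w $ i) / v $ i) (\<lambda>t. w + t *s v)"
      using i by (intro homeomorphismI)
        (auto intro!: continuous_intros simp: L_def)
    then have "(D \<inter> L) homeomorphic ?T" by (auto simp: homeomorphic_def)
    then show ?thesis using sc homeomorphic_simply_connected by blast
  qed
qed

lemma lineconv_translate:
  assumes "lineconv D"
  shows "lineconv ((\<lambda>x. p + x) -` D)"
proof -
  have "open ((\<lambda>x. p + x) -` D)"
    using assms by (intro open_vimage) (auto simp: lineconv_def intro!: continuous_intros)
  then show ?thesis
    using assms by (auto simp: lineconv_def add.assoc[symmetric])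
qed

section \<open>Increments of logarithms along complex lines\<close>

definition trace_set :: "(complex ^ 'n) set \<Rightarrow> complex ^ 'n \<Rightarrow> complex ^ 'n \<Rightarrow> complex set" where
  "trace_set D x y = {t. x + t *s (y - x) \<in> D}"

lemma trace_set:
  fixes D :: "(complex ^ 'n) set"
  assumes "lineconv D" "x \<in> D"
  shows "open (trace_set D x y)" "simply_connected (trace_set D x y)" "0 \<in> trace_set D x y"
    "y \<in> D \<Longrightarrow> 1 \<in> trace_set D x y" "connected (trace_set D x y)"
proof -
  have "trace_set D x y = (\<lambda>t. x + t *s (y - x)) -` D"
    by (auto simp: trace_set_def)
  then show "open (trace_set D x y)"
    using assms by (auto simp: lineconv_def intro!: open_vimage continuous_intros)
  show "0 \<in> trace_set D x y" "y \<in> D \<Longrightarrow> 1 \<in> trace_set D x y"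
    using assms by (auto simp: trace_set_def)
  show "simply_connected (trace_set D x y)"
    using assms unfolding trace_set_def lineconv_def by blast
  then show "connected (trace_set D x y)"
    by (simp add: simply_connected_imp_connected)
qed

text \<open>The increment of a continuous logarithm of \<open>f\<close> from \<open>x\<close> to
  \<open>y\<close> inside the slice of \<open>D\<close> by their line. For a linearly sliced
  \<open>D\<close> and \<open>f\<close> without zeros on that slice the choice is immaterial, since
  two logarithms on a connected set differ by a constant.\<close>

definition logdiff :: "(complex ^ 'n) set \<Rightarrow> (complex ^ 'n \<Rightarrow> complex) \<Rightarrow> complex ^ 'n \<Rightarrow> complex ^ 'n \<Rightarrow> complex"
  where "logdiff D f x y = (SOME d. \<exists>L. continuous_on (trace_set D x y) L \<and>
    (\<forall>t\<in>trace_set D x y. f (x + t *s (y - x)) = exp (L t)) \<and> d = L 1 - L 0)"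

definition nz_on_line :: "(complex ^ 'n) set \<Rightarrow> (complex ^ 'n \<Rightarrow> complex) \<Rightarrow> complex ^ 'n \<Rightarrow> complex ^ 'n \<Rightarrow> bool"
  where "nz_on_line D f x y \<longleftrightarrow> x \<in> D \<and> y \<in> D \<and> (\<forall>t\<in>trace_set D x y. f (x + t *s (y - x)) \<noteq> 0)"

text \<open>Distinct logarithms of one number differ by a nonzero multiple of
  \<open>2 * pi * \<i>\<close>, so they are at least 1 apart and a continuous choice on a connected
  set cannot jump.\<close>

lemma exp_const_imp_const:
  fixes g :: "'a::topological_space \<Rightarrow> complex"
  assumes "connected S" "continuous_on S g" "\<And>t. t \<in> S \<Longrightarrow> exp (g t) = c" "x \<in> S" "y \<in> S"
  shows "g x = g y"
proof -
  have "g constant_on S"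
  proof (rule continuous_discrete_range_constant[OF assms(1,2)])
    fix u assume u: "u \<in> S"
    show "\<exists>e>0. \<forall>v. v \<in> S \<and> g v \<noteq> g u \<longrightarrow> e \<le> cmod (g v - g u)"
    proof (intro exI[of _ 1] conjI allI impI)
      fix v assume v: "v \<in> S \<and> g v \<noteq> g u"
      then have "exp (g v) = exp (g u)" using assms(3) u by simp
      then obtain n :: int where n: "g v = g u + complex_of_real (of_int (2 * n) * pi) * \<i>"
        unfolding exp_eq by auto
      then have "n \<noteq> 0" using v by auto
      then have "1 \<le> \<bar>real_of_int n\<bar>" by linarith
      moreover have "cmod (g v - g u) = 2 * \<bar>real_of_int n\<bar> * pi"
        using n by (simp add: norm_mult abs_mult)
      moreover have "1 * 1 \<le> (2 * \<bar>real_of_int n\<bar>) * pi"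
        using calculation pi_gt3 by (intro mult_mono) auto
      ultimately show "1 \<le> cmod (g v - g u)" by simp
    qed simp
  qed
  then show ?thesis using assms(4,5) by (auto simp: constant_on_def)
qed

lemma logdiff_obtain:
  assumes "lineconv D" "nz_on_line D f x y" "continuous_on D f"
  obtains L where "continuous_on (trace_set D x y) L"
    "\<And>t. t \<in> trace_set D x y \<Longrightarrow> f (x + t *s (y - x)) = exp (L t)" "logdiff D f x y = L 1 - L 0"
proof -
  note tr = trace_set[OF assms(1), of x y]
  have xy: "x \<in> D" "y \<in> D" using assms(2) by (auto simp: nz_on_line_def)
  have "continuous_on (trace_set D x y) (\<lambda>t. f (x + t *s (y - x)))"
    by (rule continuous_on_compose2[OF assms(3)])
      (auto intro!: continuous_intros simp: trace_set_def)
  then have "\<exists>L. continuous_on (trace_set D x y) L \<and>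
      (\<forall>t\<in>trace_set D x y. f (x + t *s (y - x)) = exp (L t))"
    using simply_connected_eq_continuous_log[OF tr(1)[OF xy(1)]] tr(2)[OF xy(1)] assms(2)
    unfolding nz_on_line_def by blast
  then have "\<exists>d L. continuous_on (trace_set D x y) L \<and>
      (\<forall>t\<in>trace_set D x y. f (x + t *s (y - x)) = exp (L t)) \<and> d = L 1 - L 0" by blast
  from someI_ex[OF this] show ?thesis
    using that unfolding logdiff_def by blast
qed

text \<open>Only increments matter, so \<open>g\<close> may be a logarithm of any constant multiple
  of \<open>f\<close>; \<open>logdiff_add\<close> uses the factor \<open>1 / f x\<close>.\<close>

lemma logdiff_unique:
  assumes "lineconv D" "nz_on_line D f x y" "continuous_on D f"
    and g: "continuous_on (trace_set D x y) g"
      "\<And>t. t \<in> trace_set D x y \<Longrightarrow> exp (g t) = c * f (x + t *s (y - x))"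
  shows "logdiff D f x y = g 1 - g 0"
proof -
  note tr = trace_set[OF assms(1), of x y]
  have xy: "x \<in> D" "y \<in> D" using assms(2) by (auto simp: nz_on_line_def)
  obtain L where L: "continuous_on (trace_set D x y) L"
    "\<And>t. t \<in> trace_set D x y \<Longrightarrow> f (x + t *s (y - x)) = exp (L t)" "logdiff D f x y = L 1 - L 0"
    by (rule logdiff_obtain[OF assms(1-3)]) (rule that)
  have "g 1 - L 1 = g 0 - L 0"
    by (rule exp_const_imp_const[where c = c and g = "\<lambda>t. g t - L t" and S = "trace_set D x y"])
      (use tr xy L g in \<open>auto intro!: continuous_intros simp: exp_diff\<close>)
  then have "L 1 - L 0 = g 1 - g 0" by algebra
  then show ?thesis using L(3) by simp
qed

lemma exp_logdiff:
  assumes "lineconv D" "nz_on_line D f x y" "continuous_on D f"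
  shows "exp (logdiff D f x y) = f y / f x"
proof -
  obtain L where L: "continuous_on (trace_set D x y) L"
    "\<And>t. t \<in> trace_set D x y \<Longrightarrow> f (x + t *s (y - x)) = exp (L t)" "logdiff D f x y = L 1 - L 0"
    by (rule logdiff_obtain[OF assms]) (rule that)
  show ?thesis
    using L(2)[of 0] L(2)[of 1] L(3) trace_set[OF assms(1), of x y] assms(2)
    by (simp add: exp_diff nz_on_line_def)
qed

text \<open>The slice itself may change abruptly with the line, but the compact image of a path from
  0 to 1 persists on all nearby lines.\<close>

lemma trace_set_path:
  assumes "lineconv D" "x \<in> D" "y \<in> D"
  obtains p where "path p" "path_image p \<subseteq> trace_set D x y" "p 0 = 0" "p 1 = 1"
proof -
  have "path_connected (trace_set D x y)"
    using trace_set[OF assms(1,2), of y] by (simp add: simply_connected_imp_path_connected)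
  then show ?thesis
    using trace_set(3)[OF assms(1,2), of y] trace_set(4)[OF assms] that
    unfolding path_connected_def pathstart_def pathfinish_def by metis
qed

text \<open>A path from \<open>x\<^sub>0\<close> to \<open>y\<^sub>0\<close> inside the intersection of \<open>D\<close> with their line can be transported to the
  lines of nearby pairs, and the two logarithms along it differ by a principal logarithm.\<close>

lemma continuous_on_logdiff:
  fixes D :: "(complex ^ 'n) set"
  assumes D: "lineconv D" and f: "\<And>x y. cmod (f x - f y) \<le> C * norm (x - y)"
  shows "continuous_on {p. nz_on_line D f (fst p) (snd p)} (\<lambda>p. logdiff D f (fst p) (snd p))"
  unfolding continuous_on_iff
proof (intro ballI allI impI)
  fix p0 :: "(complex ^ 'n) \<times> (complex ^ 'n)" and e :: real
  assume "p0 \<in> {p. nz_on_line D f (fst p) (snd p)}" and e: "0 < e"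
  then obtain x0 y0 where p0: "p0 = (x0, y0)" and nz0: "nz_on_line D f x0 y0"
    by (cases p0) auto
  have xy0: "x0 \<in> D" "y0 \<in> D" using nz0 by (auto simp: nz_on_line_def)
  have Df: "continuous_on UNIV f"
  proof (rule lipschitz_on_continuous_on)
    show "(max C 0)-lipschitz_on UNIV f"
      using f by (intro lipschitz_onI)
        (auto simp: dist_norm intro!: order_trans[OF f mult_right_mono])
  qed
  then have Df': "continuous_on D f" by (rule continuous_on_subset) simp
  obtain p where p: "path p" "path_image p \<subseteq> trace_set D x0 y0" "p 0 = 0" "p 1 = 1"
    by (rule trace_set_path[OF D xy0]) (rule that)
  have contp: "continuous_on {0..1} p" using p(1) by (simp add: path_def)
  have pin: "p s \<in> trace_set D x0 y0" if "s \<in> {0..1}" for s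
    using p(2) that by (auto simp: path_image_def)
  obtain B where B: "B > 0" "\<And>s. s \<in> {0..1} \<Longrightarrow> cmod (p s) \<le> B"
  proof -
    have "bounded (p ` {0..1})"
      using contp compact_continuous_image compact_imp_bounded by blast
    then show ?thesis using that unfolding bounded_pos by auto
  qed
  define G where "G x y s = x + p s *s (y - x)" for x y :: "complex ^ 'n" and s :: real
  have contG: "continuous_on {0..1} (G x y)" for x y
    unfolding G_def by (intro continuous_intros contp)
  define K where "K = G x0 y0 ` {0..1}"
  have K: "compact K" "K \<subseteq> D" "K \<noteq> {}"
    using contG[of x0 y0] pin by (auto simp: K_def G_def trace_set_def intro: compact_continuous_image)
  obtain e1 where e1: "e1 > 0" "(\<Union>k\<in>K. ball k e1) \<subseteq> D"
    using compact_subset_open_imp_ball_epsilon_subset[OF K(1) _ K(2)] D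
    by (auto simp: lineconv_def)
  have fK: "f k \<noteq> 0" if "k \<in> K" for k
    using that nz0 pin by (auto simp: K_def G_def nz_on_line_def)
  obtain k0 where k0: "k0 \<in> K" "\<And>k. k \<in> K \<Longrightarrow> cmod (f k0) \<le> cmod (f k)"
    using continuous_attains_inf[OF K(1,3), of "\<lambda>k. cmod (f k)"] Df
    by (metis continuous_on_norm continuous_on_subset subset_UNIV)
  define m where "m = cmod (f k0)"
  have m: "m > 0" using fK k0(1) by (simp add: m_def)
  have "isCont Ln 1" by (rule continuous_at_Ln) auto
  then obtain h0 where h0: "h0 > 0" "\<And>w. dist w 1 < h0 \<Longrightarrow> dist (Ln w) (Ln 1) < e / 2"
    using e unfolding continuous_at_eps_delta by (metis half_gt_zero)
  define h where "h = min h0 1"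
  have h: "h > 0" "h \<le> 1" "\<And>w. cmod (w - 1) < h \<Longrightarrow> cmod (Ln w) < e / 2"
    using h0 by (auto simp: h_def dist_norm)
  define C' where "C' = max C 1"
  have C': "C' > 0" "\<And>x y. cmod (f x - f y) \<le> C' * norm (x - y)"
    using f by (auto simp: C'_def intro!: order_trans[OF f mult_right_mono])
  \<comment> \<open>Moving both endpoints by less than \<open>d\<close> moves each point of the
    transported path by less than \<open>(1 + 2 * B) * d\<close>. The bound \<open>e1\<close> keeps
    it in \<open>D\<close>; the bound \<open>m * h / C'\<close> keeps the ratio of the two values of
    \<open>f\<close> within \<open>h\<close> of 1, inside the domain of the principal
    logarithm.\<close>
  define d where "d = min e1 (m * h / C') / (1 + 2 * B)"
  have d: "d > 0" using e1 m h C' B by (simp add: d_def)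
  have dB: "(1 + 2 * B) * d \<le> e1" "(1 + 2 * B) * d \<le> m * h / C'"
    using B by (simp_all add: d_def)
  show "\<exists>d>0. \<forall>q\<in>{p. nz_on_line D f (fst p) (snd p)}. dist q p0 < d \<longrightarrow>
      dist (logdiff D f (fst q) (snd q)) (logdiff D f (fst p0) (snd p0)) < e"
  proof (intro exI[of _ d] conjI ballI impI d)
    fix q assume q: "q \<in> {p. nz_on_line D f (fst p) (snd p)}" "dist q p0 < d"
    obtain x y where xy: "q = (x, y)" by (cases q)
    have nz: "nz_on_line D f x y" using q xy by simp
    have dx: "norm (x - x0) < d" "norm (y - y0) < d"
      using q(2) dist_fst_le[of q p0] dist_snd_le[of q p0] by (auto simp: xy p0 dist_norm)
    have Gd: "norm (G x y s - G x0 y0 s) < (1 + 2 * B) * d" if s: "s \<in> {0..1}" for s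
    proof -
      have "G x y s - G x0 y0 s = (1 - p s) *s (x - x0) + p s *s (y - y0)"
        by (simp add: G_def vec_eq_iff algebra_simps)
      then have "norm (G x y s - G x0 y0 s) \<le> cmod (1 - p s) * norm (x - x0) + cmod (p s) * norm (y - y0)"
        by (metis norm_triangle_ineq norm_vec_scale)
      also have "cmod (1 - p s) * norm (x - x0) \<le> (1 + B) * norm (x - x0)"
        using norm_triangle_ineq4[of 1 "p s"] B(2)[OF s] by (intro mult_right_mono) auto
      also have "cmod (p s) * norm (y - y0) \<le> B * d"
        using dx B s by (intro mult_mono) auto
      also have "(1 + B) * norm (x - x0) < (1 + B) * d"
        using dx B by (intro mult_strict_left_mono) auto
      finally show ?thesis by (simp add: algebra_simps)
    qed
    have GK: "G x0 y0 s \<in> K" if "s \<in> {0..1}" for s using that by (auto simp: K_def)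
    have GD: "G x y s \<in> D" if s: "s \<in> {0..1}" for s
    proof -
      have "G x y s \<in> ball (G x0 y0 s) e1"
        using Gd[OF s] dB by (simp add: dist_norm norm_minus_commute)
      then show ?thesis using e1(2) GK[OF s] by blast
    qed
    then have pin': "p s \<in> trace_set D x y" if "s \<in> {0..1}" for s
      using that by (auto simp: G_def trace_set_def)
    define R where "R s = f (G x y s) / f (G x0 y0 s)" for s
    have R1: "cmod (R s - 1) < h" if s: "s \<in> {0..1}" for s
    proof -
      have "cmod (f (G x y s) - f (G x0 y0 s)) \<le> C' * norm (G x y s - G x0 y0 s)"
        by (rule C'(2))
      also have "\<dots> < C' * ((1 + 2 * B) * d)"
        using Gd[OF s] C' by (intro mult_strict_left_mono)
      also have "\<dots> \<le> C' * (m * h / C')"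
        using dB C' by (intro mult_left_mono) auto
      also have "\<dots> = m * h" using C' by simp
      also have "\<dots> \<le> cmod (f (G x0 y0 s)) * h"
        using k0(2)[OF GK[OF s]] h by (simp add: m_def)
      finally have "cmod (f (G x y s) - f (G x0 y0 s)) < h * cmod (f (G x0 y0 s))"
        by (simp add: mult.commute)
      moreover have "R s - 1 = (f (G x y s) - f (G x0 y0 s)) / f (G x0 y0 s)"
        using fK[OF GK[OF s]] by (simp add: R_def diff_divide_distrib)
      ultimately show ?thesis
        using fK[OF GK[OF s]] by (simp add: norm_divide pos_divide_less_eq)
    qed
    have Rpos: "R s \<notin> \<real>\<^sub>\<le>\<^sub>0" if s: "s \<in> {0..1}" for s
    proof -
      have "\<bar>Re (R s - 1)\<bar> < 1"
        using R1[OF s] h(2) abs_Re_le_cmod[of "R s - 1"] by linarith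
      then show ?thesis by (auto simp: complex_nonpos_Reals_iff)
    qed
    have contR: "continuous_on {0..1} R"
      unfolding R_def
      by (intro continuous_on_divide continuous_on_compose2[OF Df] contG) (use fK GK in auto)
    obtain L where L: "continuous_on (trace_set D x y) L"
      "\<And>t. t \<in> trace_set D x y \<Longrightarrow> f (x + t *s (y - x)) = exp (L t)" "logdiff D f x y = L 1 - L 0"
      by (rule logdiff_obtain[OF D nz Df']) (rule that)
    obtain L0 where L0: "continuous_on (trace_set D x0 y0) L0"
      "\<And>t. t \<in> trace_set D x0 y0 \<Longrightarrow> f (x0 + t *s (y0 - x0)) = exp (L0 t)"
      "logdiff D f x0 y0 = L0 1 - L0 0"
      by (rule logdiff_obtain[OF D nz0 Df']) (rule that)
    define g where "g s = L (p s) - L0 (p s) - Ln (R s)" for s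
    have "g 1 = g 0"
    proof (rule exp_const_imp_const[where c = 1 and g = g and S = "{0..1}"])
      have "continuous_on {0..1} (\<lambda>s. L (p s))" "continuous_on {0..1} (\<lambda>s. L0 (p s))"
        by (rule continuous_on_compose2[OF L(1) contp] continuous_on_compose2[OF L0(1) contp];
            use pin pin' in auto)+
      moreover have "continuous_on {0..1} (\<lambda>s. Ln (R s))"
        by (rule continuous_on_Ln'[OF contR]) (rule Rpos)
      ultimately show "continuous_on {0..1} g"
        unfolding g_def by (intro continuous_on_diff)
      fix s :: real assume s: "s \<in> {0..1}"
      have "exp (L (p s)) = f (G x y s)" "exp (L0 (p s)) = f (G x0 y0 s)"
        using L(2)[OF pin'[OF s]] L0(2)[OF pin[OF s]] by (simp_all add: G_def)
      moreover have "R s \<noteq> 0" using Rpos[OF s] by auto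
      ultimately show "exp (g s) = 1"
        by (auto simp: g_def exp_diff R_def)
    qed auto
    then have "logdiff D f x y - logdiff D f x0 y0 = Ln (R 1) - Ln (R 0)"
      unfolding L(3) L0(3) g_def p(3,4) by algebra
    moreover have "cmod (Ln (R 1) - Ln (R 0)) < e"
      using h(3)[OF R1[of 1]] h(3)[OF R1[of 0]] norm_triangle_ineq4[of "Ln (R 1)" "Ln (R 0)"] by simp
    ultimately show "dist (logdiff D f (fst q) (snd q)) (logdiff D f (fst p0) (snd p0)) < e"
      by (simp add: xy p0 dist_norm)
  qed
qed

lemma continuous_on_logdiff_compose:
  fixes D :: "(complex ^ 'n) set"
  assumes "lineconv D" "\<And>x y. cmod (f x - f y) \<le> C * norm (x - y)"
    and "continuous_on S g" "continuous_on S h" "\<And>s. s \<in> S \<Longrightarrow> nz_on_line D f (g s) (h s)"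
  shows "continuous_on S (\<lambda>s. logdiff D f (g s) (h s))"
proof -
  have "(\<lambda>s. (g s, h s)) ` S \<subseteq> {p. nz_on_line D f (fst p) (snd p)}"
    using assms(5) by auto
  from continuous_on_compose2[OF continuous_on_logdiff[OF assms(1,2)] continuous_on_Pair[OF assms(3,4)] this]
  show ?thesis by simp
qed

text \<open>The substitute for connectedness: any two points of \<open>E\<close> are joined inside
  \<open>E\<close> by a full slice of \<open>D\<close>, and such slices are connected when
  \<open>D\<close> satisfies \<open>lineconv\<close>. It is applied to level sets, to fibres of
  quotients of functionals, and to \<open>D\<close> itself.\<close>

definition line_closed :: "(complex ^ 'n) set \<Rightarrow> (complex ^ 'n) set \<Rightarrow> bool" where
  "line_closed D E \<longleftrightarrow> E \<subseteq> D \<and> (\<forall>x\<in>E. \<forall>y\<in>E. \<forall>t\<in>trace_set D x y. x + t *s (y - x) \<in> E)"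

lemma line_closed_nz_on_line:
  assumes "line_closed D E" "\<And>x. x \<in> E \<Longrightarrow> f x \<noteq> 0" "x \<in> E" "y \<in> E"
  shows "nz_on_line D f x y"
  using assms by (auto simp: line_closed_def nz_on_line_def)

text \<open>The slice through \<open>x\<close> and \<open>y\<close> lies in \<open>E\<close> and is
  connected, so the discreteness of the fibres of \<open>exp\<close> applies along it.\<close>

lemma const_on_line_closed:
  fixes g :: "complex ^ 'n \<Rightarrow> complex"
  assumes "lineconv D" "line_closed D E" "continuous_on E g" "\<And>x. x \<in> E \<Longrightarrow> exp (g x) = c"
    and xy: "x \<in> E" "y \<in> E"
  shows "g x = g y"
proof -
  have D: "x \<in> D" "y \<in> D" using assms(2) xy by (auto simp: line_closed_def)
  have "(\<lambda>t. g (x + t *s (y - x))) 0 = (\<lambda>t. g (x + t *s (y - x))) 1"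
  proof (rule exp_const_imp_const[where c = c and S = "trace_set D x y" and g = "\<lambda>t. g (x + t *s (y - x))"])
    show "continuous_on (trace_set D x y) (\<lambda>t. g (x + t *s (y - x)))"
      by (rule continuous_on_compose2[OF assms(3)])
        (use assms(2) xy in \<open>auto simp: line_closed_def intro!: continuous_intros\<close>)
  qed (use trace_set[OF assms(1) D(1), of y] D assms(2,4) xy in \<open>auto simp: line_closed_def\<close>)
  then show ?thesis by simp
qed

text \<open>The three points need not be collinear. As \<open>w\<close> runs through the slice of
  \<open>y\<close> and \<open>z\<close>, the increment from \<open>x\<close> to \<open>w\<close>
  varies continuously and is a logarithm of \<open>f w / f x\<close>; by uniqueness its own
  increment from \<open>y\<close> to \<open>z\<close> is \<open>logdiff D f y z\<close>. This
  cocycle identity is the replacement for a homotopy argument in \<open>D\<close>.\<close>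

lemma logdiff_add:
  fixes D :: "(complex ^ 'n) set"
  assumes D: "lineconv D" and f: "\<And>x y. cmod (f x - f y) \<le> C * norm (x - y)"
    and cf: "continuous_on D f"
    and E: "line_closed D E" "\<And>x. x \<in> E \<Longrightarrow> f x \<noteq> 0" and xyz: "x \<in> E" "y \<in> E" "z \<in> E"
  shows "logdiff D f x y + logdiff D f y z = logdiff D f x z"
proof -
  note nz = line_closed_nz_on_line[OF E]
  let ?g = "\<lambda>t. logdiff D f x (y + t *s (z - y))"
  have inE: "y + t *s (z - y) \<in> E" if "t \<in> trace_set D y z" for t
    using that E(1) xyz by (auto simp: line_closed_def)
  have "logdiff D f y z = ?g 1 - ?g 0"
  proof (rule logdiff_unique[OF D _ cf, where c = "1 / f x"])
    show "continuous_on (trace_set D y z) ?g"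
      by (rule continuous_on_logdiff_compose[OF D f])
        (use inE xyz nz in \<open>auto intro!: continuous_intros\<close>)
    show "exp (?g t) = 1 / f x * f (y + t *s (z - y))" if "t \<in> trace_set D y z" for t
      using exp_logdiff[OF D nz[OF _ xyz(1) inE[OF that]] cf] by simp
  qed (use nz xyz in auto)
  then show ?thesis by simp
qed

section \<open>Linear convexity\<close>

lemma clinear_fun_lipschitz:
  assumes "clinear_fun l"
  obtains C where "\<And>x y. cmod (l x - l y) \<le> C * norm (x - y)"
proof -
  obtain C where "\<And>x. cmod (l x) \<le> norm x * C"
    using bounded_linear.bounded[OF clinear_fun_bounded_linear[OF assms]] by blast
  then have "cmod (l x - l y) \<le> C * norm (x - y)" for x y
    by (metis clinear_fun_diff[OF assms] mult.commute)
  then show ?thesis by (rule that)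
qed

lemma clinear_fun_continuous_on:
  "clinear_fun l \<Longrightarrow> continuous_on S l"
  by (intro linear_continuous_on clinear_fun_bounded_linear)

lemma clinear_fun_nth: "clinear_fun (\<lambda>x. x $ i)"
  by (rule clinear_funI) auto

lemma clinear_fun_sub_scale:
  "clinear_fun a \<Longrightarrow> clinear_fun b \<Longrightarrow> clinear_fun (\<lambda>x. a x - c * b x)"
  by (rule clinear_funI) (auto simp: clinear_fun_add clinear_fun_scale algebra_simps)

lemma line_closed_fibre:
  assumes W: "vec.subspace W" and l: "clinear_fun a" "clinear_fun b"
  shows "line_closed D {w \<in> D \<inter> W. b w = c * a w}"
  unfolding line_closed_def trace_set_def
  by (auto simp: clinear_fun_add[OF l(1)] clinear_fun_add[OF l(2)] clinear_fun_scale[OF l(1)]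
      clinear_fun_scale[OF l(2)] clinear_fun_diff[OF l(1)] clinear_fun_diff[OF l(2)] algebra_simps
      simp del: vec.scale_right_diff_distrib
      intro!: vec.subspace_add[OF W] vec.subspace_scale[OF W] vec.subspace_diff[OF W])

text \<open>Sliding along \<open>e\<close> changes \<open>b\<close> but not \<open>a\<close>, so a
  point over \<open>y0\<close> extends to a section of \<open>b / a\<close> over nearby
  \<open>y\<close>, which stays in the open set \<open>D\<close> for a while.\<close>

lemma fibre_section:
  assumes W: "vec.subspace W" and l: "clinear_fun a" "clinear_fun b"
    and e: "e \<in> W" "a e = 0" "b e = 1" and w: "w \<in> W" "b w = y0 * a w"
  shows "w + ((y - y0) * a w) *s e \<in> W"
    "b (w + ((y - y0) * a w) *s e) = y * a (w + ((y - y0) * a w) *s e)"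
proof -
  show "w + ((y - y0) * a w) *s e \<in> W"
    by (intro vec.subspace_add[OF W] vec.subspace_scale[OF W] e w)
  show "b (w + ((y - y0) * a w) *s e) = y * a (w + ((y - y0) * a w) *s e)"
    unfolding clinear_fun_add[OF l(1)] clinear_fun_add[OF l(2)] clinear_fun_scale[OF l(1)]
      clinear_fun_scale[OF l(2)] e w by (simp add: algebra_simps)
qed

text \<open>The fibres of \<open>b / a\<close> carry logarithms of \<open>a\<close>, unique up to a constant.  Averaging \<open>logdiff\<close> over
  finitely many local sections (a partition of unity in the base disc) normalises them to \<open>N\<close>;
  then \<open>a * exp (- N)\<close> descends to a zero-free function on the closed disc, which has a logarithm.\<close>

lemma log_on_fibred_part:
  fixes D W :: "(complex ^ 'n) set"
  assumes D: "lineconv D" and W: "vec.subspace W" and l: "clinear_fun a" "clinear_fun b"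
    and nz: "\<And>w. w \<in> D \<inter> W \<Longrightarrow> a w \<noteq> 0 \<or> b w \<noteq> 0"
    and e: "e \<in> W" "a e = 0" "b e = 1"
    and fib: "\<And>y. \<exists>w\<in>D \<inter> W. b w = y * a w"
  obtains A where "continuous_on {w \<in> D \<inter> W. cmod (b w) \<le> cmod (a w)} A"
    "\<And>w. w \<in> D \<inter> W \<Longrightarrow> cmod (b w) \<le> cmod (a w) \<Longrightarrow> exp (A w) = a w"
proof -
  define E where "E y = {w \<in> D \<inter> W. b w = y * a w}" for y
  define S where "S = {w \<in> D \<inter> W. cmod (b w) \<le> cmod (a w)}"
  obtain C where C: "\<And>x y. cmod (a x - a y) \<le> C * norm (x - y)"
    by (rule clinear_fun_lipschitz[OF l(1)]) (rule that)
  have ca: "continuous_on T a" and cb: "continuous_on T b" for T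
    using l by (auto intro: clinear_fun_continuous_on)
  have lc: "line_closed D (E y)" for y
    unfolding E_def by (rule line_closed_fibre[OF W l])
  have aE: "a w \<noteq> 0" if "w \<in> E y" for w y
    using that nz by (auto simp: E_def)
  have aS: "a w \<noteq> 0" if "w \<in> S" for w
    using that nz by (auto simp: S_def)
  have S_E: "w \<in> E (b w / a w) \<and> b w / a w \<in> cball 0 1" if "w \<in> S" for w
    using that aS[OF that] by (auto simp: S_def E_def norm_divide)
  have E_S: "w \<in> S \<and> b w / a w = y" if "w \<in> E y" "y \<in> cball 0 1" for w y
    using that aE[OF that(1)] by (auto simp: S_def E_def norm_mult mult_left_le_one_le)
  have cy: "continuous_on S (\<lambda>w. b w / a w)"
    by (intro continuous_on_divide ca cb) (use aS in auto)
  have "\<exists>w r. r > 0 \<and> (\<forall>y\<in>cball y0 r. w + ((y - y0) * a w) *s e \<in> E y)" for y0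
  proof -
    obtain w where w: "w \<in> E y0" using fib[of y0] by (auto simp: E_def)
    have "open ((\<lambda>y. w + ((y - y0) * a w) *s e) -` D)"
      using D by (auto simp: lineconv_def intro!: open_vimage continuous_intros)
    moreover have "y0 \<in> (\<lambda>y. w + ((y - y0) * a w) *s e) -` D"
      using w by (auto simp: E_def)
    ultimately obtain r where r: "r > 0" "cball y0 r \<subseteq> (\<lambda>y. w + ((y - y0) * a w) *s e) -` D"
      using open_contains_cball by metis
    have "w + ((y - y0) * a w) *s e \<in> E y" if "y \<in> cball y0 r" for y
      using fibre_section[OF W l e, of w y0 y] r(2) that w unfolding E_def by blast
    then show ?thesis using r(1) by blast
  qed
  then obtain s r where r: "\<And>y0. r y0 > 0"
    and s: "\<And>y0 y. y \<in> cball y0 (r y0) \<Longrightarrow> s y0 + ((y - y0) * a (s y0)) *s e \<in> E y"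
    by metis
  define q where "q y0 y = s y0 + ((y - y0) * a (s y0)) *s e" for y0 y
  have qE: "q y0 y \<in> E y" if "y \<in> cball y0 (r y0)" for y0 y
    using s[OF that] by (simp add: q_def)
  have cq: "continuous_on T (q y0)" for T y0
    unfolding q_def by (intro continuous_intros)
  have "cball 0 1 \<subseteq> (\<Union>y0\<in>cball 0 1. ball y0 (r y0))" using r by auto
  then obtain I where I: "finite I" "cball 0 1 \<subseteq> (\<Union>y0\<in>I. ball y0 (r y0))"
    by (rule compactE_image[OF compact_cball open_ball])
  \<comment> \<open>Unnormalised partition of unity: the bump at \<open>y0\<close> vanishes exactly
    where the section \<open>q y0\<close> is no longer guaranteed to stay in
    \<open>D\<close>.\<close>
  define \<omega> where "\<omega> y0 y = max 0 (r y0 - dist y0 y)" for y0 y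
  define \<Omega> where "\<Omega> y = (\<Sum>y0\<in>I. \<omega> y0 y)" for y
  have \<omega>0: "\<omega> y0 y \<ge> 0" for y0 y by (simp add: \<omega>_def)
  have \<Omega>pos: "\<Omega> y > 0" if y: "y \<in> cball 0 1" for y
  proof -
    obtain y0 where "y0 \<in> I" "y \<in> ball y0 (r y0)" using I(2) y by blast
    then show ?thesis
      unfolding \<Omega>_def using I(1) \<omega>0 by (intro sum_pos2[of _ y0]) (auto simp: \<omega>_def)
  qed
  have c\<omega>: "continuous_on T (\<omega> y0)" for T y0
    unfolding \<omega>_def by (intro continuous_intros)
  have c\<Omega>: "continuous_on T \<Omega>" for T
    unfolding \<Omega>_def by (intro continuous_intros c\<omega>)
  \<comment> \<open>The default 0 outside the ball glues continuously, because
    \<open>\<omega> y0\<close> vanishes on the bounding sphere.\<close>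
  define trm where "trm y0 w = (let y = b w / a w in
      if y \<in> cball y0 (r y0) then of_real (\<omega> y0 y) * logdiff D a (q y0 y) w else 0)" for y0 w
  define N where "N w = (\<Sum>y0\<in>I. trm y0 w) / of_real (\<Omega> (b w / a w))" for w
  have ctrm: "continuous_on S (trm y0)" for y0
  proof -
    let ?y = "\<lambda>w. b w / a w"
    let ?T = "S \<inter> ?y -` cball y0 (r y0)" and ?U = "S \<inter> ?y -` (- ball y0 (r y0))"
    have S: "?T \<union> ?U = S" by auto
    have "continuous_on (?T \<union> ?U) (trm y0)"
      unfolding trm_def Let_def
    proof (rule continuous_on_cases_local; (unfold S)?)
      show "closedin (top_of_set S) ?T" "closedin (top_of_set S) ?U"
        by (intro continuous_closedin_preimage[OF cy]; simp add: closed_Compl)+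
      have cyT: "continuous_on ?T ?y" by (rule continuous_on_subset[OF cy]) auto
      have "continuous_on ?T (\<lambda>w. logdiff D a (q y0 (?y w)) w)"
      proof (rule continuous_on_logdiff_compose[OF D C])
        show "continuous_on ?T (\<lambda>w. q y0 (?y w))"
          by (rule continuous_on_compose2[OF cq[of UNIV] cyT]) simp
        fix w assume w: "w \<in> ?T"
        show "nz_on_line D a (q y0 (?y w)) w"
          by (rule line_closed_nz_on_line[OF lc[of "?y w"]]) (use aE qE S_E w in blast)+
      qed (rule continuous_on_id)
      then show "continuous_on ?T (\<lambda>w. of_real (\<omega> y0 (?y w)) * logdiff D a (q y0 (?y w)) w)"
        by (intro continuous_on_mult continuous_on_of_real continuous_on_compose2[OF c\<omega>[of UNIV] cyT]) simp
    qed (auto simp: \<omega>_def)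
    then show ?thesis by (simp only: S)
  qed
  have cN: "continuous_on S N"
    unfolding N_def
    by (intro continuous_intros ctrm continuous_on_compose2[OF c\<Omega>[of UNIV] cy])
      (use \<Omega>pos S_E in force)+
  \<comment> \<open>The weights depend on \<open>y\<close> only, and additivity removes the base
    point \<open>q y0 y\<close> from each difference. So the average \<open>N\<close> has the
    increments of a logarithm of \<open>a\<close> on every fibre.\<close>
  have Nadd: "N w' - N w = logdiff D a w w'" if w: "w \<in> E y" "w' \<in> E y" and y: "y \<in> cball 0 1" for w w' y
  proof -
    have yw: "b w / a w = y" "b w' / a w' = y" using E_S[OF _ y] w by auto
    have "trm y0 w' - trm y0 w = of_real (\<omega> y0 y) * logdiff D a w w'" for y0
    proof (cases "y \<in> cball y0 (r y0)")
      case True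
      have "logdiff D a (q y0 y) w + logdiff D a w w' = logdiff D a (q y0 y) w'"
        by (rule logdiff_add[OF D C ca lc aE qE[OF True] w])
      then show ?thesis using True by (simp add: trm_def yw algebra_simps flip: distrib_left)
    next
      case False
      then show ?thesis by (simp add: trm_def yw \<omega>_def)
    qed
    then have "N w' - N w = (\<Sum>y0\<in>I. of_real (\<omega> y0 y) * logdiff D a w w') / of_real (\<Omega> y)"
      by (simp add: N_def yw flip: diff_divide_distrib sum_subtractf)
    also have "\<dots> = logdiff D a w w'"
      using \<Omega>pos[OF y] by (simp add: \<Omega>_def flip: sum_distrib_right of_real_sum)
    finally show ?thesis .
  qed
  define c' where "c' w = a w * exp (- N w)" for w
  have c'eq: "c' w' = c' w" if w: "w \<in> E y" "w' \<in> E y" and y: "y \<in> cball 0 1" for w w' y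
  proof -
    have nzl: "nz_on_line D a w w'"
      by (rule line_closed_nz_on_line[OF lc[of y]]) (use aE w in blast)+
    have "N w' = N w + logdiff D a w w'" using Nadd[OF that] by (simp add: algebra_simps)
    then have "exp (N w') = exp (N w) * (a w' / a w)"
      by (simp only: exp_add exp_logdiff[OF D nzl ca])
    then show ?thesis
      using aE[OF w(1)] aE[OF w(2)] by (simp add: c'_def exp_minus divide_inverse)
  qed
  have cc': "continuous_on S c'"
    unfolding c'_def by (intro continuous_intros ca cN)
  \<comment> \<open>\<open>c'\<close> is constant on fibres, so an arbitrary point of the fibre
    serves; continuity of \<open>c\<close> is then seen by evaluating \<open>c'\<close> on a local
    section instead.\<close>
  define c where "c y = c' (SOME w. w \<in> E y)" for y
  have c: "c y = c' w" if "w \<in> E y" "y \<in> cball 0 1" for w y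
    using c'eq[OF that(1) _ that(2)] someI[of "\<lambda>w. w \<in> E y", OF that(1)] by (simp add: c_def)
  have c_nz: "c y \<noteq> 0" if "y \<in> cball 0 1" for y
  proof -
    obtain w where "w \<in> E y" using fib[of y] by (auto simp: E_def)
    then show ?thesis using c[OF _ that] aE by (auto simp: c'_def)
  qed
  have "continuous_on (cball 0 1) c"
    unfolding continuous_on_eq_continuous_within
  proof
    fix y1 :: complex assume y1: "y1 \<in> cball 0 1"
    obtain y0 where y0: "y1 \<in> ball y0 (r y0)" using I(2) y1 by blast
    let ?T = "cball 0 1 \<inter> ball y0 (r y0)"
    have "continuous_on ?T (\<lambda>y. c' (q y0 y))"
    proof (rule continuous_on_compose2[OF cc' cq], intro image_subsetI)
      fix y assume "y \<in> ?T"
      then have "y \<in> cball y0 (r y0)" "y \<in> cball 0 1" by auto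
      then show "q y0 y \<in> S" using E_S qE by blast
    qed
    moreover have "c' (q y0 y) = c y" if "y \<in> ?T" for y
      using that by (intro c[symmetric] qE) auto
    ultimately have "continuous_on ?T c" by (rule continuous_on_eq)
    then have "continuous (at y1 within ?T) c"
      using y0 y1 by (simp add: continuous_on_eq_continuous_within)
    moreover have "at y1 within ?T = at y1 within cball 0 1"
      using y0 by (intro at_within_nhd[of _ "ball y0 (r y0)"]) auto
    ultimately show "continuous (at y1 within cball 0 1) c" by simp
  qed
  then obtain h where h: "continuous_on (cball 0 1) h" "\<And>y. y \<in> cball 0 1 \<Longrightarrow> c y = exp (h y)"
    by (rule continuous_logarithm_on_cball) (use c_nz that in auto)
  show ?thesis
  proof (rule that[of "\<lambda>w. N w + h (b w / a w)"]; (fold S_def)?)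
    show "continuous_on S (\<lambda>w. N w + h (b w / a w))"
      by (intro continuous_intros cN continuous_on_compose2[OF h(1) cy]) (use S_E in auto)
    fix w assume "w \<in> D \<inter> W" "cmod (b w) \<le> cmod (a w)"
    then have w: "w \<in> S" by (simp add: S_def)
    then have "exp (h (b w / a w)) = a w * exp (- N w)"
      using h(2)[of "b w / a w"] c[of w "b w / a w"] S_E[OF w] by (simp add: c'_def)
    then show "exp (N w + h (b w / a w)) = a w"
      by (simp add: exp_add exp_minus)
  qed
qed

text \<open>The imaginary part of such a logarithm would be a continuous argument, so the identity
  of the circle would be null-homotopic and the circle contractible.\<close>

lemma no_log_on_circle:
  "\<not> (\<exists>g. continuous_on (sphere 0 1) g \<and> (\<forall>y\<in>sphere 0 1. exp (g y) = (y :: complex)))"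
proof
  assume "\<exists>g. continuous_on (sphere 0 1) g \<and> (\<forall>y\<in>sphere 0 1. exp (g y) = (y :: complex))"
  then obtain g where g: "continuous_on (sphere 0 1) g" "\<And>y::complex. y \<in> sphere 0 1 \<Longrightarrow> exp (g y) = y"
    by blast
  have "\<exists>c. homotopic_with_canon (\<lambda>h. True) (sphere 0 1) (sphere 0 1) (\<lambda>y::complex. y) (\<lambda>t. c)"
    unfolding inessential_eq_continuous_logarithm_circle
  proof (intro exI[of _ "\<lambda>y. Im (g y)"] conjI ballI)
    show "continuous_on (sphere 0 1) (\<lambda>y. Im (g y))"
      by (intro continuous_intros g)
    fix y :: complex assume y: "y \<in> sphere 0 1"
    have "exp (Re (g y)) = 1" using g(2)[OF y] y by (metis mem_sphere_0 norm_exp_eq_Re)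
    then have "Re (g y) = 0" by simp
    then have "g y = \<i> * of_real (Im (g y))" by (simp add: complex_eq_iff)
    then show "y = exp (\<i> * of_real (Im (g y)))" using g(2)[OF y] by simp
  qed
  then have "contractible (sphere (0::complex) 1)"
    by (simp add: contractible_def id_def)
  then show False by (simp add: contractible_sphere)
qed

text \<open>Otherwise logarithms of \<open>a\<close> over \<open>|b/a| \<le> 1\<close> and of \<open>b\<close> over \<open>|a/b| \<le> 1\<close> would differ by a continuous
  logarithm on the unit circle: the tautological bundle on the projective line is not trivial.\<close>

lemma missing_fibre:
  fixes D W :: "(complex ^ 'n) set"
  assumes D: "lineconv D" and W: "vec.subspace W" and l: "clinear_fun a" "clinear_fun b"
    and nz: "\<And>w. w \<in> D \<inter> W \<Longrightarrow> a w \<noteq> 0 \<or> b w \<noteq> 0"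
    and fib: "\<And>y. \<exists>w\<in>D \<inter> W. b w = y * a w"
    and fib': "\<exists>w\<in>D \<inter> W. a w = 0"
  shows False
proof -
  obtain u where u: "u \<in> D \<inter> W" "a u = 0" using fib' by blast
  obtain v where v: "v \<in> D \<inter> W" "b v = 0" using fib[of 0] by auto
  have uv: "b u \<noteq> 0" "a v \<noteq> 0" using nz[of u] nz[of v] u v by auto
  define e where "e = (1 / b u) *s u"
  have e: "e \<in> W" "a e = 0" "b e = 1"
    using u uv by (auto simp: e_def clinear_fun_scale[OF l(1)] clinear_fun_scale[OF l(2)]
        intro: vec.subspace_scale[OF W])
  have e': "(1 / a v) *s v \<in> W" "b ((1 / a v) *s v) = 0" "a ((1 / a v) *s v) = 1"
    using v uv by (auto simp: clinear_fun_scale[OF l(1)] clinear_fun_scale[OF l(2)]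
        intro: vec.subspace_scale[OF W])
  obtain A where A: "continuous_on {w \<in> D \<inter> W. cmod (b w) \<le> cmod (a w)} A"
    "\<And>w. w \<in> D \<inter> W \<Longrightarrow> cmod (b w) \<le> cmod (a w) \<Longrightarrow> exp (A w) = a w"
    by (rule log_on_fibred_part[OF D W l nz e fib]) (assumption, rule that)
  have nz': "b w \<noteq> 0 \<or> a w \<noteq> 0" if "w \<in> D \<inter> W" for w using nz[OF that] by auto
  \<comment> \<open>Fibres of \<open>a / b\<close> are those of \<open>b / a\<close> with
    \<open>y\<close> inverted; the fibre over 0 is the one at infinity, supplied by
    \<open>fib'\<close>.\<close>
  have fib2: "\<exists>w\<in>D \<inter> W. a w = y * b w" for y
  proof (cases "y = 0")
    case True then show ?thesis using u by auto
  next
    case False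
    obtain w where "w \<in> D \<inter> W" "b w = (1 / y) * a w" using fib[of "1 / y"] by auto
    then show ?thesis using False by (intro bexI[of _ w]) auto
  qed
  obtain B where B: "continuous_on {w \<in> D \<inter> W. cmod (a w) \<le> cmod (b w)} B"
    "\<And>w. w \<in> D \<inter> W \<Longrightarrow> cmod (a w) \<le> cmod (b w) \<Longrightarrow> exp (B w) = b w"
    by (rule log_on_fibred_part[OF D W l(2,1) nz' e' fib2]) (assumption, rule that)
  define E where "E y = {w \<in> D \<inter> W. b w = y * a w}" for y
  have aE: "a w \<noteq> 0" if "w \<in> E y" for w y
    using that nz by (auto simp: E_def)
  have lc: "line_closed D (E y)" for y
    unfolding E_def by (rule line_closed_fibre[OF W l])
  define S where "S = {w \<in> D \<inter> W. cmod (b w) = cmod (a w)}"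
  define g where "g w = B w - A w" for w
  have cg: "continuous_on S g"
    unfolding g_def
    by (intro continuous_on_diff continuous_on_subset[OF A(1)] continuous_on_subset[OF B(1)])
      (auto simp: S_def)
  have ES: "E y \<subseteq> S" if "y \<in> sphere 0 1" for y
    using that by (auto simp: E_def S_def norm_mult)
  have expg: "exp (g w) = y" if "w \<in> E y" "y \<in> sphere 0 1" for w y
  proof -
    have "w \<in> D \<inter> W" "cmod (b w) = cmod (a w)" using that ES by (auto simp: S_def)
    then have "exp (g w) = b w / a w"
      using A(2)[of w] B(2)[of w] by (simp add: g_def exp_diff)
    then show ?thesis using that aE by (auto simp: E_def)
  qed
  \<comment> \<open>On a fibre over the circle \<open>g\<close> is a continuous logarithm of the
    fixed number \<open>y\<close>, hence constant, and so descends to a function of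
    \<open>y\<close>.\<close>
  have gconst: "g w' = g w" if "w \<in> E y" "w' \<in> E y" "y \<in> sphere 0 1" for w w' y
    by (rule const_on_line_closed[OF D lc continuous_on_subset[OF cg ES] expg]) (use that in auto)
  define h where "h y = g (SOME w. w \<in> E y)" for y
  have h: "h y = g w" if "w \<in> E y" "y \<in> sphere 0 1" for w y
    using gconst[OF that(1) _ that(2)] someI[of "\<lambda>w. w \<in> E y", OF that(1)] by (simp add: h_def)
  have "continuous_on (sphere 0 1) h"
    unfolding continuous_on_eq_continuous_within
  proof
    fix y0 :: complex assume y0: "y0 \<in> sphere 0 1"
    obtain w where w: "w \<in> E y0" using fib[of y0] by (auto simp: E_def)
    define q where "q y = w + ((y - y0) * a w) *s e" for y
    have cq: "continuous_on T q" for T unfolding q_def by (intro continuous_intros)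
    have oU: "open (q -` D)"
      using D cq by (auto simp: lineconv_def intro!: open_vimage)
    have y0U: "y0 \<in> q -` D" using w by (auto simp: E_def q_def)
    have qE: "q y \<in> E y" if "y \<in> q -` D" for y
      using fibre_section[OF W l e, of w y0 y] that w unfolding E_def q_def by blast
    let ?T = "sphere 0 1 \<inter> q -` D"
    have "continuous_on ?T (\<lambda>y. g (q y))"
      by (rule continuous_on_compose2[OF cg cq]) (use ES qE in blast)
    moreover have "g (q y) = h y" if "y \<in> ?T" for y
      using that by (intro h[symmetric] qE) auto
    ultimately have "continuous_on ?T h" by (rule continuous_on_eq)
    then have "continuous (at y0 within ?T) h"
      using y0U y0 by (simp add: continuous_on_eq_continuous_within)
    moreover have "at y0 within ?T = at y0 within sphere 0 1"
      using y0U oU by (intro at_within_nhd[of _ "q -` D"]) auto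
    ultimately show "continuous (at y0 within sphere 0 1) h" by simp
  qed
  moreover have "exp (h y) = y" if "y \<in> sphere 0 1" for y
  proof -
    obtain w where w: "w \<in> E y" using fib[of y] by (auto simp: E_def)
    then show ?thesis using h[OF w that] expg[OF w that] by simp
  qed
  ultimately show False using no_log_on_circle by blast
qed

text \<open>The coordinates have no common zero on \<open>D\<close> because \<open>0\<close> is not
  in \<open>D\<close>; take a smallest family with this property. If it had two members
  \<open>a\<close>, \<open>b\<close>, let \<open>W\<close> be the common kernel of the others. Then
  \<open>a\<close>, \<open>b\<close> have no common zero on the part of \<open>D\<close> in
  \<open>W\<close>, while minimality forces each single functional, in particular \<open>a\<close>
  and every \<open>b - y * a\<close>, to vanish somewhere there. So all fibres of
  \<open>b / a\<close>, including the one at infinity, are nonempty, against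
  \<open>missing_fibre\<close>.\<close>

theorem lineconv_supporting_functional:
  fixes D :: "(complex ^ 'n) set"
  assumes D: "lineconv D" "D \<noteq> {}" "0 \<notin> D"
  obtains l where "clinear_fun l" "\<And>w. w \<in> D \<Longrightarrow> l w \<noteq> 0"
proof -
  define P where "P k \<longleftrightarrow> (\<exists>F :: (complex ^ 'n \<Rightarrow> complex) set. finite F \<and> card F = k \<and>
    (\<forall>l\<in>F. clinear_fun l) \<and> (\<forall>w\<in>D. \<exists>l\<in>F. l w \<noteq> 0))" for k
  have "P (card (range (\<lambda>i::'n. \<lambda>x::complex ^ 'n. x $ i)))"
    unfolding P_def
  proof (intro exI conjI ballI)
    fix w assume "w \<in> D"
    then have "w \<noteq> 0" using D by auto
    then show "\<exists>l\<in>range (\<lambda>i::'n. \<lambda>x::complex ^ 'n. x $ i). l w \<noteq> 0"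
      by (auto simp: vec_eq_iff)
  qed (auto intro: clinear_fun_nth)
  then have PL: "P (Least P)" by (rule LeastI)
  then obtain F where F: "finite F" "card F = Least P" "\<And>l. l \<in> F \<Longrightarrow> clinear_fun l"
    "\<And>w. w \<in> D \<Longrightarrow> \<exists>l\<in>F. l w \<noteq> 0" unfolding P_def by auto
  have F_ne: "F \<noteq> {}" using F(4) D(2) by blast
  show ?thesis
  proof (cases "\<exists>l. F = {l}")
    case True
    then show ?thesis using that F by auto
  next
    case False
    then obtain a b where ab: "a \<in> F" "b \<in> F" "a \<noteq> b" using F_ne by blast
    define F' where "F' = F - {a, b}"
    have cF': "card F' + 2 = card F" "finite F'"
      using ab F(1) card_Diff_subset[of "{a,b}" F] card_mono[of F "{a,b}"]
      by (auto simp: F'_def)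
    define W where "W = {w. \<forall>l\<in>F'. l w = 0}"
    have lF': "clinear_fun l" if "l \<in> F'" for l using F(3) that by (auto simp: F'_def)
    have "l 0 = 0" "l x = 0 \<Longrightarrow> l y = 0 \<Longrightarrow> l (x + y) = 0" "l x = 0 \<Longrightarrow> l (c *s x) = 0"
      if "l \<in> F'" for l x y c
      using clinear_fun_0[OF lF'[OF that]] clinear_fun_add[OF lF'[OF that], of x y]
        clinear_fun_scale[OF lF'[OF that], of c x] by simp_all
    then have W: "vec.subspace W"
      unfolding vec.subspace_def W_def by blast
    have common_zero: "\<exists>w\<in>D \<inter> W. l w = 0" if l: "clinear_fun l" for l
    proof (rule ccontr)
      assume "\<not> ?thesis"
      then have *: "\<exists>l\<in>insert l F'. l w \<noteq> 0" if "w \<in> D" for w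
        using that by (auto simp: W_def)
      have "P (card (insert l F'))"
        unfolding P_def
      proof (intro exI conjI)
        show "\<forall>l\<in>insert l F'. clinear_fun l" using l lF' by blast
        show "\<forall>w\<in>D. \<exists>l\<in>insert l F'. l w \<noteq> 0" using * by blast
      qed (use cF' in auto)
      moreover have "card (insert l F') < Least P"
        using cF' by (simp add: card_insert_if flip: F(2))
      ultimately show False using not_less_Least by blast
    qed
    have l: "clinear_fun a" "clinear_fun b" using ab F(3) by auto
    have False
    proof (rule missing_fibre[OF D(1) W l])
      show "a w \<noteq> 0 \<or> b w \<noteq> 0" if "w \<in> D \<inter> W" for w
        using F(4)[of w] that by (auto simp: W_def F'_def)
      show "\<exists>w\<in>D \<inter> W. b w = y * a w" for y
        using common_zero[OF clinear_fun_sub_scale[OF l(2,1), of y]] by simp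
      show "\<exists>w\<in>D \<inter> W. a w = 0" by (rule common_zero[OF l(1)])
    qed
    then show ?thesis ..
  qed
qed

section \<open>Square roots of affine functions\<close>

lemma line_closed_level_set:
  assumes l: "clinear_fun l"
  shows "line_closed D {w \<in> D. l w = c}"
  unfolding line_closed_def trace_set_def
  by (auto simp: clinear_fun_add[OF l] clinear_fun_scale[OF l] clinear_fun_diff[OF l]
      simp del: vec.scale_right_diff_distrib)

text \<open>By continuity \<open>\<sigma> x / \<sigma> w\<close> has positive real part near
  \<open>w\<close>, so there it is the principal root of \<open>f x / f w\<close> and the chain rule
  applies.\<close>

lemma has_derivative_sqrt_branch:
  fixes f \<sigma> :: "complex ^ 'n \<Rightarrow> complex"
  assumes D: "open D" "w \<in> D" and \<sigma>: "continuous_on D \<sigma>" "\<And>x. x \<in> D \<Longrightarrow> (\<sigma> x)\<^sup>2 = f x"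
    and f: "(f has_derivative f') (at w)" "f w \<noteq> 0"
  shows "(\<sigma> has_derivative (\<lambda>X. f' X / (2 * \<sigma> w))) (at w)"
proof -
  have nz: "\<sigma> w \<noteq> 0" using \<sigma>(2)[OF D(2)] f(2) by auto
  have "isCont \<sigma> w" using \<sigma>(1) D by (simp add: continuous_on_eq_continuous_at)
  then have "((\<lambda>x. \<sigma> x / \<sigma> w) \<longlongrightarrow> \<sigma> w / \<sigma> w) (at w)"
    by (intro tendsto_intros) (use nz in \<open>auto simp: isCont_def\<close>)
  then have "((\<lambda>x. Re (\<sigma> x / \<sigma> w)) \<longlongrightarrow> 1) (at w)"
    using nz tendsto_Re by fastforce
  then have "\<forall>\<^sub>F x in at w. Re (\<sigma> x / \<sigma> w) > 0"
    by (rule order_tendstoD) simp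
  moreover have "\<forall>\<^sub>F x in at w. x \<in> D"
    using D by (rule eventually_at_in_open')
  ultimately have ev: "\<forall>\<^sub>F x in at w. \<sigma> w * csqrt (f x / f w) = \<sigma> x"
  proof eventually_elim
    case (elim x)
    have "csqrt ((\<sigma> x / \<sigma> w)\<^sup>2) = \<sigma> x / \<sigma> w"
      using elim by (intro csqrt_square) simp
    then show ?case
      using nz \<sigma>(2)[OF elim(2)] \<sigma>(2)[OF D(2)] by (simp add: power_divide)
  qed
  have "(csqrt has_field_derivative inverse (2 * csqrt 1)) (at (f w / f w))"
    using f(2) has_field_derivative_csqrt[of 1] by simp
  then have "((\<lambda>x. csqrt (f x / f w)) has_derivative (\<lambda>X. inverse (2 * csqrt 1) * (f' X / f w))) (at w)"
    unfolding has_field_derivative_def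
    by (rule has_derivative_compose[rotated, where f = "\<lambda>x. f x / f w"])
      (auto intro!: derivative_eq_intros f simp: f(2))
  then have "((\<lambda>x. \<sigma> w * csqrt (f x / f w)) has_derivative
      (\<lambda>X. \<sigma> w * (inverse (2 * csqrt 1) * (f' X / f w)))) (at w)"
    by (rule has_derivative_mult_right)
  moreover have "(\<lambda>X. \<sigma> w * (inverse (2 * csqrt 1) * (f' X / f w))) = (\<lambda>X. f' X / (2 * \<sigma> w))"
    using nz by (auto simp: fun_eq_iff power2_eq_square simp flip: \<sigma>(2)[OF D(2)])
  ultimately show ?thesis
    using has_derivative_transform_eventually[OF _ ev] f(2) nz by simp
qed

text \<open>A square root of \<open>1 - l\<close> is constant on the (line-closed) level sets of \<open>l\<close>; it maps the disc in the
  direction \<open>e\<close> onto a neighbourhood of \<open>1\<close>, so it omits the opposite neighbourhood of \<open>- 1\<close>.\<close>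

theorem lineconv_sqrt:
  fixes D :: "(complex ^ 'n) set"
  assumes D: "lineconv D" "z \<in> D" and l: "clinear_fun l" "\<And>w. w \<in> D \<Longrightarrow> l (w - z) \<noteq> 1"
    and e: "l e = 1" "\<And>t. cmod t < 1 \<Longrightarrow> z + t *s e \<in> D"
  obtains \<sigma> where "\<And>w. w \<in> D \<Longrightarrow> (\<sigma> has_derivative (\<lambda>X. - l X / (2 * \<sigma> w))) (at w)"
    "\<sigma> z = 1" "\<And>w. w \<in> D \<Longrightarrow> (\<sigma> w)\<^sup>2 = 1 - l (w - z)" "\<And>w. w \<in> D \<Longrightarrow> 2 / 5 \<le> cmod (\<sigma> w + 1)"
proof -
  define f where "f w = 1 - l (w - z)" for w
  have fnz: "f w \<noteq> 0" if "w \<in> D" for w using l(2)[OF that] by (simp add: f_def)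
  have fz: "f z = 1" by (simp add: f_def clinear_fun_0[OF l(1)])
  obtain C where C: "\<And>x y. cmod (l x - l y) \<le> C * norm (x - y)"
    by (rule clinear_fun_lipschitz[OF l(1)]) (rule that)
  have Cf: "cmod (f x - f y) \<le> C * norm (x - y)" for x y
    using C[of "y - z" "x - z"] by (simp add: f_def norm_minus_commute)
  have fder: "(f has_derivative (\<lambda>X. - l X)) (at w)" for w
    unfolding f_def
    by (auto intro!: derivative_eq_intros bounded_linear.has_derivative[OF clinear_fun_bounded_linear[OF l(1)]])
  have cf: "continuous_on T f" for T
    using fder by (intro has_derivative_continuous_on) (auto intro: has_derivative_at_withinI)
  have lcD: "line_closed D D" by (auto simp: line_closed_def trace_set_def)
  have nzD: "nz_on_line D f z w" if "w \<in> D" for w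
    by (rule line_closed_nz_on_line[OF lcD fnz D(2) that])
  define \<Lambda> where "\<Lambda> = logdiff D f z"
  have c\<Lambda>: "continuous_on D \<Lambda>"
    unfolding \<Lambda>_def by (intro continuous_on_logdiff_compose[OF D(1) Cf] continuous_intros nzD)
  have exp\<Lambda>: "exp (\<Lambda> w) = f w" if "w \<in> D" for w
    unfolding \<Lambda>_def using exp_logdiff[OF D(1) nzD[OF that] cf] fz by simp
  have \<Lambda>z: "\<Lambda> z = 0"
    using logdiff_add[OF D(1) Cf cf lcD fnz D(2) D(2) D(2)] by (simp add: \<Lambda>_def)
  define \<sigma> where "\<sigma> w = exp (\<Lambda> w / 2)" for w
  have c\<sigma>: "continuous_on D \<sigma>"
    unfolding \<sigma>_def by (intro continuous_intros c\<Lambda>) auto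
  have \<sigma>2: "(\<sigma> w)\<^sup>2 = f w" if "w \<in> D" for w
    using exp\<Lambda>[OF that] by (simp add: \<sigma>_def power2_eq_square flip: exp_add)
  have \<sigma>z: "\<sigma> z = 1" by (simp add: \<sigma>_def \<Lambda>z)
  \<comment> \<open>The radius \<open>2 / 5\<close> lies below \<open>sqrt 2 - 1\<close>: if
    \<open>\<sigma> w\<close> is that close to \<open>-1\<close>, then
    \<open>v = (1 + \<sigma> w) * (1 - \<sigma> w)\<close> has modulus at most
    \<open>24 / 25\<close>, so the unit disc in direction \<open>e\<close> meets the level set of
    \<open>l\<close> through \<open>w\<close>.\<close>
  have bound: "2 / 5 \<le> cmod (\<sigma> w + 1)" if w: "w \<in> D" for w
  proof (rule ccontr)
    assume "\<not> ?thesis"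
    then have s: "cmod (\<sigma> w + 1) < 2 / 5" by simp
    define v where "v = l (w - z)"
    have v: "v = (1 + \<sigma> w) * (1 - \<sigma> w)"
      using \<sigma>2[OF w] by (simp add: v_def f_def power2_eq_square algebra_simps)
    have "cmod (1 - \<sigma> w) \<le> 2 + 2 / 5"
    proof -
      have "1 - \<sigma> w = 2 - (\<sigma> w + 1)" by simp
      then show ?thesis using norm_triangle_ineq4[of 2 "\<sigma> w + 1"] s by simp
    qed
    then have "cmod v \<le> 2 / 5 * (2 + 2 / 5)"
      unfolding v norm_mult using s by (intro mult_mono) (auto simp: add.commute)
    then have v1: "cmod v < 1" by simp
    define w1 where "w1 = z + v *s e"
    have w1: "w1 \<in> D" "l w1 = l w"
      using e(2)[OF v1] by (auto simp: w1_def v_def clinear_fun_add[OF l(1)] clinear_fun_scale[OF l(1)]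
          clinear_fun_diff[OF l(1)] e(1))
    have fl: "f x = 1 - (l x - l z)" for x by (simp add: f_def clinear_fun_diff[OF l(1)])
    have "\<Lambda> w1 = \<Lambda> w"
    proof (rule const_on_line_closed[OF D(1) line_closed_level_set[OF l(1), of D "l w"]])
      show "continuous_on {x \<in> D. l x = l w} \<Lambda>" by (rule continuous_on_subset[OF c\<Lambda>]) auto
      show "exp (\<Lambda> x) = f w" if "x \<in> {x \<in> D. l x = l w}" for x
        using that exp\<Lambda> by (simp add: fl)
    qed (use w w1 in auto)
    have fe: "f (z + t *s e) = 1 - t" for t
      by (simp add: fl clinear_fun_add[OF l(1)] clinear_fun_scale[OF l(1)] e(1))
    have nonpos: "1 - t \<notin> \<real>\<^sub>\<le>\<^sub>0" if "cmod t < 1" for t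
      using that complex_Re_le_cmod[of t] by (auto simp: complex_nonpos_Reals_iff)
    \<comment> \<open>On the disc both terms are logarithms of \<open>1 - t\<close>, and both vanish
      at \<open>t = 0\<close>. Hence \<open>\<sigma> w\<close> is the principal root, with
      nonnegative real part, which contradicts its being near \<open>-1\<close>.\<close>
    have "\<Lambda> (z + v *s e) - Ln (1 - v) = \<Lambda> (z + 0 *s e) - Ln (1 - 0)"
    proof (rule exp_const_imp_const[where g = "\<lambda>t. \<Lambda> (z + t *s e) - Ln (1 - t)" and S = "ball 0 1" and c = 1])
      have "continuous_on (ball 0 1) (\<lambda>t. \<Lambda> (z + t *s e))"
        by (rule continuous_on_compose2[OF c\<Lambda>]) (auto intro!: continuous_intros e(2))
      moreover have "continuous_on (ball 0 1) (\<lambda>t::complex. Ln (1 - t))"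
        by (intro continuous_on_Ln' continuous_intros) (use nonpos in auto)
      ultimately show "continuous_on (ball 0 1) (\<lambda>t. \<Lambda> (z + t *s e) - Ln (1 - t))"
        by (intro continuous_on_diff)
      fix t :: complex assume "t \<in> ball 0 1"
      then have t: "cmod t < 1" by simp
      then have "1 - t \<noteq> 0" using nonpos[OF t] by auto
      then show "exp (\<Lambda> (z + t *s e) - Ln (1 - t)) = 1"
        using exp\<Lambda>[OF e(2)[OF t]] by (simp add: exp_diff fe)
    qed (use v1 in auto)
    then have "\<Lambda> w1 = Ln (1 - v)" by (simp add: w1_def \<Lambda>z)
    then have "\<sigma> w = csqrt (1 - v)"
      using \<open>\<Lambda> w1 = \<Lambda> w\<close> nonpos[OF v1] by (subst csqrt_exp_Ln) (auto simp: \<sigma>_def)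
    then have "Re (\<sigma> w) \<ge> 0" by (simp only: Re_csqrt)
    then have "1 \<le> Re (\<sigma> w + 1)" by simp
    then show False using s complex_Re_le_cmod[of "\<sigma> w + 1"] by linarith
  qed
  have "(\<sigma> has_derivative (\<lambda>X. - l X / (2 * \<sigma> w))) (at w)" if "w \<in> D" for w
    using D(1) that by (intro has_derivative_sqrt_branch[OF _ that c\<sigma> \<sigma>2 fder fnz])
      (auto simp: lineconv_def)
  then show ?thesis
    using that[of \<sigma>] \<sigma>z \<sigma>2 bound by (simp add: f_def)
qed

section \<open>Geometry of the adapted basis\<close>

lemma cinner_add_left: "cinner (x + y) w = cinner x w + cinner y w"
  by (simp add: cinner_def sum.distrib algebra_simps)

lemma cinner_scale_left: "cinner (c *s x) w = c * cinner x w"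
  by (simp add: cinner_def sum_distrib_left algebra_simps)

lemma cinner_scale_right: "cinner x (c *s y) = cnj c * cinner x y"
  by (simp add: cinner_def sum_distrib_left algebra_simps)

lemma cinner_commute: "cinner y x = cnj (cinner x y)"
  by (simp add: cinner_def algebra_simps)

lemma cinner_self: "cinner x x = of_real ((norm x)\<^sup>2)"
proof -
  have "cinner x x = (\<Sum>i\<in>UNIV. of_real ((cmod (x $ i))\<^sup>2))"
    unfolding cinner_def by (intro sum.cong refl) (simp only: complex_norm_square)
  also have "\<dots> = of_real ((norm x)\<^sup>2)"
    unfolding norm_vec_def L2_set_def by (subst real_sqrt_pow2) (auto intro: sum_nonneg)
  finally show ?thesis .
qed

lemma cinner_zero_left: "cinner 0 y = 0"
  by (simp add: cinner_def)

lemma cinner_sum_left: "cinner (\<Sum>i\<in>I. f i) y = (\<Sum>i\<in>I. cinner (f i) y)"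
  by (induction I rule: infinite_finite_induct) (simp_all add: cinner_zero_left cinner_add_left)

lemma norm_sq_orthonormal_pair:
  assumes "cinner u u = 1" "cinner v v = 1" "cinner u v = 0"
  shows "(norm (b *s u + c *s v))\<^sup>2 = (cmod b)\<^sup>2 + (cmod c)\<^sup>2"
proof -
  have vu: "cinner v u = 0" using assms(3) cinner_commute[of v u] by simp
  have R: "cinner x (y + w) = cinner x y + cinner x w" for x y w :: "complex ^ 'a"
    by (simp add: cinner_def sum.distrib algebra_simps)
  have "complex_of_real ((norm (b *s u + c *s v))\<^sup>2) = b * cnj b + c * cnj c"
    unfolding cinner_self[symmetric]
    by (simp add: R cinner_add_left cinner_scale_left cinner_scale_right assms vu)
  also have "\<dots> = of_real ((cmod b)\<^sup>2 + (cmod c)\<^sup>2)"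
    by (simp only: complex_norm_square of_real_add)
  finally show ?thesis by (simp only: of_real_eq_iff)
qed

lemma mem_Hsp: "x \<in> Hsp z a j \<longleftrightarrow> (\<forall>i\<in>{1..j}. cinner x (a i - z) = 0)"
proof (induction j)
  case (Suc j)
  have "x \<in> corth_compl (vec.span {v}) \<longleftrightarrow> cinner x v = 0" for v
  proof -
    have "cinner x v = 0" if "\<forall>y\<in>range (\<lambda>k. k *s v). cinner x y = 0"
      using that[rule_format, OF rangeI, of 1] by simp
    then show ?thesis
      unfolding corth_compl_def vec.span_singleton by (auto simp: cinner_scale_right simp del: vec.scale_right_diff_distrib)
  qed
  then show ?case
    using Suc by (auto simp: atLeastAtMostSuc_conv)
qed simp

lemma subspace_Hsp: "vec.subspace (Hsp z a j)"
  by (auto simp: vec.subspace_def mem_Hsp cinner_zero_left cinner_add_left cinner_scale_left)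

lemma Hsp_mono: "i \<le> j \<Longrightarrow> Hsp z a j \<subseteq> Hsp z a i"
  by (auto simp: mem_Hsp)

lemma Dslice_eq: "Dslice D z a j = D \<inter> (+) z ` Hsp z a j"
proof (induction j)
  case (Suc j)
  then show ?case using Hsp_mono[of j "Suc j" z a] by (auto simp: image_iff)
qed auto

locale adapted_point =
  fixes D :: "(complex ^ 'n) set" and z a
  assumes CC: "C_convex D" and zD: "z \<in> D" and ad: "adapted D z a"
begin

abbreviation dst :: "nat \<Rightarrow> real" where "dst j \<equiv> bd_dist D z a j"
abbreviation dir :: "nat \<Rightarrow> complex ^ 'n" where "dir j \<equiv> unit_dir z a j"

declare One_nat_def [simp del]

lemma lineconv_D: "lineconv D" by (rule C_convex_imp_lineconv[OF CC])

lemma open_D: "open D" using CC by (simp add: C_convex_def domain_in_def)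

text \<open>The slice is relatively open, so its relative frontier is disjoint from it while staying
  in the same affine space, hence lies outside \<open>D\<close>.\<close>

lemma rel_bd_subset: "rel_bd D z a j \<subseteq> (+) z ` Hsp z a (j - 1) - D"
proof -
  let ?M = "(+) z ` Hsp z a (j - 1)"
  have "openin (top_of_set ?M) (D \<inter> ?M)"
    using open_D by (auto simp: openin_open)
  then have "(top_of_set ?M) frontier_of (D \<inter> ?M) = (top_of_set ?M) closure_of (D \<inter> ?M) - (D \<inter> ?M)"
    by (simp add: frontier_of_def interior_of_openin)
  moreover have "(top_of_set ?M) closure_of (D \<inter> ?M) \<subseteq> ?M"
    using closure_of_subset_topspace[of "top_of_set ?M"] by simp
  ultimately show ?thesis unfolding rel_bd_def Dslice_eq by blast
qed

lemma bd_point: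
  assumes "j \<in> {1..CARD('n)}"
  shows "a j \<notin> D" "a j - z \<in> Hsp z a (j - 1)" "norm (a j - z) = dst j" "dst j > 0"
proof -
  have *: "a j \<in> rel_bd D z a j" "norm (a j - z) = dst j"
    using ad assms by (auto simp: adapted_def)
  then show "a j \<notin> D" "a j - z \<in> Hsp z a (j - 1)" "norm (a j - z) = dst j"
    using rel_bd_subset[of j] by auto
  then show "dst j > 0" using zD by (metis zero_less_norm_iff right_minus_eq)
qed

lemma dir_eq:
  assumes "j \<in> {1..CARD('n)}"
  shows "a j - z = of_real (dst j) *s dir j"
  using bd_point[OF assms] by (simp add: unit_dir_def flip: scaleR_vec_eq)

lemma dir_mem: "j \<in> {1..CARD('n)} \<Longrightarrow> dir j \<in> Hsp z a (j - 1)"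
  unfolding unit_dir_def scaleR_vec_eq
  by (rule vec.subspace_scale[OF subspace_Hsp bd_point(2)])

lemma norm_dir: "j \<in> {1..CARD('n)} \<Longrightarrow> norm (dir j) = 1"
  using bd_point[of j] by (simp add: unit_dir_def)

lemma cinner_dir_self: "j \<in> {1..CARD('n)} \<Longrightarrow> cinner (dir j) (dir j) = 1"
  by (simp add: cinner_self norm_dir)

lemma cinner_dir_less:
  assumes "j \<in> {1..CARD('n)}" "i \<in> {1..CARD('n)}" "i < j"
  shows "cinner (dir j) (dir i) = 0"
proof -
  have "cinner (dir j) (a i - z) = 0"
    using dir_mem[OF assms(1)] assms by (auto simp: mem_Hsp)
  then show ?thesis
    using bd_point(4)[OF assms(2)] by (simp add: dir_eq[OF assms(2)] cinner_scale_right)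
qed

lemma cinner_dir:
  assumes "j \<in> {1..CARD('n)}" "i \<in> {1..CARD('n)}" "i \<noteq> j"
  shows "cinner (dir j) (dir i) = 0"
proof (cases "i < j")
  case False
  then have "cinner (dir i) (dir j) = 0" using assms by (intro cinner_dir_less) auto
  then show ?thesis by (subst cinner_commute) simp
qed (use assms cinner_dir_less in auto)

lemma inj_dir: "inj_on dir {1..CARD('n)}"
proof (rule inj_onI, rule ccontr)
  fix i j assume *: "i \<in> {1..CARD('n)}" "j \<in> {1..CARD('n)}" "dir i = dir j" "i \<noteq> j"
  then have "cinner (dir i) (dir i) = 0" using cinner_dir[of i j] by simp
  then show False using cinner_dir_self[OF *(1)] by simp
qed

lemma independent_dir: "vec.independent (dir ` {1..CARD('n)})"
proof
  assume "vec.dependent (dir ` {1..CARD('n)})"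
  then obtain u j where u: "j \<in> {1..CARD('n)}" "u (dir j) \<noteq> 0" "(\<Sum>v\<in>dir ` {1..CARD('n)}. u v *s v) = 0"
    by (subst (asm) vec.dependent_finite) auto
  have "0 = cinner (\<Sum>i\<in>{1..CARD('n)}. u (dir i) *s dir i) (dir j)"
    using u(3) by (simp add: sum.reindex[OF inj_dir] cinner_zero_left)
  also have "\<dots> = (\<Sum>i\<in>{1..CARD('n)}. if i = j then u (dir j) else 0)"
    unfolding cinner_sum_left cinner_scale_left
    by (intro sum.cong refl) (use u(1) cinner_dir cinner_dir_self in auto)
  also have "\<dots> = u (dir j)" using u(1) by (subst sum.delta) auto
  finally show False using u(2) by simp
qed

lemma span_dir: "vec.span (dir ` {1..CARD('n)}) = UNIV"
proof -
  have "card (dir ` {1..CARD('n)}) = CARD('n)" by (simp add: card_image[OF inj_dir])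
  then have "UNIV \<subseteq> vec.span (dir ` {1..CARD('n)})"
    using vec.card_ge_dim_independent[OF subset_UNIV independent_dir] by (simp only: vec_dim_card)
  then show ?thesis by blast
qed

lemma coord_expansion: "(\<Sum>j\<in>{1..CARD('n)}. coord z a X j *s dir j) = X"
  using vec.sum_representation_eq[OF independent_dir, of X "dir ` {1..CARD('n)}"]
  by (simp add: sum.reindex[OF inj_dir] coord_def span_dir)

lemma clinear_fun_coord: "clinear_fun (\<lambda>X. coord z a X j)"
  by (rule clinear_funI)
    (simp_all add: coord_def vec.representation_add[OF independent_dir]
      vec.representation_scale[OF independent_dir] span_dir)

section \<open>The weighted sum of the theorem, as a norm\<close>

definition ssum :: "complex ^ 'n \<Rightarrow> real" where
  "ssum X = (\<Sum>j\<in>{1..CARD('n)}. cmod (coord z a X j) / dst j)"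

lemma term_le_ssum: "j \<in> {1..CARD('n)} \<Longrightarrow> cmod (coord z a X j) / dst j \<le> ssum X"
  unfolding ssum_def using bd_point(4)
  by (intro member_le_sum) (auto intro!: divide_nonneg_pos)

lemma ssum_nonneg: "ssum X \<ge> 0"
  unfolding ssum_def using bd_point(4) by (intro sum_nonneg divide_nonneg_pos) auto

lemma ssum_pos:
  assumes "X \<noteq> 0"
  shows "ssum X > 0"
proof (rule ccontr)
  assume "\<not> ?thesis"
  then have "cmod (coord z a X j) / dst j \<le> 0" if "j \<in> {1..CARD('n)}" for j
    using term_le_ssum[OF that, of X] by linarith
  then have "coord z a X j = 0" if "j \<in> {1..CARD('n)}" for j
    using that bd_point(4)[OF that] by (fastforce simp: divide_le_0_iff)
  then have "(\<Sum>j\<in>{1..CARD('n)}. coord z a X j *s dir j) = (\<Sum>j\<in>{1..CARD('n)}. 0)"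
    by (intro sum.cong) auto
  then show False using assms coord_expansion[of X] by simp
qed

lemma ssum_scale: "ssum (c *s X) = cmod c * ssum X"
  by (simp add: ssum_def clinear_fun_scale[OF clinear_fun_coord] norm_mult sum_distrib_left)

lemma ssum_triangle: "ssum (X + Y) \<le> ssum X + ssum Y"
proof -
  have "ssum (X + Y) \<le> (\<Sum>j\<in>{1..CARD('n)}. cmod (coord z a X j) / dst j + cmod (coord z a Y j) / dst j)"
    unfolding ssum_def clinear_fun_add[OF clinear_fun_coord] add_divide_distrib[symmetric]
    using bd_point(4) by (intro sum_mono divide_right_mono norm_triangle_ineq) (auto intro: less_imp_le)
  then show ?thesis by (simp add: ssum_def sum.distrib)
qed

lemma continuous_on_ssum: "continuous_on S ssum"
  unfolding ssum_def
  by (intro continuous_intros clinear_fun_continuous_on[OF clinear_fun_coord])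
    (use bd_point(4) in force)

text \<open>If the segment from \<open>z\<close> to \<open>z + x\<close> left \<open>D\<close>, it
  would cross the relative boundary at distance at most \<open>norm x\<close> from \<open>z\<close>,
  below the minimal distance \<open>dst j\<close>.\<close>

lemma Hsp_ball:
  assumes j: "j \<in> {1..CARD('n)}" and x: "x \<in> Hsp z a (j - 1)" "norm x < dst j"
  shows "z + x \<in> D"
proof (rule ccontr)
  assume n: "z + x \<notin> D"
  let ?M = "(+) z ` Hsp z a (j - 1)"
  define C where "C = (\<lambda>t::real. z + of_real t *s x) ` {0..1}"
  have "connected C"
    unfolding C_def by (intro connected_continuous_image continuous_intros) auto
  moreover have CM: "C \<subseteq> ?M"
    by (auto simp: C_def intro!: vec.subspace_scale[OF subspace_Hsp x(1)])
  ultimately have con: "connectedin (top_of_set ?M) C"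
    by (simp add: connectedin_subtopology)
  have "z \<in> C" unfolding C_def by (rule image_eqI[of _ _ 0]) simp_all
  moreover have "z + x \<in> C" unfolding C_def by (rule image_eqI[of _ _ 1]) simp_all
  ultimately have "C \<inter> Dslice D z a (j - 1) \<noteq> {}" "C - Dslice D z a (j - 1) \<noteq> {}"
    using zD n CM by (auto simp: Dslice_eq)
  from connectedin_Int_frontier_of[OF con this]
  obtain t :: real where t: "0 \<le> t" "t \<le> 1" "z + of_real t *s x \<in> rel_bd D z a j"
    by (auto simp: C_def rel_bd_def)
  have "dst j \<le> dist z (z + of_real t *s x)"
    unfolding bd_dist_def by (rule infdist_le[OF t(3)])
  also have "\<dots> = t * norm x"
    using t by (simp add: dist_norm norm_vec_scale)
  also have "\<dots> \<le> norm x" using t by (simp add: mult_left_le_one_le)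
  finally show False using x by simp
qed

lemma disc_in_D:
  assumes "j \<in> {1..CARD('n)}" "cmod t < dst j"
  shows "z + t *s dir j \<in> D"
  using assms norm_dir[OF assms(1)]
  by (intro Hsp_ball[OF assms(1)] vec.subspace_scale[OF subspace_Hsp dir_mem]) (auto simp: norm_vec_scale)

text \<open>\<open>D\<close> contains the disc of radius \<open>dst j\<close> in direction
  \<open>dir j\<close>, and a larger value of \<open>l (dir j)\<close> would make \<open>l\<close>
  equal to 1 inside that disc.\<close>

lemma functional_bound:
  assumes l: "clinear_fun l" "\<And>w. w \<in> D \<Longrightarrow> l (w - z) \<noteq> 1" and j: "j \<in> {1..CARD('n)}"
  shows "cmod (l (dir j)) \<le> 1 / dst j"
proof (rule ccontr)
  assume n: "\<not> ?thesis"
  have d: "dst j > 0" by (rule bd_point(4)[OF j])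
  then have p: "0 < 1 / dst j" "1 / dst j < cmod (l (dir j))" using n by auto
  then have nz: "cmod (l (dir j)) > 0" by linarith
  have "cmod (1 / l (dir j)) < dst j"
    using p d nz by (simp add: norm_divide field_simps)
  from l(2)[OF disc_in_D[OF j this]] nz show False
    by (simp add: clinear_fun_scale[OF l(1)])
qed

text \<open>Linear convexity after moving \<open>p\<close> to the origin, with the functional
  normalised so that its hyperplane through \<open>p\<close> is the level 1 seen from
  \<open>z\<close>.\<close>

lemma supporting_functional:
  assumes "p \<notin> D"
  obtains l where "clinear_fun l" "\<And>w. w \<in> D \<Longrightarrow> l (w - z) \<noteq> 1" "l (p - z) = 1"
proof -
  have "lineconv ((\<lambda>x. p + x) -` D)" by (rule lineconv_translate[OF lineconv_D])
  moreover have "z - p \<in> (\<lambda>x. p + x) -` D" using zD by simp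
  then have "(\<lambda>x. p + x) -` D \<noteq> {}" by blast
  moreover have "0 \<notin> (\<lambda>x. p + x) -` D" using assms by simp
  ultimately obtain m where m: "clinear_fun m" "\<And>w. w \<in> (\<lambda>x. p + x) -` D \<Longrightarrow> m w \<noteq> 0"
    by (rule lineconv_supporting_functional) (rule that)
  have nz: "m (p - z) \<noteq> 0"
    using m(2)[of "z - p"] zD by (simp add: clinear_fun_diff[OF m(1)])
  have "clinear_fun (\<lambda>x. m x / m (p - z))"
    by (rule clinear_funI) (simp_all add: clinear_fun_add[OF m(1)] clinear_fun_scale[OF m(1)] add_divide_distrib)
  moreover have "m (w - z) / m (p - z) \<noteq> 1" if "w \<in> D" for w
  proof
    assume "m (w - z) / m (p - z) = 1"
    then have "m (w - z) = m (p - z)" using nz by simp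
    then have "m (w - p) = 0" by (simp add: clinear_fun_diff[OF m(1)])
    then show False using m(2)[of "w - p"] that by simp
  qed
  ultimately show ?thesis using that nz by simp
qed

lemma clinear_fun_expansion:
  assumes "clinear_fun l"
  shows "l X = (\<Sum>j\<in>{1..CARD('n)}. coord z a X j * l (dir j))"
proof -
  have "l (\<Sum>j\<in>J. coord z a X j *s dir j) = (\<Sum>j\<in>J. coord z a X j * l (dir j))" for J
    by (induction J rule: infinite_finite_induct)
      (simp_all add: clinear_fun_0[OF assms] clinear_fun_add[OF assms] clinear_fun_scale[OF assms])
  then show ?thesis by (metis coord_expansion)
qed

lemma functional_le_ssum:
  assumes l: "clinear_fun l" "\<And>w. w \<in> D \<Longrightarrow> l (w - z) \<noteq> 1"
  shows "cmod (l X) \<le> ssum X"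
proof -
  have "cmod (l X) \<le> (\<Sum>j\<in>{1..CARD('n)}. cmod (coord z a X j * l (dir j)))"
    unfolding clinear_fun_expansion[OF l(1), of X] by (rule norm_sum)
  also have "\<dots> \<le> (\<Sum>j\<in>{1..CARD('n)}. cmod (coord z a X j) * (1 / dst j))"
    unfolding norm_mult by (intro sum_mono mult_left_mono functional_bound[OF l]) auto
  finally show ?thesis by (simp add: ssum_def)
qed

text \<open>Duality: a point outside \<open>D\<close> has a supporting functional equal to 1 there,
  but every functional avoiding the value 1 on \<open>D - z\<close> is dominated by
  \<open>ssum\<close>.\<close>

lemma ssum_ball_subset:
  assumes "ssum x < 1"
  shows "z + x \<in> D"
proof (rule ccontr)
  assume "z + x \<notin> D"
  then obtain l where l: "clinear_fun l" "\<And>w. w \<in> D \<Longrightarrow> l (w - z) \<noteq> 1" "l (z + x - z) = 1"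
    by (rule supporting_functional) (rule that)
  then show False using functional_le_ssum[OF l(1,2), of x] assms by simp
qed

text \<open>Both directions lie in \<open>Hsp z a (j - 1)\<close>, where \<open>D\<close> contains
  the ball of radius \<open>dst j\<close>. So \<open>l\<close> restricted to their span has norm at
  most \<open>1 / dst j\<close>; the value at \<open>dir j\<close> already exhausts it.\<close>

lemma functional_vanishes:
  assumes j: "j \<in> {1..CARD('n)}" "k \<in> {1..CARD('n)}" "j < k" and l: "clinear_fun l" "\<And>w. w \<in> D \<Longrightarrow> l (w - z) \<noteq> 1"
    and lj: "l (dir j) = 1 / dst j"
  shows "l (dir k) = 0"
proof (rule ccontr)
  assume nz: "l (dir k) \<noteq> 0"
  have d: "dst j > 0" by (rule bd_point(4)[OF j(1)])
  define b where "b = l (dir j)"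
  define u where "u = l (dir k)"
  define s where "s = (cmod b)\<^sup>2 + (cmod u)\<^sup>2"
  have b: "cmod b = 1 / dst j" using lj d by (simp add: b_def norm_divide)
  have s: "s > (1 / dst j)\<^sup>2" using nz b by (simp add: s_def u_def)
  moreover have "(1 / dst j)\<^sup>2 > 0" using d by simp
  ultimately have s0: "s > 0" by linarith
  define y where "y = cnj b *s dir j + cnj u *s dir k"
  \<comment> \<open>The point of least norm in the span of the two directions with
    \<open>l x = 1\<close>; its norm is \<open>1 / sqrt s\<close>.\<close>
  define x where "x = of_real (1 / s) *s y"
  have "dir k \<in> Hsp z a (j - 1)"
    using dir_mem[OF j(2)] Hsp_mono[OF diff_le_mono[OF less_imp_le[OF j(3)]]] by blast
  then have xH: "x \<in> Hsp z a (j - 1)"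
    unfolding x_def y_def
    by (intro vec.subspace_scale[OF subspace_Hsp] vec.subspace_add[OF subspace_Hsp] dir_mem[OF j(1)])
  have "(norm y)\<^sup>2 = s"
    unfolding y_def using norm_sq_orthonormal_pair[OF cinner_dir_self[OF j(1)] cinner_dir_self[OF j(2)]
        cinner_dir[OF j(1,2)], of "cnj b" "cnj u"] j(3) by (simp add: s_def)
  then have "(norm x)\<^sup>2 = 1 / s"
    using s0 by (simp add: x_def norm_vec_scale norm_divide power_divide power2_eq_square)
  also have "\<dots> < (dst j)\<^sup>2"
    using s s0 d by (simp add: field_simps)
  finally have "norm x < dst j" using d by (simp add: power_less_imp_less_base)
  from Hsp_ball[OF j(1) xH this] have "l x \<noteq> 1" using l(2) by force
  moreover have "l y = of_real s"
    by (simp only: y_def s_def clinear_fun_add[OF l(1)] clinear_fun_scale[OF l(1)] of_real_add complex_norm_square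
        flip: b_def u_def) (simp add: mult.commute)
  then have "l x = 1" using s0 by (simp add: x_def clinear_fun_scale[OF l(1)])
  ultimately show False by simp
qed

text \<open>Forward substitution in a triangular system: the terms with \<open>k > j\<close> vanish,
  and the coefficients with \<open>k < j\<close> are bounded by \<open>1 / dst k\<close>. With
  \<open>m\<close> the maximum of the \<open>cmod (l j X)\<close>, the \<open>j\<close>-th term of
  \<open>ssum X\<close> is at most \<open>m\<close> plus the sum of the earlier ones, so the terms
  at most double and add up to \<open>(2 ^ CARD('n) - 1) * m\<close>. The maximising index depends
  on \<open>X\<close>.\<close>

lemma obtain_functionals:
  obtains l where "\<And>j. j \<in> {1..CARD('n)} \<Longrightarrow> clinear_fun (l j)"
    "\<And>j w. j \<in> {1..CARD('n)} \<Longrightarrow> w \<in> D \<Longrightarrow> l j (w - z) \<noteq> 1"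
    "\<And>j. j \<in> {1..CARD('n)} \<Longrightarrow> l j (a j - z) = 1"
    "\<And>X. \<exists>j\<in>{1..CARD('n)}. ssum X \<le> 2 ^ CARD('n) * cmod (l j X)"
proof -
  have "\<exists>l. clinear_fun l \<and> (\<forall>w\<in>D. l (w - z) \<noteq> 1) \<and> l (a j - z) = 1" if "j \<in> {1..CARD('n)}" for j
    using supporting_functional[OF bd_point(1)[OF that]] by metis
  then obtain l where l: "\<And>j. j \<in> {1..CARD('n)} \<Longrightarrow> clinear_fun (l j)"
    "\<And>j w. j \<in> {1..CARD('n)} \<Longrightarrow> w \<in> D \<Longrightarrow> l j (w - z) \<noteq> 1" "\<And>j. j \<in> {1..CARD('n)} \<Longrightarrow> l j (a j - z) = 1"
    by metis
  have ldir: "l j (dir j) = 1 / dst j" if "j \<in> {1..CARD('n)}" for j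
    using l(3)[OF that] bd_point(4)[OF that]
    by (simp add: dir_eq[OF that] clinear_fun_scale[OF l(1)[OF that]] field_simps)
  have bound: "ssum X \<le> 2 ^ CARD('n) * m" if m: "\<And>j. j \<in> {1..CARD('n)} \<Longrightarrow> cmod (l j X) \<le> m" for X m
  proof -
    have "1 \<in> {1..CARD('n)}" by (simp add: Suc_le_eq One_nat_def)
    then have m0: "m \<ge> 0" using m[of 1] norm_ge_zero[of "l 1 X"] by linarith
    let ?c = "\<lambda>j. cmod (coord z a X j) / dst j"
    have step: "?c j \<le> m + (\<Sum>k\<in>{1..<j}. ?c k)" if j: "j \<in> {1..CARD('n)}" for j
    proof -
      have d: "dst j > 0" by (rule bd_point(4)[OF j])
      have "l j X = (\<Sum>k\<in>{1..CARD('n)}. coord z a X k * l j (dir k))"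
        by (rule clinear_fun_expansion[OF l(1)[OF j]])
      also have "\<dots> = (\<Sum>k\<in>{1..j}. coord z a X k * l j (dir k))"
        using j functional_vanishes[OF j _ _ l(1)[OF j] l(2)[OF j] ldir[OF j]]
        by (intro sum.mono_neutral_right) auto
      also have "{1..j} = insert j {1..<j}" using j by auto
      finally have "l j X = coord z a X j / dst j + (\<Sum>k\<in>{1..<j}. coord z a X k * l j (dir k))"
        by (simp add: ldir[OF j])
      then have "coord z a X j / dst j = l j X - (\<Sum>k\<in>{1..<j}. coord z a X k * l j (dir k))"
        by simp
      then have "?c j = cmod (l j X - (\<Sum>k\<in>{1..<j}. coord z a X k * l j (dir k)))"
        using d by (metis norm_divide norm_of_real abs_of_pos)
      also have "\<dots> \<le> cmod (l j X) + (\<Sum>k\<in>{1..<j}. cmod (coord z a X k * l j (dir k)))"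
        by (rule order_trans[OF norm_triangle_ineq4]) (intro add_left_mono norm_sum)
      also have "\<dots> \<le> m + (\<Sum>k\<in>{1..<j}. cmod (coord z a X k) * (1 / dst k))"
        unfolding norm_mult using j
        by (intro add_mono m sum_mono mult_left_mono functional_bound[OF l(1)[OF j] l(2)[OF j]]) auto
      finally show ?thesis by simp
    qed
    have "j \<le> CARD('n) \<Longrightarrow> (\<Sum>k\<in>{1..<Suc j}. ?c k) \<le> (2 ^ j - 1) * m" for j
    proof (induction j)
      case (Suc j)
      have "(\<Sum>k\<in>{1..<Suc (Suc j)}. ?c k) = (\<Sum>k\<in>{1..<Suc j}. ?c k) + ?c (Suc j)"
        by (subst sum.atLeastLessThan_Suc) auto
      also have "\<dots> \<le> (2 ^ j - 1) * m + (m + (2 ^ j - 1) * m)"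
      proof (rule add_mono)
        show IH: "(\<Sum>k\<in>{1..<Suc j}. ?c k) \<le> (2 ^ j - 1) * m"
          using Suc by simp
        have "?c (Suc j) \<le> m + (\<Sum>k\<in>{1..<Suc j}. ?c k)"
          using Suc.prems by (intro step) auto
        then show "?c (Suc j) \<le> m + (2 ^ j - 1) * m" using IH by linarith
      qed
      also have "\<dots> = (2 ^ Suc j - 1) * m" by (simp add: algebra_simps)
      finally show ?case .
    qed simp
    from this[of "CARD('n)"] have "ssum X \<le> (2 ^ CARD('n) - 1) * m"
      by (simp add: ssum_def atLeastLessThanSuc_atLeastAtMost)
    also have "\<dots> \<le> 2 ^ CARD('n) * m" using m0 by (intro mult_right_mono) auto
    finally show ?thesis .
  qed
  have max: "\<exists>j\<in>{1..CARD('n)}. ssum X \<le> 2 ^ CARD('n) * cmod (l j X)" for X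
  proof -
    have "1 \<in> {1..CARD('n)}" by (simp add: Suc_le_eq One_nat_def)
    then have ne: "(\<lambda>j. cmod (l j X)) ` {1..CARD('n)} \<noteq> {}" by blast
    have "Max ((\<lambda>j. cmod (l j X)) ` {1..CARD('n)}) \<in> (\<lambda>j. cmod (l j X)) ` {1..CARD('n)}"
      by (rule Max_in[OF _ ne]) simp
    then obtain j where j: "j \<in> {1..CARD('n)}" "Max ((\<lambda>j. cmod (l j X)) ` {1..CARD('n)}) = cmod (l j X)"
      by blast
    have "cmod (l i X) \<le> cmod (l j X)" if "i \<in> {1..CARD('n)}" for i
      unfolding j(2)[symmetric] using that by (intro Max_ge) auto
    then have "ssum X \<le> 2 ^ CARD('n) * cmod (l j X)" by (rule bound)
    then show ?thesis using j(1) by blast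
  qed
  show ?thesis by (rule that[of l]) (use l max in blast)+
qed

end

section \<open>The Caratheodory and Kobayashi metrics\<close>

lemma holo_fun_onI:
  assumes "\<And>x. x \<in> D \<Longrightarrow> (f has_derivative f' x) (at x)" "\<And>x. x \<in> D \<Longrightarrow> clinear_fun (f' x)"
  shows "holo_fun_on f D"
  unfolding holo_fun_on_def using assms by blast

lemma holo_fun_on_frechet:
  assumes "holo_fun_on f D" "x \<in> D"
  shows "(f has_derivative frechet_derivative f (at x)) (at x)" "clinear_fun (frechet_derivative f (at x))"
proof -
  obtain f' where f': "(f has_derivative f') (at x)" "clinear_fun f'"
    using assms unfolding holo_fun_on_def by blast
  then have "frechet_derivative f (at x) = f'" using frechet_derivative_at by metis
  then show "(f has_derivative frechet_derivative f (at x)) (at x)" "clinear_fun (frechet_derivative f (at x))"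
    using f' by simp_all
qed

lemma holo_fun_on_continuous_on: "holo_fun_on f D \<Longrightarrow> continuous_on D f"
  by (meson continuous_at_imp_continuous_on has_derivative_continuous holo_fun_on_frechet(1))

lemma holo_fun_on_const: "holo_fun_on (\<lambda>x. c) D"
  by (rule holo_fun_onI[where f' = "\<lambda>_ _. 0"]) (auto intro: clinear_funI)

lemma holo_fun_on_mult:
  assumes "holo_fun_on f D" "holo_fun_on g D"
  shows "holo_fun_on (\<lambda>x. f x * g x) D"
proof (rule holo_fun_onI)
  fix x assume x: "x \<in> D"
  note F = holo_fun_on_frechet[OF assms(1) x] and G = holo_fun_on_frechet[OF assms(2) x]
  show "((\<lambda>x. f x * g x) has_derivative
      (\<lambda>h. f x * frechet_derivative g (at x) h + frechet_derivative f (at x) h * g x)) (at x)"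
    by (rule has_derivative_mult[OF F(1) G(1)])
  show "clinear_fun (\<lambda>h. f x * frechet_derivative g (at x) h + frechet_derivative f (at x) h * g x)"
    by (rule clinear_funI) (auto simp: clinear_fun_add[OF F(2)] clinear_fun_add[OF G(2)]
        clinear_fun_scale[OF F(2)] clinear_fun_scale[OF G(2)] algebra_simps)
qed

lemma holo_fun_on_power: "holo_fun_on f D \<Longrightarrow> holo_fun_on (\<lambda>x. f x ^ k) D"
  by (induction k) (auto intro: holo_fun_on_const holo_fun_on_mult)

lemma holo_fun_on_prod:
  "(\<And>i. i \<in> I \<Longrightarrow> holo_fun_on (f i) D) \<Longrightarrow> holo_fun_on (\<lambda>x. \<Prod>i\<in>I. f i x) D"
  by (induction I rule: infinite_finite_induct) (auto intro: holo_fun_on_const holo_fun_on_mult)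

text \<open>Componentwise complex differentiability is turned into a real Frechet derivative by
  testing against the real basis vectors \<open>axis i u\<close>, so that the chain rule with
  \<open>holo_fun_on\<close> functions becomes available.\<close>

lemma has_derivative_curve:
  fixes \<phi> :: "complex \<Rightarrow> complex ^ 'n" and v :: "complex ^ 'n"
  assumes "\<And>i. ((\<lambda>t. \<phi> t $ i) has_field_derivative v $ i) (at t)"
  shows "(\<phi> has_derivative (\<lambda>h. h *s v)) (at t)"
  unfolding has_derivative_componentwise_within[of \<phi>]
proof
  fix b :: "complex ^ 'n" assume "b \<in> Basis"
  then obtain i u where b: "b = axis i u" by (auto simp: Basis_vec_def)
  have "((\<lambda>x. \<phi> x $ i) has_derivative (\<lambda>h. h * v $ i)) (at t)"
    using assms[of i] by (simp add: has_field_derivative_def mult_commute_abs)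
  then have "((\<lambda>x. \<phi> x $ i \<bullet> u) has_derivative (\<lambda>h. (h * v $ i) \<bullet> u)) (at t)"
    by (rule has_derivative_inner_left)
  then show "((\<lambda>x. \<phi> x \<bullet> b) has_derivative (\<lambda>x. (x *s v) \<bullet> b)) (at t)"
    by (simp add: b inner_axis)
qed

lemma holo_fun_on_curve:
  fixes \<phi> :: "complex \<Rightarrow> complex ^ 'n" and v :: "complex ^ 'n"
  assumes f: "holo_fun_on f D" "\<phi> t \<in> D"
    and \<phi>: "\<And>i. ((\<lambda>t. \<phi> t $ i) has_field_derivative v $ i) (at t)"
  shows "((\<lambda>t. f (\<phi> t)) has_field_derivative frechet_derivative f (at (\<phi> t)) v) (at t)"
  using has_derivative_compose[OF has_derivative_curve[OF \<phi>] holo_fun_on_frechet(1)[OF f]]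
  by (simp add: has_field_derivative_def clinear_fun_scale[OF holo_fun_on_frechet(2)[OF f]] mult_commute_abs)

lemma holo_fun_on_line:
  assumes f: "holo_fun_on f D" "w + t *s v \<in> D"
  shows "((\<lambda>t. f (w + t *s v)) has_field_derivative frechet_derivative f (at (w + t *s v)) v) (at t)"
  using f by (intro holo_fun_on_curve[where \<phi> = "\<lambda>t. w + t *s v"]) (auto intro!: derivative_eq_intros)

text \<open>The Schwarz lemma for \<open>f\<close> composed with \<open>\<phi>\<close>. It serves
  twice: with one explicit disc it bounds all Caratheodory competitors from above, with one explicit
  function all Kobayashi competitors from below.\<close>

lemma schwarz_along_disc:
  fixes \<phi> :: "complex \<Rightarrow> complex ^ 'n"
  assumes f: "holo_fun_on f D" "f ` D \<subseteq> ball 0 1" "f z = 0"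
    and \<phi>: "holo_map_on \<phi> (ball 0 1)" "\<phi> ` ball 0 1 \<subseteq> D" "\<phi> 0 = z"
    and \<alpha>: "\<alpha> \<ge> 0" "\<alpha> *\<^sub>R (\<chi> i. deriv (\<lambda>t. \<phi> t $ i) 0) = X"
  shows "cmod (frechet_derivative f (at z) X) \<le> \<alpha>"
proof -
  define v where "v t = (\<chi> i. deriv (\<lambda>t. \<phi> t $ i) t)" for t
  have der: "((\<lambda>t. f (\<phi> t)) has_field_derivative frechet_derivative f (at (\<phi> t)) (v t)) (at t)"
    if "t \<in> ball 0 1" for t
  proof (rule holo_fun_on_curve[OF f(1)])
    show "\<phi> t \<in> D" using \<phi>(2) that by auto
    show "((\<lambda>t. \<phi> t $ i) has_field_derivative v t $ i) (at t)" for i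
      using \<phi>(1) that unfolding holo_map_on_def v_def
      by (auto intro!: holomorphic_derivI[of _ "ball 0 1"])
  qed
  have hol: "(\<lambda>t. f (\<phi> t)) holomorphic_on ball 0 1"
    using der unfolding holomorphic_on_open[OF open_ball] by blast
  have "cmod (deriv (\<lambda>t. f (\<phi> t)) 0) \<le> 1"
  proof (rule Schwarz_Lemma(2)[where \<xi> = 0, OF hol])
    show "cmod (f (\<phi> t)) < 1" if "cmod t < 1" for t
      using f(2) \<phi>(2) that by (force simp: image_subset_iff)
  qed (use f(3) \<phi>(3) in auto)
  moreover have "deriv (\<lambda>t. f (\<phi> t)) 0 = frechet_derivative f (at z) (v 0)"
    using DERIV_imp_deriv[OF der[of 0]] \<phi>(3) by simp
  moreover have "z \<in> D" using \<phi>(2,3) by force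
  then have "frechet_derivative f (at z) X = of_real \<alpha> * frechet_derivative f (at z) (v 0)"
    unfolding \<alpha>(2)[symmetric] v_def scaleR_vec_eq
    by (intro clinear_fun_scale holo_fun_on_frechet(2)[OF f(1)])
  ultimately show ?thesis using \<alpha>(1) by (simp add: norm_mult mult_left_le)
qed

context adapted_point
begin

lemma obtain_sqrts:
  obtains l \<sigma> where "\<And>j. j \<in> {1..CARD('n)} \<Longrightarrow> clinear_fun (l j)"
    "\<And>j w. j \<in> {1..CARD('n)} \<Longrightarrow> w \<in> D \<Longrightarrow> (\<sigma> j has_derivative (\<lambda>X. - l j X / (2 * \<sigma> j w))) (at w)"
    "\<And>j. j \<in> {1..CARD('n)} \<Longrightarrow> \<sigma> j z = 1"
    "\<And>j w. j \<in> {1..CARD('n)} \<Longrightarrow> w \<in> D \<Longrightarrow> (\<sigma> j w)\<^sup>2 = 1 - l j (w - z)"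
    "\<And>j w. j \<in> {1..CARD('n)} \<Longrightarrow> w \<in> D \<Longrightarrow> 2 / 5 \<le> cmod (\<sigma> j w + 1)"
    "\<And>X. \<exists>j\<in>{1..CARD('n)}. ssum X \<le> 2 ^ CARD('n) * cmod (l j X)"
proof -
  obtain l where l: "\<And>j. j \<in> {1..CARD('n)} \<Longrightarrow> clinear_fun (l j)"
    "\<And>j w. j \<in> {1..CARD('n)} \<Longrightarrow> w \<in> D \<Longrightarrow> l j (w - z) \<noteq> 1"
    "\<And>j. j \<in> {1..CARD('n)} \<Longrightarrow> l j (a j - z) = 1"
    "\<And>X. \<exists>j\<in>{1..CARD('n)}. ssum X \<le> 2 ^ CARD('n) * cmod (l j X)"
    by (rule obtain_functionals) (rule that)
  have "\<exists>\<sigma>. (\<forall>w\<in>D. (\<sigma> has_derivative (\<lambda>X. - l j X / (2 * \<sigma> w))) (at w)) \<and> \<sigma> z = 1 \<and>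
      (\<forall>w\<in>D. (\<sigma> w)\<^sup>2 = 1 - l j (w - z)) \<and> (\<forall>w\<in>D. 2 / 5 \<le> cmod (\<sigma> w + 1))"
    if j: "j \<in> {1..CARD('n)}" for j
  proof -
    have "z + t *s (a j - z) \<in> D" if "cmod t < 1" for t
    proof -
      have "cmod (t * of_real (dst j)) < dst j"
        using that bd_point(4)[OF j] by (simp add: norm_mult)
      from disc_in_D[OF j this] show ?thesis unfolding dir_eq[OF j] by (simp only: vec.scale_scale)
    qed
    from lineconv_sqrt[OF lineconv_D zD l(1)[OF j] l(2)[OF j] l(3)[OF j] this]
    obtain \<sigma> where "\<And>w. w \<in> D \<Longrightarrow> (\<sigma> has_derivative (\<lambda>X. - l j X / (2 * \<sigma> w))) (at w)"
      "\<sigma> z = 1" "\<And>w. w \<in> D \<Longrightarrow> (\<sigma> w)\<^sup>2 = 1 - l j (w - z)" "\<And>w. w \<in> D \<Longrightarrow> 2 / 5 \<le> cmod (\<sigma> w + 1)"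
      by blast
    then show ?thesis by blast
  qed
  then obtain \<sigma> where \<sigma>: "\<And>j. j \<in> {1..CARD('n)} \<Longrightarrow>
      (\<forall>w\<in>D. (\<sigma> j has_derivative (\<lambda>X. - l j X / (2 * \<sigma> j w))) (at w)) \<and> \<sigma> j z = 1 \<and>
      (\<forall>w\<in>D. (\<sigma> j w)\<^sup>2 = 1 - l j (w - z)) \<and> (\<forall>w\<in>D. 2 / 5 \<le> cmod (\<sigma> j w + 1))"
    by metis
  show ?thesis by (rule that[of l \<sigma>]) (use l(1,4) \<sigma> in blast)+
qed

lemma test_function:
  obtains f where "holo_fun_on f D" "f ` D \<subseteq> ball 0 1" "f z = 0"
    "ssum X / (40 * 2 ^ CARD('n)) \<le> cmod (frechet_derivative f (at z) X)"
proof -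
  obtain l \<sigma> where l: "\<And>j. j \<in> {1..CARD('n)} \<Longrightarrow> clinear_fun (l j)"
    and \<sigma>: "\<And>j w. j \<in> {1..CARD('n)} \<Longrightarrow> w \<in> D \<Longrightarrow> (\<sigma> j has_derivative (\<lambda>X. - l j X / (2 * \<sigma> j w))) (at w)"
    "\<And>j. j \<in> {1..CARD('n)} \<Longrightarrow> \<sigma> j z = 1"
    "\<And>j w. j \<in> {1..CARD('n)} \<Longrightarrow> w \<in> D \<Longrightarrow> (\<sigma> j w)\<^sup>2 = 1 - l j (w - z)"
    "\<And>j w. j \<in> {1..CARD('n)} \<Longrightarrow> w \<in> D \<Longrightarrow> 2 / 5 \<le> cmod (\<sigma> j w + 1)"
    and max: "\<And>X. \<exists>j\<in>{1..CARD('n)}. ssum X \<le> 2 ^ CARD('n) * cmod (l j X)"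
    by (rule obtain_sqrts) (rule that)
  obtain j where j: "j \<in> {1..CARD('n)}" "ssum X \<le> 2 ^ CARD('n) * cmod (l j X)"
    using max by blast
  \<comment> \<open>\<open>1 / (\<sigma> j + 1)\<close> has modulus at most \<open>5 / 2\<close> and
    equals \<open>1 / 2\<close> at \<open>z\<close>, so \<open>f\<close> vanishes there and has
    modulus at most \<open>3 / 5\<close>. Its derivative at \<open>z\<close> is
    \<open>l j / 40\<close>: a factor \<open>1 / 5\<close> here, \<open>1 / 4\<close> from the
    inverse, \<open>1 / 2\<close> from the root.\<close>
  define f where "f w = inverse (\<sigma> j w + 1) / 5 - 1 / 10" for w
  have nz: "\<sigma> j w + 1 \<noteq> 0" if "w \<in> D" for w
    using \<sigma>(4)[OF j(1) that] by auto
  define f' where "f' w h = (1 / 5) * (l j h / (2 * \<sigma> j w * (\<sigma> j w + 1)\<^sup>2))" for w h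
  have der: "(f has_derivative f' w) (at w)" if "w \<in> D" for w
    unfolding f_def f'_def
    by (rule derivative_eq_intros \<sigma>(1)[OF j(1) that] refl nz[OF that] | simp)+
      (use nz[OF that] in \<open>simp add: fun_eq_iff power2_eq_square field_simps\<close>)
  have "holo_fun_on f D"
    by (rule holo_fun_onI[OF der])
      (auto simp: f'_def clinear_fun_add[OF l[OF j(1)]] clinear_fun_scale[OF l[OF j(1)]] add_divide_distrib
        algebra_simps intro!: clinear_funI)
  moreover have "f ` D \<subseteq> ball 0 1"
  proof (rule image_subsetI)
    fix w assume w: "w \<in> D"
    have "cmod (f w) \<le> inverse (cmod (\<sigma> j w + 1)) / 5 + 1 / 10"
      unfolding f_def by (rule order_trans[OF norm_triangle_ineq4]) (simp add: norm_divide norm_inverse)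
    also have "inverse (cmod (\<sigma> j w + 1)) \<le> inverse (2 / 5)"
      using \<sigma>(4)[OF j(1) w] by (intro le_imp_inverse_le) auto
    finally show "f w \<in> ball 0 1" by simp
  qed
  moreover have "f z = 0" by (simp add: f_def \<sigma>(2)[OF j(1)])
  moreover have "frechet_derivative f (at z) = f' z"
    using frechet_derivative_at[OF der[OF zD]] by simp
  then have "cmod (frechet_derivative f (at z) X) = cmod (l j X) / 40"
    by (simp add: f'_def \<sigma>(2)[OF j(1)] norm_mult norm_divide)
  then have "ssum X / (40 * 2 ^ CARD('n)) \<le> cmod (frechet_derivative f (at z) X)"
    using j(2) by (simp add: field_simps)
  ultimately show ?thesis by (rule that)
qed

text \<open>The linear disc through \<open>z\<close> in direction \<open>X\<close>, filling the part
  of the \<open>ssum\<close> unit ball on that line; it is extremal only up to the constant of the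
  theorem.\<close>

lemma extremal_disc:
  assumes "X \<noteq> 0"
  obtains \<phi> :: "complex \<Rightarrow> complex ^ 'n" where "holo_map_on \<phi> (ball 0 1)" "\<phi> ` ball 0 1 \<subseteq> D" "\<phi> 0 = z"
    "ssum X *\<^sub>R (\<chi> i. deriv (\<lambda>t. \<phi> t $ i) 0) = X"
proof -
  have S: "ssum X > 0" by (rule ssum_pos[OF assms])
  define \<phi> where "\<phi> t = z + (t / of_real (ssum X)) *s X" for t :: complex
  have der: "((\<lambda>t. \<phi> t $ i) has_field_derivative X $ i / of_real (ssum X)) (at t)" for t i
    unfolding \<phi>_def using S by (auto intro!: derivative_eq_intros)
  have "(\<lambda>t. \<phi> t $ i) holomorphic_on ball 0 1" for i
    using der by (auto simp: holomorphic_on_open)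
  then have "holo_map_on \<phi> (ball 0 1)" by (simp add: holo_map_on_def)
  moreover have "\<phi> ` ball 0 1 \<subseteq> D"
    using S by (auto simp: \<phi>_def ssum_scale norm_divide intro!: ssum_ball_subset)
  moreover have "\<phi> 0 = z" by (simp add: \<phi>_def)
  moreover have "deriv (\<lambda>t. \<phi> t $ i) 0 = X $ i / of_real (ssum X)" for i
    by (rule DERIV_imp_deriv[OF der])
  then have "ssum X *\<^sub>R (\<chi> i. deriv (\<lambda>t. \<phi> t $ i) 0) = X"
    using S by (simp add: scaleR_vec_eq vec_eq_iff)
  ultimately show ?thesis by (rule that)
qed

lemma caratheodory_bounds:
  assumes X: "X \<noteq> 0"
  shows "ssum X / (40 * 2 ^ CARD('n)) \<le> caratheodory_metric D z X" "caratheodory_metric D z X \<le> ssum X"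
proof -
  let ?A = "{cmod (frechet_derivative f (at z) X) | f. holo_fun_on f D \<and> f ` D \<subseteq> ball 0 1 \<and> f z = 0}"
  obtain \<phi> :: "complex \<Rightarrow> complex ^ 'n" where \<phi>: "holo_map_on \<phi> (ball 0 1)" "\<phi> ` ball 0 1 \<subseteq> D" "\<phi> 0 = z"
    "ssum X *\<^sub>R (\<chi> i. deriv (\<lambda>t. \<phi> t $ i) 0) = X" by (rule extremal_disc[OF X]) (rule that)
  have upper: "y \<le> ssum X" if "y \<in> ?A" for y
    using that schwarz_along_disc[OF _ _ _ \<phi>(1-3) ssum_nonneg \<phi>(4)] by blast
  obtain f where f: "holo_fun_on f D" "f ` D \<subseteq> ball 0 1" "f z = 0"
    "ssum X / (40 * 2 ^ CARD('n)) \<le> cmod (frechet_derivative f (at z) X)"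
    by (rule test_function) (rule that)
  have mem: "cmod (frechet_derivative f (at z) X) \<in> ?A" using f by blast
  show "caratheodory_metric D z X \<le> ssum X"
    unfolding caratheodory_metric_def using mem upper by (intro cSup_least) blast+
  have "cmod (frechet_derivative f (at z) X) \<le> caratheodory_metric D z X"
    unfolding caratheodory_metric_def using mem upper by (intro cSup_upper bdd_aboveI) blast+
  then show "ssum X / (40 * 2 ^ CARD('n)) \<le> caratheodory_metric D z X" using f(4) by linarith
qed

lemma kobayashi_bounds:
  assumes X: "X \<noteq> 0"
  shows "ssum X / (40 * 2 ^ CARD('n)) \<le> kobayashi_metric D z X" "kobayashi_metric D z X \<le> ssum X"
proof -
  let ?A = "{\<alpha>. \<alpha> \<ge> 0 \<and> (\<exists>\<phi> :: complex \<Rightarrow> complex ^ 'n. holo_map_on \<phi> (ball 0 1) \<and> \<phi> ` ball 0 1 \<subseteq> D \<and> \<phi> 0 = z \<and>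
                 \<alpha> *\<^sub>R (\<chi> i. deriv (\<lambda>t. \<phi> t $ i) 0) = X)}"
  obtain \<phi> :: "complex \<Rightarrow> complex ^ 'n" where \<phi>: "holo_map_on \<phi> (ball 0 1)" "\<phi> ` ball 0 1 \<subseteq> D" "\<phi> 0 = z"
    "ssum X *\<^sub>R (\<chi> i. deriv (\<lambda>t. \<phi> t $ i) 0) = X" by (rule extremal_disc[OF X]) (rule that)
  have mem: "ssum X \<in> ?A" using \<phi> ssum_nonneg by blast
  obtain f where f: "holo_fun_on f D" "f ` D \<subseteq> ball 0 1" "f z = 0"
    "ssum X / (40 * 2 ^ CARD('n)) \<le> cmod (frechet_derivative f (at z) X)"
    by (rule test_function) (rule that)
  have lower: "ssum X / (40 * 2 ^ CARD('n)) \<le> \<alpha>" if "\<alpha> \<in> ?A" for \<alpha>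
    using that schwarz_along_disc[OF f(1-3)] f(4) by (blast intro: order_trans)
  show "ssum X / (40 * 2 ^ CARD('n)) \<le> kobayashi_metric D z X"
    unfolding kobayashi_metric_def using mem lower by (intro cInf_greatest) blast+
  show "kobayashi_metric D z X \<le> ssum X"
    unfolding kobayashi_metric_def using mem lower by (intro cInf_lower bdd_belowI) blast+
qed

end

section \<open>Mean values over balanced sets\<close>

lemma nn_integral_lborel_shift:
  fixes g :: "'a::euclidean_space \<Rightarrow> ennreal"
  assumes [measurable]: "g \<in> borel_measurable borel"
  shows "(\<integral>\<^sup>+x. g (y + x) \<partial>lborel) = (\<integral>\<^sup>+x. g x \<partial>lborel)"
proof -
  have "(\<integral>\<^sup>+x. g x \<partial>distr lborel borel ((+) y)) = (\<integral>\<^sup>+x. g (y + x) \<partial>lborel)"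
    by (subst nn_integral_distr) auto
  then show ?thesis by (simp add: lborel_distr_plus)
qed

text \<open>Uniqueness of Haar measure in disguise: the double integral of
  \<open>indicator E (c *s x + y) * indicator F (- c *s x)\<close> is computed in both orders, with \<open>F\<close> the unit ball.\<close>

lemma distr_lborel_rotation:
  assumes c: "cmod c = 1"
  shows "distr lborel borel (\<lambda>x :: complex ^ 'n. c *s x) = lborel"
proof (rule measure_eqI)
  show "sets (distr lborel borel (\<lambda>x :: complex ^ 'n. c *s x)) = sets lborel" by simp
  have c0: "c \<noteq> 0" using c by auto
  have cT: "continuous_on S (\<lambda>x :: complex ^ 'n. c *s x)" for S by (intro continuous_intros)
  have mT [measurable]: "(\<lambda>x :: complex ^ 'n. c *s x) \<in> borel_measurable borel"
    by (rule borel_measurable_continuous_onI[OF cT])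
  fix E :: "(complex ^ 'n) set"
  assume "E \<in> sets (distr lborel borel (\<lambda>x. c *s x))"
  then have [measurable]: "E \<in> sets borel" by simp
  let ?T = "\<lambda>x :: complex ^ 'n. c *s x"
  let ?F = "ball (0 :: complex ^ 'n) 1"
  let ?I = "indicator :: (complex ^ 'n) set \<Rightarrow> complex ^ 'n \<Rightarrow> ennreal"
  have mF [measurable]: "?F \<in> sets borel" by simp
  have shift: "(\<integral>\<^sup>+x. g (x + y) \<partial>lborel) = (\<integral>\<^sup>+x. g x \<partial>lborel)"
    if [measurable]: "g \<in> borel_measurable borel" for g :: "complex ^ 'n \<Rightarrow> ennreal" and y
    using nn_integral_lborel_shift[OF that, of y] by (simp add: add.commute)
  have F1: "?I ?F (- ?T x) = ?I ?F x" for x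
    using c by (simp add: indicator_def norm_vec_scale)
  have "emeasure lborel E * emeasure lborel ?F = (\<integral>\<^sup>+x. ?I ?F (- ?T x) * emeasure lborel E \<partial>lborel)"
    unfolding F1 by (subst nn_integral_multc) (simp_all add: mult.commute)
  also have "\<dots> = (\<integral>\<^sup>+x. \<integral>\<^sup>+y. ?I ?F (- ?T x) * ?I E (y + ?T x) \<partial>lborel \<partial>lborel)"
    by (simp add: nn_integral_cmult shift)
  also have "\<dots> = (\<integral>\<^sup>+y. \<integral>\<^sup>+x. ?I ?F (- ?T x) * ?I E (y + ?T x) \<partial>lborel \<partial>lborel)"
    by (rule lborel_pair.Fubini'[symmetric]) measurable
  also have "\<dots> = (\<integral>\<^sup>+y. \<integral>\<^sup>+x. ?I ?F (y + - ?T x) * ?I E (?T x) \<partial>lborel \<partial>lborel)"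
  proof (rule nn_integral_cong)
    fix y :: "complex ^ 'n"
    \<comment> \<open>Translating \<open>x\<close> by \<open>y'\<close> moves \<open>y\<close> from
      the argument of \<open>E\<close> to that of the ball, where the integration over
      \<open>y\<close> absorbs it by translation invariance.\<close>
    define y' where "y' = (1 / c) *s y"
    have y': "?T y' = y" using c0 by (simp add: y'_def)
    have "(\<integral>\<^sup>+x. ?I ?F (- ?T x) * ?I E (y + ?T x) \<partial>lborel) =
        (\<integral>\<^sup>+x. ?I ?F (- ?T (x + - y')) * ?I E (y + ?T (x + - y')) \<partial>lborel)"
      by (rule shift[symmetric]) measurable
    also have "- ?T (x + - y') = y + - ?T x \<and> y + ?T (x + - y') = ?T x" for x
      using y' by (simp add: algebra_simps)
    then have "(\<integral>\<^sup>+x. ?I ?F (- ?T (x + - y')) * ?I E (y + ?T (x + - y')) \<partial>lborel) =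
        (\<integral>\<^sup>+x. ?I ?F (y + - ?T x) * ?I E (?T x) \<partial>lborel)"
      by (intro nn_integral_cong) metis
    finally show "(\<integral>\<^sup>+x. ?I ?F (- ?T x) * ?I E (y + ?T x) \<partial>lborel) =
        (\<integral>\<^sup>+x. ?I ?F (y + - ?T x) * ?I E (?T x) \<partial>lborel)" .
  qed
  also have "\<dots> = (\<integral>\<^sup>+x. \<integral>\<^sup>+y. ?I ?F (y + - ?T x) * ?I E (?T x) \<partial>lborel \<partial>lborel)"
    by (rule lborel_pair.Fubini') measurable
  also have "\<dots> = (\<integral>\<^sup>+x. emeasure lborel ?F * ?I E (?T x) \<partial>lborel)"
  proof (rule nn_integral_cong)
    fix x :: "complex ^ 'n"
    have "(\<integral>\<^sup>+y. ?I ?F (y + - ?T x) * ?I E (?T x) \<partial>lborel) = (\<integral>\<^sup>+y. ?I ?F (y + - ?T x) \<partial>lborel) * ?I E (?T x)"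
      by (rule nn_integral_multc) measurable
    also have "(\<integral>\<^sup>+y. ?I ?F (y + - ?T x) \<partial>lborel) = (\<integral>\<^sup>+y. ?I ?F y \<partial>lborel)"
      by (rule shift) measurable
    finally show "(\<integral>\<^sup>+y. ?I ?F (y + - ?T x) * ?I E (?T x) \<partial>lborel) = emeasure lborel ?F * ?I E (?T x)"
      by simp
  qed
  also have "\<dots> = emeasure lborel ?F * (\<integral>\<^sup>+x. ?I E x \<partial>distr lborel borel ?T)"
    by (subst nn_integral_cmult) (simp_all add: nn_integral_distr del: nn_integral_indicator)
  also have "\<dots> = emeasure (distr lborel borel ?T) E * emeasure lborel ?F"
    by (simp add: mult.commute)
  finally have "emeasure lborel E * emeasure lborel ?F = emeasure (distr lborel borel ?T) E * emeasure lborel ?F" .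
  moreover have "emeasure lborel ?F \<noteq> 0"
    using content_ball_pos[of 1 "0 :: complex ^ 'n"] by (auto simp: measure_def)
  moreover have "emeasure lborel ?F \<noteq> \<infinity>"
    using emeasure_bounded_finite[of ?F] by simp
  ultimately show "emeasure (distr lborel borel ?T) E = emeasure lborel E"
    by (metis ennreal_mult_cancel_left infinity_ennreal_def mult.commute)
qed

text \<open>Cauchy's formula at the centre. The nonnegative integral on the right is the form needed
  for exchanging integrals in \<open>balanced_mean_value\<close>.\<close>

lemma cmod_le_circle_mean:
  assumes "continuous_on (cball 0 1) h" "h holomorphic_on ball 0 1"
  shows "ennreal (cmod (h 0)) \<le>
    (\<integral>\<^sup>+\<theta>. ennreal (cmod (h (cis (2 * pi * \<theta>)))) * indicator {0..1} \<theta> \<partial>lborel)"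
proof -
  have cp: "circlepath 0 1 \<theta> = cis (2 * pi * \<theta>)" for \<theta>
    by (simp add: circlepath cis_conv_exp mult_ac)
  have vd: "vector_derivative (circlepath 0 1) (at \<theta> within {0..1}) = 2 * of_real pi * \<i> * cis (2 * pi * \<theta>)"
    if "\<theta> \<in> {0..1}" for \<theta>
    using vector_derivative_circlepath01[of \<theta> 0 1] that by (simp add: cis_conv_exp mult_ac)
  have "((\<lambda>u. h u / (u - 0)) has_contour_integral (2 * of_real pi * \<i> * h 0)) (circlepath 0 1)"
    by (rule Cauchy_integral_circlepath[OF assms]) simp
  then have "((\<lambda>\<theta>. h (circlepath 0 1 \<theta>) / (circlepath 0 1 \<theta> - 0) *
      vector_derivative (circlepath 0 1) (at \<theta> within {0..1})) has_integral (2 * of_real pi * \<i> * h 0)) {0..1}"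
    by (simp add: has_contour_integral_def)
  then have "((\<lambda>\<theta>. (2 * of_real pi * \<i>) * h (cis (2 * pi * \<theta>))) has_integral (2 * of_real pi * \<i> * h 0)) {0..1}"
    by (rule has_integral_eq[rotated]) (simp add: cp vd)
  then have "((\<lambda>\<theta>. inverse (2 * of_real pi * \<i>) * ((2 * of_real pi * \<i>) * h (cis (2 * pi * \<theta>)))) has_integral
      (inverse (2 * of_real pi * \<i>) * (2 * of_real pi * \<i> * h 0))) {0..1}"
    by (rule has_integral_mult_right)
  moreover have "inverse (2 * of_real pi * \<i>) * (2 * of_real pi * \<i> * u) = u" for u :: complex
    by (simp add: field_simps)
  ultimately have hi: "((\<lambda>\<theta>. h (cis (2 * pi * \<theta>))) has_integral h 0) {0..1}"
    by (simp only:)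
  have ch: "continuous_on {0..1} (\<lambda>\<theta>. cmod (h (cis (2 * pi * \<theta>))))"
    by (intro continuous_intros continuous_on_compose2[OF assms(1)]) auto
  define I where "I = integral {0..1} (\<lambda>\<theta>. cmod (h (cis (2 * pi * \<theta>))))"
  have hI: "((\<lambda>\<theta>. cmod (h (cis (2 * pi * \<theta>)))) has_integral I) {0..1}"
    unfolding I_def by (intro integrable_integral integrable_continuous_real ch)
  have "cmod (h 0) \<le> I"
    using integral_norm_bound_integral[OF has_integral_integrable[OF hi] has_integral_integrable[OF hI]]
    by (simp add: integral_unique[OF hi] integral_unique[OF hI])
  moreover have "(\<integral>\<^sup>+\<theta>. ennreal (indicator {0..1} \<theta> *\<^sub>R cmod (h (cis (2 * pi * \<theta>)))) \<partial>lborel) = ennreal I"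
  proof (rule nn_integral_has_integral_lborel)
    show "(\<lambda>\<theta>. indicator {0..1} \<theta> *\<^sub>R cmod (h (cis (2 * pi * \<theta>)))) \<in> borel_measurable borel"
      by (rule borel_measurable_continuous_on_indicator[OF _ ch]) simp
    have "((\<lambda>\<theta>. if \<theta> \<in> {0..1} then cmod (h (cis (2 * pi * \<theta>))) else 0) has_integral I) UNIV"
      using hI by (simp only: has_integral_restrict_UNIV)
    then show "((\<lambda>\<theta>. indicator {0..1} \<theta> *\<^sub>R cmod (h (cis (2 * pi * \<theta>)))) has_integral I) UNIV"
      by (rule has_integral_eq[rotated]) simp
  qed simp
  moreover have "ennreal (indicator {0..1} \<theta> *\<^sub>R cmod (h (cis (2 * pi * \<theta>)))) =
      ennreal (cmod (h (cis (2 * pi * \<theta>)))) * indicator {0..1} \<theta>" for \<theta>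
    by (simp add: indicator_def)
  ultimately show ?thesis by (simp add: ennreal_leI)
qed

text \<open>On the complex line through \<open>y\<close> in direction \<open>x\<close> the square of
  \<open>g\<close> is holomorphic, so its value at \<open>y\<close> is dominated by circle means.
  Rotations preserve \<open>B\<close> and Lebesgue measure, so integrating over \<open>B\<close> and
  exchanging the integrals removes the angle.\<close>

lemma balanced_mean_value:
  fixes g :: "complex ^ 'n \<Rightarrow> complex"
  assumes g: "holo_fun_on g U" and U: "open U" and B: "open B" "\<And>x. x \<in> B \<Longrightarrow> y + x \<in> U"
    and bal: "\<And>x c. x \<in> B \<Longrightarrow> cmod c \<le> 1 \<Longrightarrow> c *s x \<in> B"
  shows "ennreal ((cmod (g y))\<^sup>2) * emeasure lborel B \<le>
    (\<integral>\<^sup>+x. ennreal ((cmod (g (y + x)))\<^sup>2) * indicator B x \<partial>lborel)"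
proof -
  define G where "G x = ennreal ((cmod (g (y + x)))\<^sup>2) * indicator B x" for x
  have "continuous_on B (\<lambda>x. (cmod (g (y + x)))\<^sup>2)"
    by (intro continuous_intros continuous_on_compose2[OF holo_fun_on_continuous_on[OF g]]) (use B in auto)
  then have "(\<lambda>x. indicator B x *\<^sub>R (cmod (g (y + x)))\<^sup>2) \<in> borel_measurable borel"
    using B(1) by (intro borel_measurable_continuous_on_indicator) auto
  then have "(\<lambda>x. ennreal (indicator B x *\<^sub>R (cmod (g (y + x)))\<^sup>2)) \<in> borel_measurable borel"
    by measurable
  moreover have G_eq: "(\<lambda>x. ennreal (indicator B x *\<^sub>R (cmod (g (y + x)))\<^sup>2)) = G"
    by (auto simp: G_def fun_eq_iff indicator_def)
  ultimately have mG [measurable]: "G \<in> borel_measurable borel" by (simp only:)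
  have mB [measurable]: "B \<in> sets borel" using B(1) by simp
  let ?e = "\<lambda>\<theta>. cis (2 * pi * \<theta>)"
  have rot: "?e \<theta> *s x \<in> B \<longleftrightarrow> x \<in> B" for \<theta> x
  proof
    assume "?e \<theta> *s x \<in> B"
    then have "cis (- (2 * pi * \<theta>)) *s (?e \<theta> *s x) \<in> B" by (rule bal) simp
    then show "x \<in> B" by (simp add: cis_mult)
  qed (use bal in auto)
  have pointwise: "ennreal ((cmod (g y))\<^sup>2) * indicator B x \<le> (\<integral>\<^sup>+\<theta>. G (?e \<theta> *s x) * indicator {0..1} \<theta> \<partial>lborel)" for x
  proof (cases "x \<in> B")
    case True
    have inU: "y + t *s x \<in> U" if "cmod t \<le> 1" for t using B(2) bal[OF True that] by blast
    have der: "((\<lambda>t. (g (y + t *s x))\<^sup>2) has_field_derivative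
        2 * g (y + t *s x) * frechet_derivative g (at (y + t *s x)) x) (at t)" if "cmod t \<le> 1" for t
      by (auto intro!: derivative_eq_intros holo_fun_on_line[OF g inU[OF that]])
    have "ennreal (cmod ((\<lambda>t. (g (y + t *s x))\<^sup>2) 0)) \<le>
        (\<integral>\<^sup>+\<theta>. ennreal (cmod ((\<lambda>t. (g (y + t *s x))\<^sup>2) (?e \<theta>))) * indicator {0..1} \<theta> \<partial>lborel)"
    proof (rule cmod_le_circle_mean)
      show "continuous_on (cball 0 1) (\<lambda>t. (g (y + t *s x))\<^sup>2)"
        by (intro continuous_at_imp_continuous_on ballI DERIV_isCont[OF der]) simp
      show "(\<lambda>t. (g (y + t *s x))\<^sup>2) holomorphic_on ball 0 1"
        unfolding holomorphic_on_open[OF open_ball] using der by (metis less_imp_le mem_ball_0)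
    qed
    then show ?thesis using True rot by (simp add: G_def norm_power)
  qed simp
  have "ennreal ((cmod (g y))\<^sup>2) * emeasure lborel B = (\<integral>\<^sup>+x. ennreal ((cmod (g y))\<^sup>2) * indicator B x \<partial>lborel)"
    by (simp add: nn_integral_cmult)
  also have "\<dots> \<le> (\<integral>\<^sup>+x. \<integral>\<^sup>+\<theta>. G (?e \<theta> *s x) * indicator {0..1} \<theta> \<partial>lborel \<partial>lborel)"
    by (intro nn_integral_mono pointwise)
  also have "\<dots> = (\<integral>\<^sup>+\<theta>. \<integral>\<^sup>+x. G (?e \<theta> *s x) * indicator {0..1} \<theta> \<partial>lborel \<partial>lborel)"
  proof (rule lborel_pair.Fubini'[symmetric])
    have "continuous_on UNIV (\<lambda>p :: (complex ^ 'n) \<times> real. ?e (snd p) *s fst p)"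
      by (intro continuous_intros)
    then have "(\<lambda>p :: (complex ^ 'n) \<times> real. ?e (snd p) *s fst p) \<in> borel_measurable borel"
      by (rule borel_measurable_continuous_onI)
    then have m1: "(\<lambda>p. G (?e (snd p) *s fst p)) \<in> borel_measurable borel"
      by (rule measurable_compose[OF _ mG])
    have "(snd :: (complex ^ 'n) \<times> real \<Rightarrow> real) \<in> borel_measurable borel"
      by (intro borel_measurable_continuous_onI continuous_on_snd continuous_on_id)
    then have m2: "(\<lambda>p :: (complex ^ 'n) \<times> real. indicator {0..1} (snd p) :: ennreal) \<in> borel_measurable borel"
      by (rule measurable_compose) simp
    have "(\<lambda>p. G (?e (snd p) *s fst p) * indicator {0..1} (snd p)) \<in> borel_measurable borel"
      by (rule borel_measurable_times_ennreal[OF m1 m2])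
    then show "(\<lambda>(x, \<theta>). G (?e \<theta> *s x) * indicator {0..1} \<theta>) \<in> borel_measurable (lborel \<Otimes>\<^sub>M lborel)"
      by (simp add: case_prod_beta' lborel_prod)
  qed
  also have "\<dots> = (\<integral>\<^sup>+\<theta>. (\<integral>\<^sup>+x. G x \<partial>lborel) * indicator {0..1} (\<theta>::real) \<partial>lborel)"
  proof (rule nn_integral_cong)
    fix \<theta> :: real
    have "continuous_on UNIV (\<lambda>x :: complex ^ 'n. ?e \<theta> *s x)" by (intro continuous_intros)
    then have [measurable]: "(\<lambda>x :: complex ^ 'n. ?e \<theta> *s x) \<in> borel_measurable borel"
      by (rule borel_measurable_continuous_onI)
    have "(\<integral>\<^sup>+x. G x \<partial>distr lborel borel (\<lambda>x. ?e \<theta> *s x)) = (\<integral>\<^sup>+x. G (?e \<theta> *s x) \<partial>lborel)"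
      by (subst nn_integral_distr) auto
    then have "(\<integral>\<^sup>+x. G (?e \<theta> *s x) \<partial>lborel) = (\<integral>\<^sup>+x. G x \<partial>lborel)"
      by (simp add: distr_lborel_rotation)
    then show "(\<integral>\<^sup>+x. G (?e \<theta> *s x) * indicator {0..1} \<theta> \<partial>lborel) = (\<integral>\<^sup>+x. G x \<partial>lborel) * indicator {0..1} \<theta>"
      by (subst nn_integral_multc) auto
  qed
  also have "\<dots> = (\<integral>\<^sup>+x. G x \<partial>lborel)"
    by (simp add: nn_integral_cmult_indicator)
  finally show ?thesis by (simp add: G_def)
qed

section \<open>The Bergman metric\<close>

lemma L2h_nn_integral:
  assumes "g \<in> L2h D"
  shows "(\<integral>\<^sup>+x. ennreal ((cmod (g x))\<^sup>2) * indicator D x \<partial>lborel) = ennreal ((L2norm D g)\<^sup>2)"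
proof -
  have int: "integrable lborel (\<lambda>x. indicator D x *\<^sub>R (cmod (g x))\<^sup>2)"
    using assms by (simp add: L2h_def set_integrable_def)
  have "(\<integral>\<^sup>+x. ennreal ((cmod (g x))\<^sup>2) * indicator D x \<partial>lborel) =
      (\<integral>\<^sup>+x. ennreal (indicator D x *\<^sub>R (cmod (g x))\<^sup>2) \<partial>lborel)"
    by (intro nn_integral_cong) (simp add: indicator_def)
  also have "\<dots> = ennreal (set_lebesgue_integral lborel D (\<lambda>x. (cmod (g x))\<^sup>2))"
    unfolding set_lebesgue_integral_def by (rule nn_integral_eq_integral[OF int]) simp
  also have "set_lebesgue_integral lborel D (\<lambda>x. (cmod (g x))\<^sup>2) = (L2norm D g)\<^sup>2"
    unfolding L2norm_def set_lebesgue_integral_def by (simp add: integral_nonneg_AE)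
  finally show ?thesis .
qed

lemma L2hI:
  assumes g: "holo_fun_on g D" and D: "open D"
    and fin: "(\<integral>\<^sup>+x. ennreal ((cmod (g x))\<^sup>2) * indicator D x \<partial>lborel) \<le> ennreal c"
  shows "g \<in> L2h D"
proof -
  have "continuous_on D (\<lambda>x. (cmod (g x))\<^sup>2)"
    by (intro continuous_intros holo_fun_on_continuous_on[OF g])
  then have m: "(\<lambda>x. indicator D x *\<^sub>R (cmod (g x))\<^sup>2) \<in> borel_measurable lborel"
    using D borel_measurable_continuous_on_indicator[of D "\<lambda>x. (cmod (g x))\<^sup>2"] by simp
  have "(\<integral>\<^sup>+x. ennreal (norm (indicator D x *\<^sub>R (cmod (g x))\<^sup>2)) \<partial>lborel) =
      (\<integral>\<^sup>+x. ennreal ((cmod (g x))\<^sup>2) * indicator D x \<partial>lborel)"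
    by (intro nn_integral_cong) (simp add: indicator_def)
  then have "(\<integral>\<^sup>+x. ennreal (norm (indicator D x *\<^sub>R (cmod (g x))\<^sup>2)) \<partial>lborel) < \<infinity>"
    using fin by (simp add: le_less_trans)
  then have "integrable lborel (\<lambda>x. indicator D x *\<^sub>R (cmod (g x))\<^sup>2)"
    by (rule integrableI_bounded[OF m])
  then show ?thesis using g by (simp add: L2h_def set_integrable_def)
qed

lemma L2norm_nonneg: "0 \<le> L2norm D g"
  unfolding L2norm_def set_lebesgue_integral_def by (simp add: integral_nonneg_AE)

lemma L2h_scale:
  assumes "g \<in> L2h D"
  shows "(\<lambda>x. c * g x) \<in> L2h D" "L2norm D (\<lambda>x. c * g x) = cmod c * L2norm D g"
proof -
  have int: "integrable lborel (\<lambda>x. indicator D x *\<^sub>R (cmod (g x))\<^sup>2)" and g: "holo_fun_on g D"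
    using assms by (simp_all add: L2h_def set_integrable_def)
  have eq: "(\<lambda>x. indicator D x *\<^sub>R (cmod (c * g x))\<^sup>2) = (\<lambda>x. (cmod c)\<^sup>2 * (indicator D x *\<^sub>R (cmod (g x))\<^sup>2))"
    by (simp add: fun_eq_iff norm_mult power_mult_distrib)
  show "(\<lambda>x. c * g x) \<in> L2h D"
    unfolding L2h_def set_integrable_def mem_Collect_eq eq
    by (intro conjI holo_fun_on_mult holo_fun_on_const g integrable_mult_right int)
  show "L2norm D (\<lambda>x. c * g x) = cmod c * L2norm D g"
    unfolding L2norm_def set_lebesgue_integral_def eq integral_mult_right_zero real_sqrt_mult by simp
qed

text \<open>Used to turn competitors for the kernel into competitors for \<open>bergman_M\<close>,
  with \<open>f\<close> the Caratheodory test function.\<close>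

lemma L2h_bounded_mult:
  assumes f: "holo_fun_on f D" "f ` D \<subseteq> ball 0 1" and h: "h \<in> L2h D" and D: "open D"
  shows "(\<lambda>x. f x * h x) \<in> L2h D" "L2norm D (\<lambda>x. f x * h x) \<le> L2norm D h"
proof -
  have le: "ennreal ((cmod (f x * h x))\<^sup>2) * indicator D x \<le> ennreal ((cmod (h x))\<^sup>2) * indicator D x" for x
  proof (cases "x \<in> D")
    case True
    then have "cmod (f x) \<le> 1" using f(2) by (auto simp: image_subset_iff less_imp_le)
    then have "cmod (f x * h x) \<le> cmod (h x)" by (simp add: norm_mult mult_left_le_one_le)
    then show ?thesis using True by (simp add: ennreal_leI power_mono)
  qed simp
  then have int: "(\<integral>\<^sup>+x. ennreal ((cmod (f x * h x))\<^sup>2) * indicator D x \<partial>lborel) \<le> ennreal ((L2norm D h)\<^sup>2)"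
    unfolding L2h_nn_integral[OF h, symmetric] by (intro nn_integral_mono)
  have "holo_fun_on h D" using h by (simp add: L2h_def)
  then show fh: "(\<lambda>x. f x * h x) \<in> L2h D"
    by (intro L2hI[OF _ D int] holo_fun_on_mult f)
  have "(L2norm D (\<lambda>x. f x * h x))\<^sup>2 \<le> (L2norm D h)\<^sup>2"
    using int unfolding L2h_nn_integral[OF fh] by simp
  then show "L2norm D (\<lambda>x. f x * h x) \<le> L2norm D h"
    by (rule power2_le_imp_le) (rule L2norm_nonneg)
qed

section \<open>Weighted balls, their volumes, and interior estimates\<close>

context adapted_point
begin

definition sball :: "real \<Rightarrow> (complex ^ 'n) set" where
  "sball r = {x. ssum x < r}"

text \<open>The scale of the Bergman quantities: the kernel at \<open>z\<close> is comparable to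
  \<open>1 / vol\<close>, and \<open>bergman_M\<close> to \<open>ssum X / sqrt vol\<close>.\<close>

definition vol :: real where
  "vol = measure lborel (sball 1)"

lemma open_sball: "open (sball r)"
  unfolding sball_def by (intro open_Collect_less continuous_on_ssum continuous_intros)

lemma norm_le_coord_sum: "norm X \<le> (\<Sum>j\<in>{1..CARD('n)}. cmod (coord z a X j))"
proof -
  have "norm (\<Sum>j\<in>{1..CARD('n)}. coord z a X j *s dir j) \<le> (\<Sum>j\<in>{1..CARD('n)}. norm (coord z a X j *s dir j))"
    by (rule norm_sum)
  also have "\<dots> = (\<Sum>j\<in>{1..CARD('n)}. cmod (coord z a X j))"
    by (intro sum.cong refl) (simp add: norm_vec_scale norm_dir)
  finally show ?thesis by (simp only: coord_expansion)
qed

lemma bounded_sball: "bounded (sball 1)"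
proof (rule boundedI)
  fix x assume "x \<in> sball 1"
  then have "cmod (coord z a x j) \<le> dst j" if "j \<in> {1..CARD('n)}" for j
  proof -
    have "cmod (coord z a x j) / dst j \<le> 1"
      using term_le_ssum[OF that, of x] \<open>x \<in> sball 1\<close> by (simp add: sball_def)
    then show ?thesis using bd_point(4)[OF that] by (simp add: divide_le_eq)
  qed
  then have "(\<Sum>j\<in>{1..CARD('n)}. cmod (coord z a x j)) \<le> (\<Sum>j\<in>{1..CARD('n)}. dst j)"
    by (intro sum_mono)
  then show "norm x \<le> (\<Sum>j\<in>{1..CARD('n)}. dst j)"
    using norm_le_coord_sum[of x] by linarith
qed

lemma zero_in_sball: "r > 0 \<Longrightarrow> 0 \<in> sball r"
  using ssum_scale[of 0 0] by (simp add: sball_def)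

lemma emeasure_sball_1: "emeasure lborel (sball 1) = ennreal vol"
  unfolding vol_def
  by (rule emeasure_eq_ennreal_measure) (use emeasure_bounded_finite[OF bounded_sball] in auto)

lemma vol_pos: "vol > 0"
proof -
  obtain e where e: "e > 0" "ball 0 e \<subseteq> sball 1"
    using open_sball[of 1] zero_in_sball[of 1] by (auto simp: open_contains_ball)
  have "0 < measure lborel (ball (0 :: complex ^ 'n) e)"
    using e(1) by (rule content_ball_pos)
  also have "\<dots> \<le> vol"
    unfolding vol_def
    by (rule measure_mono_fmeasurable[OF e(2)])
      (use emeasure_bounded_finite[OF bounded_sball] open_sball in \<open>auto simp: fmeasurable_def\<close>)
  finally show ?thesis .
qed

lemma emeasure_sball:
  assumes r: "r > 0"
  shows "emeasure lborel (sball r) = ennreal (r ^ (2 * CARD('n)) * vol)"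
proof -
  have dim: "DIM(complex ^ 'n) = 2 * CARD('n)" by simp
  have [measurable]: "sball r \<in> sets borel" using open_sball by simp
  have "(\<lambda>x. 0 + r *\<^sub>R x) -` sball r = sball 1"
    using r by (auto simp: sball_def scaleR_vec_eq ssum_scale)
  moreover have "emeasure lborel (sball r) =
      emeasure (density (distr lborel borel (\<lambda>x. 0 + r *\<^sub>R x)) (\<lambda>_. \<bar>r\<bar> ^ DIM(complex ^ 'n))) (sball r)"
    using lborel_affine[of r "0 :: complex ^ 'n"] r by simp
  ultimately have "emeasure lborel (sball r) = ennreal (r ^ (2 * CARD('n))) * emeasure lborel (sball 1)"
    using r by (simp add: emeasure_density nn_integral_cmult emeasure_distr dim mult.commute[of "CARD('n)" 2])
  then show ?thesis using r by (simp add: emeasure_sball_1 ennreal_mult' vol_pos less_imp_le)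
qed

text \<open>The \<open>ssum\<close> ball of radius \<open>1 / 2\<close> about \<open>z + y\<close>
  still lies in \<open>D\<close> and is balanced; the mean value inequality applies with its volume
  \<open>(1 / 2) ^ (2 * CARD('n)) * vol\<close>.\<close>

lemma point_estimate:
  assumes g: "g \<in> L2h D" and y: "ssum y \<le> 1 / 2"
  shows "cmod (g (z + y)) \<le> 2 ^ CARD('n) / sqrt vol * L2norm D g"
proof -
  have hg: "holo_fun_on g D" using g by (simp add: L2h_def)
  have inD: "z + y + x \<in> D" if "x \<in> sball (1 / 2)" for x
    using ssum_ball_subset[of "y + x"] ssum_triangle[of y x] y that by (simp add: sball_def add.assoc)
  have bal: "c *s x \<in> sball (1 / 2)" if "x \<in> sball (1 / 2)" "cmod c \<le> 1" for x c
    using that mult_left_le_one_le[OF ssum_nonneg[of x] norm_ge_zero that(2)]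
    by (simp add: sball_def ssum_scale)
  have "ennreal ((cmod (g (z + y)))\<^sup>2) * emeasure lborel (sball (1 / 2)) \<le>
      (\<integral>\<^sup>+x. ennreal ((cmod (g (z + y + x)))\<^sup>2) * indicator (sball (1 / 2)) x \<partial>lborel)"
    by (rule balanced_mean_value[OF hg open_D open_sball inD bal])
  also have "\<dots> \<le> (\<integral>\<^sup>+x. ennreal ((cmod (g (z + y + x)))\<^sup>2) * indicator D (z + y + x) \<partial>lborel)"
    by (intro nn_integral_mono) (use inD in \<open>auto simp: indicator_def\<close>)
  also have "\<dots> = (\<integral>\<^sup>+x. ennreal ((cmod (g x))\<^sup>2) * indicator D x \<partial>lborel)"
  proof (rule nn_integral_lborel_shift[where g = "\<lambda>x. ennreal ((cmod (g x))\<^sup>2) * indicator D x"])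
    have "integrable lborel (\<lambda>x. indicator D x *\<^sub>R (cmod (g x))\<^sup>2)"
      using g by (simp add: L2h_def set_integrable_def)
    then have "(\<lambda>x. ennreal (indicator D x *\<^sub>R (cmod (g x))\<^sup>2)) \<in> borel_measurable borel"
      by (intro measurable_compose[OF _ measurable_ennreal]) (auto dest: borel_measurable_integrable)
    also have "(\<lambda>x. ennreal (indicator D x *\<^sub>R (cmod (g x))\<^sup>2)) = (\<lambda>x. ennreal ((cmod (g x))\<^sup>2) * indicator D x)"
      by (auto simp: fun_eq_iff indicator_def)
    finally show "(\<lambda>x. ennreal ((cmod (g x))\<^sup>2) * indicator D x) \<in> borel_measurable borel" .
  qed
  also have "\<dots> = ennreal ((L2norm D g)\<^sup>2)" by (rule L2h_nn_integral[OF g])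
  finally have "ennreal ((cmod (g (z + y)))\<^sup>2) * emeasure lborel (sball (1 / 2)) \<le> ennreal ((L2norm D g)\<^sup>2)" .
  moreover have "emeasure lborel (sball (1 / 2)) = ennreal ((1 / 2) ^ (2 * CARD('n)) * vol)"
    by (rule emeasure_sball) simp
  moreover have "ennreal ((cmod (g (z + y)))\<^sup>2 * ((1 / 2) ^ (2 * CARD('n)) * vol)) =
      ennreal ((cmod (g (z + y)))\<^sup>2) * ennreal ((1 / 2) ^ (2 * CARD('n)) * vol)"
    by (rule ennreal_mult') simp
  ultimately have *: "ennreal ((cmod (g (z + y)))\<^sup>2 * ((1 / 2) ^ (2 * CARD('n)) * vol)) \<le> ennreal ((L2norm D g)\<^sup>2)"
    by (simp only:)
  have "(cmod (g (z + y)))\<^sup>2 * ((1 / 2) ^ (2 * CARD('n)) * vol) \<le> (L2norm D g)\<^sup>2"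
    by (rule ennreal_le_iff[THEN iffD1, OF _ *]) simp
  then have le: "(cmod (g (z + y)))\<^sup>2 * ((1 / 2) ^ (2 * CARD('n)) * vol) * (2 ^ (2 * CARD('n)) / vol) \<le>
      (L2norm D g)\<^sup>2 * (2 ^ (2 * CARD('n)) / vol)"
    using vol_pos by (intro mult_right_mono) auto
  have "(1 / 2) ^ (2 * CARD('n)) * (2 :: real) ^ (2 * CARD('n)) = 1"
    by (simp flip: power_mult_distrib)
  then have "(cmod (g (z + y)))\<^sup>2 * ((1 / 2) ^ (2 * CARD('n)) * vol) * (2 ^ (2 * CARD('n)) / vol) = (cmod (g (z + y)))\<^sup>2"
    using vol_pos by (simp add: mult.assoc)
  moreover have "(L2norm D g)\<^sup>2 * (2 ^ (2 * CARD('n)) / vol) = (2 ^ CARD('n) / sqrt vol * L2norm D g)\<^sup>2"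
    using vol_pos by (simp add: power_mult_distrib power_divide mult.commute flip: power_mult)
  ultimately have "(cmod (g (z + y)))\<^sup>2 \<le> (2 ^ CARD('n) / sqrt vol * L2norm D g)\<^sup>2"
    using le by (simp only:)
  then show ?thesis
    by (rule power2_le_imp_le) (use vol_pos L2norm_nonneg[of D g] in auto)
qed

lemma derivative_estimate:
  assumes g: "g \<in> L2h D" and X: "X \<noteq> 0"
  shows "cmod (frechet_derivative g (at z) X) \<le> 2 * ssum X * (2 ^ CARD('n) / sqrt vol * L2norm D g)"
proof -
  have hg: "holo_fun_on g D" using g by (simp add: L2h_def)
  have S: "ssum X > 0" by (rule ssum_pos[OF X])
  \<comment> \<open>Scaled so that the unit disc in direction \<open>V\<close> stays where
    \<open>point_estimate\<close> holds; Cauchy's inequality on it then costs the factor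
    \<open>2 * ssum X\<close>.\<close>
  define V where "V = of_real (1 / (2 * ssum X)) *s X"
  have V2: "ssum V = 1 / 2" using S by (simp add: V_def ssum_scale norm_divide norm_mult)
  have tV: "ssum (t *s V) \<le> 1 / 2" if "cmod t \<le> 1" for t
    unfolding ssum_scale V2 using that by simp
  have der: "((\<lambda>t. g (z + t *s V)) has_field_derivative frechet_derivative g (at (z + t *s V)) V) (at t)"
    if "cmod t \<le> 1" for t
    by (rule holo_fun_on_line[OF hg ssum_ball_subset]) (use tV[OF that] in linarith)
  have "cmod ((deriv ^^ 1) (\<lambda>t. g (z + t *s V)) 0) \<le> fact 1 * (2 ^ CARD('n) / sqrt vol * L2norm D g) / 1 ^ 1"
  proof (rule Cauchy_inequality)
    show "(\<lambda>t. g (z + t *s V)) holomorphic_on ball 0 1"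
      unfolding holomorphic_on_open[OF open_ball] using der by (metis less_imp_le mem_ball_0)
    show "continuous_on (cball 0 1) (\<lambda>t. g (z + t *s V))"
      by (intro continuous_at_imp_continuous_on ballI DERIV_isCont[OF der]) simp
    show "cmod (g (z + t *s V)) \<le> 2 ^ CARD('n) / sqrt vol * L2norm D g" if "cmod (0 - t) = 1" for t
      by (rule point_estimate[OF g tV]) (use that in simp)
  qed simp
  moreover have "deriv (\<lambda>t. g (z + t *s V)) 0 = frechet_derivative g (at z) V"
    using DERIV_imp_deriv[OF der[of 0]] by simp
  moreover have "frechet_derivative g (at z) V = of_real (1 / (2 * ssum X)) * frechet_derivative g (at z) X"
    unfolding V_def by (rule clinear_fun_scale[OF holo_fun_on_frechet(2)[OF hg zD]])
  ultimately have "cmod (frechet_derivative g (at z) X) / (2 * ssum X) \<le> 2 ^ CARD('n) / sqrt vol * L2norm D g"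
    using S by (simp add: norm_mult norm_divide One_nat_def)
  then show ?thesis using S by (simp add: field_simps)
qed

end

text \<open>With \<open>r = cmod (s + 1)\<close> the left side is at most
  \<open>2 + (r + 1)^2\<close>, hence at most \<open>4 + 2 * r^2\<close>, and \<open>4\<close> is at
  most \<open>25 * r^2\<close> since \<open>r\<close> is at least \<open>2 / 5\<close>.\<close>

lemma one_plus_le_square:
  fixes s :: complex
  assumes "2 / 5 \<le> cmod (s + 1)"
  shows "1 + cmod (1 - s\<^sup>2) \<le> 27 * (cmod (s + 1))\<^sup>2"
proof -
  have s: "cmod s \<le> cmod (s + 1) + 1"
    using norm_triangle_ineq4[of "s + 1" 1] by simp
  have "cmod (1 - s\<^sup>2) \<le> 1 + (cmod s)\<^sup>2"
    using norm_triangle_ineq4[of 1 "s\<^sup>2"] by (simp add: norm_power)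
  also have "(cmod s)\<^sup>2 \<le> (cmod (s + 1) + 1)\<^sup>2"
    using s by (intro power_mono) auto
  finally have 1: "1 + cmod (1 - s\<^sup>2) \<le> 2 + (cmod (s + 1) + 1)\<^sup>2" by simp
  have "(2 / 5)\<^sup>2 \<le> (cmod (s + 1))\<^sup>2" using assms by (intro power_mono) auto
  moreover have "0 \<le> (cmod (s + 1) - 1)\<^sup>2" by simp
  ultimately show ?thesis using 1 by (simp add: power2_eq_square algebra_simps)
qed

text \<open>The base collects \<open>108 = 4 * 27\<close> from each factor
  \<open>2 / (1 + \<sigma> j)\<close> and \<open>2 ^ CARD('n)\<close> from the triangular system.
  The exponent exceeds the real dimension by 2, which leaves the convergent series of inverse
  squares.\<close>

definition energy_const :: "'n itself \<Rightarrow> real" where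
  "energy_const _ = (108 ^ CARD('n) * 2 ^ CARD('n)) ^ (2 * CARD('n) + 2) * (\<Sum>i. inverse (real (Suc i) ^ 2))"

lemma energy_const_pos: "energy_const TYPE('n) > 0"
proof -
  have "summable (\<lambda>i. inverse (real (Suc i) ^ 2))"
    using inverse_power_summable[of 2, where 'a = real] by (subst summable_Suc_iff) simp
  then have "(\<Sum>i. inverse (real (Suc i) ^ 2)) > 0" by (rule suminf_pos) simp
  then show ?thesis by (simp add: energy_const_def)
qed

context adapted_point
begin

text \<open>The square roots \<open>\<sigma>\<close> grow like \<open>\<bar>l\<^sub>j\<bar> ^ (1 / 2)\<close>, so a large power of \<open>2 / (1 + \<sigma>)\<close> is
  square integrable on all of \<open>\<complex>\<^sup>n\<close>, with energy comparable to the volume of \<open>sball 1\<close>.\<close>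

lemma decaying_function:
  obtains f where "holo_fun_on f D" "f z = 1"
    "\<And>w. w \<in> D \<Longrightarrow> (cmod (f w))\<^sup>2 \<le>
      (108 ^ CARD('n) * 2 ^ CARD('n)) ^ (2 * CARD('n) + 2) / (1 + ssum (w - z)) ^ (2 * CARD('n) + 2)"
proof -
  obtain l \<sigma> where l: "\<And>j. j \<in> {1..CARD('n)} \<Longrightarrow> clinear_fun (l j)"
    and \<sigma>: "\<And>j w. j \<in> {1..CARD('n)} \<Longrightarrow> w \<in> D \<Longrightarrow> (\<sigma> j has_derivative (\<lambda>X. - l j X / (2 * \<sigma> j w))) (at w)"
    "\<And>j. j \<in> {1..CARD('n)} \<Longrightarrow> \<sigma> j z = 1"
    "\<And>j w. j \<in> {1..CARD('n)} \<Longrightarrow> w \<in> D \<Longrightarrow> (\<sigma> j w)\<^sup>2 = 1 - l j (w - z)"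
    "\<And>j w. j \<in> {1..CARD('n)} \<Longrightarrow> w \<in> D \<Longrightarrow> 2 / 5 \<le> cmod (\<sigma> j w + 1)"
    and max: "\<And>X. \<exists>j\<in>{1..CARD('n)}. ssum X \<le> 2 ^ CARD('n) * cmod (l j X)"
    by (rule obtain_sqrts) (rule that)
  let ?k = "2 * CARD('n) + 2"
  define h where "h j w = 2 * inverse (\<sigma> j w + 1)" for j w
  define f where "f w = (\<Prod>j\<in>{1..CARD('n)}. h j w) ^ ?k" for w
  have nz: "\<sigma> j w + 1 \<noteq> 0" if "j \<in> {1..CARD('n)}" "w \<in> D" for j w
    using \<sigma>(4)[OF that] by auto
  have hh: "holo_fun_on (h j) D" if j: "j \<in> {1..CARD('n)}" for j
  proof (rule holo_fun_onI)
    fix w assume w: "w \<in> D"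
    show "(h j has_derivative (\<lambda>X. 2 * (inverse (\<sigma> j w + 1) * (l j X / (2 * \<sigma> j w)) * inverse (\<sigma> j w + 1)))) (at w)"
      unfolding h_def
      by (rule derivative_eq_intros \<sigma>(1)[OF j w] refl nz[OF j w] | simp)+
    show "clinear_fun (\<lambda>X. 2 * (inverse (\<sigma> j w + 1) * (l j X / (2 * \<sigma> j w)) * inverse (\<sigma> j w + 1)))"
      by (rule clinear_funI) (simp_all add: clinear_fun_add[OF l[OF j]] clinear_fun_scale[OF l[OF j]]
          add_divide_distrib algebra_simps)
  qed
  have "holo_fun_on f D"
    unfolding f_def by (intro holo_fun_on_power holo_fun_on_prod hh)
  moreover have "f z = 1"
    using \<sigma>(2) by (simp add: f_def h_def)
  moreover have "(cmod (f w))\<^sup>2 \<le> (108 ^ CARD('n) * 2 ^ CARD('n)) ^ ?k / (1 + ssum (w - z)) ^ ?k"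
    if w: "w \<in> D" for w
  proof -
    let ?x = "w - z"
    have h1: "(cmod (h j w))\<^sup>2 \<le> 108 / (1 + cmod (l j ?x))" if j: "j \<in> {1..CARD('n)}" for j
    proof -
      have "1 - (\<sigma> j w)\<^sup>2 = l j ?x" using \<sigma>(3)[OF j w] by simp
      then have "1 + cmod (l j ?x) \<le> 27 * (cmod (\<sigma> j w + 1))\<^sup>2"
        using one_plus_le_square[OF \<sigma>(4)[OF j w]] by simp
      moreover have "(cmod (\<sigma> j w + 1))\<^sup>2 > 0" using nz[OF j w] by simp
      moreover have "1 + cmod (l j ?x) > 0" by (simp add: add_pos_nonneg)
      moreover have "4 / p \<le> 108 / q" if "q \<le> 27 * p" "p > 0" "q > 0" for p q :: real
        using that by (simp add: field_simps)
      ultimately have "4 / (cmod (\<sigma> j w + 1))\<^sup>2 \<le> 108 / (1 + cmod (l j ?x))" by blast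
      moreover have "(cmod (h j w))\<^sup>2 = 4 / (cmod (\<sigma> j w + 1))\<^sup>2"
        unfolding h_def norm_mult norm_inverse by (simp add: power_mult_distrib power_inverse divide_inverse)
      ultimately show ?thesis by simp
    qed
    \<comment> \<open>The index that controls \<open>ssum\<close> varies with the point, so all
      factors enter the product; those with other indices are at least 1 and do no harm.\<close>
    have prod: "1 + cmod (l i ?x) \<le> (\<Prod>j\<in>{1..CARD('n)}. 1 + cmod (l j ?x))" if "i \<in> {1..CARD('n)}" for i
    proof -
      have "(1 + cmod (l i ?x)) * 1 \<le> (1 + cmod (l i ?x)) * (\<Prod>j\<in>{1..CARD('n)} - {i}. 1 + cmod (l j ?x))"
        by (intro mult_left_mono prod_ge_1) auto
      also have "\<dots> = (\<Prod>j\<in>{1..CARD('n)}. 1 + cmod (l j ?x))"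
        by (rule prod.remove[symmetric, OF _ that]) simp
      finally show ?thesis by simp
    qed
    obtain i where i: "i \<in> {1..CARD('n)}" "ssum ?x \<le> 2 ^ CARD('n) * cmod (l i ?x)"
      using max by blast
    have "1 + ssum ?x \<le> 2 ^ CARD('n) * 1 + 2 ^ CARD('n) * cmod (l i ?x)"
      using i(2) by (intro add_mono) auto
    also have "\<dots> = 2 ^ CARD('n) * (1 + cmod (l i ?x))" by (simp add: algebra_simps)
    also have "\<dots> \<le> 2 ^ CARD('n) * (\<Prod>j\<in>{1..CARD('n)}. 1 + cmod (l j ?x))"
      by (intro mult_left_mono prod i(1)) auto
    finally have S: "1 + ssum ?x \<le> 2 ^ CARD('n) * (\<Prod>j\<in>{1..CARD('n)}. 1 + cmod (l j ?x))" .
    have P0: "(\<Prod>j\<in>{1..CARD('n)}. 1 + cmod (l j ?x)) > 0"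
      by (intro prod_pos) (auto simp: add_pos_nonneg)
    have S0: "1 + ssum ?x > 0" using ssum_nonneg[of ?x] by linarith
    have "(\<Prod>j\<in>{1..CARD('n)}. (cmod (h j w))\<^sup>2) \<le> (\<Prod>j\<in>{1..CARD('n)}. 108 / (1 + cmod (l j ?x)))"
      by (intro prod_mono conjI h1) auto
    also have "\<dots> = 108 ^ CARD('n) / (\<Prod>j\<in>{1..CARD('n)}. 1 + cmod (l j ?x))"
      by (simp add: prod_dividef)
    also have "\<dots> \<le> 108 ^ CARD('n) * 2 ^ CARD('n) / (1 + ssum ?x)"
    proof -
      have "108 ^ CARD('n) * (1 + ssum ?x) \<le> 108 ^ CARD('n) * (2 ^ CARD('n) * (\<Prod>j\<in>{1..CARD('n)}. 1 + cmod (l j ?x)))"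
        by (intro mult_left_mono S) auto
      then show ?thesis using P0 S0 by (simp add: divide_le_eq pos_le_divide_eq mult_ac)
    qed
    finally have "(\<Prod>j\<in>{1..CARD('n)}. (cmod (h j w))\<^sup>2) ^ ?k \<le> (108 ^ CARD('n) * 2 ^ CARD('n) / (1 + ssum ?x)) ^ ?k"
      by (intro power_mono prod_nonneg) auto
    moreover have "(cmod (f w))\<^sup>2 = (\<Prod>j\<in>{1..CARD('n)}. (cmod (h j w))\<^sup>2) ^ ?k"
    proof -
      have "(cmod (f w))\<^sup>2 = ((\<Prod>j\<in>{1..CARD('n)}. cmod (h j w)) ^ ?k)\<^sup>2"
        by (simp only: f_def norm_power prod_norm)
      also have "\<dots> = ((\<Prod>j\<in>{1..CARD('n)}. cmod (h j w))\<^sup>2) ^ ?k"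
        by (simp only: power_mult[symmetric] mult.commute)
      finally show ?thesis by (simp only: prod_power_distrib)
    qed
    ultimately show ?thesis by (simp only: power_divide)
  qed
  ultimately show ?thesis by (rule that)
qed

text \<open>Layers by the integer part of \<open>ssum\<close>: the ball of radius
  \<open>i + 1\<close> has volume \<open>(i + 1) ^ (2 * CARD('n)) * vol\<close>, and the decay
  reduces its contribution to \<open>vol / (i + 1)^2\<close>.\<close>

lemma nn_integral_decay:
  "(\<integral>\<^sup>+x. ennreal (1 / (1 + ssum x) ^ (2 * CARD('n) + 2)) \<partial>lborel) \<le>
    ennreal (vol * (\<Sum>i. inverse (real (Suc i) ^ 2)))"
proof -
  let ?k = "2 * CARD('n) + 2"
  have [measurable]: "sball r \<in> sets borel" for r using open_sball by simp
  have sm: "summable (\<lambda>i. inverse (real (Suc i) ^ 2))"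
    using inverse_power_summable[of 2, where 'a = real] by (subst summable_Suc_iff) simp
  have "ennreal (1 / (1 + ssum x) ^ ?k) \<le> (\<Sum>i. ennreal (1 / real (Suc i) ^ ?k) * indicator (sball (real (Suc i))) x)" for x
  proof -
    define i where "i = nat \<lfloor>ssum x\<rfloor>"
    have "real i = of_int \<lfloor>ssum x\<rfloor>" using ssum_nonneg[of x] by (simp add: i_def)
    then have i: "real i \<le> ssum x" "ssum x < real (Suc i)" by linarith+
    have "ennreal (1 / (1 + ssum x) ^ ?k) \<le> ennreal (1 / real (Suc i) ^ ?k)"
      using i by (intro ennreal_leI divide_left_mono power_mono mult_pos_pos zero_less_power) auto
    also have "\<dots> = ennreal (1 / real (Suc i) ^ ?k) * indicator (sball (real (Suc i))) x"
      using i(2) by (simp add: sball_def)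
    also have "\<dots> \<le> (\<Sum>i. ennreal (1 / real (Suc i) ^ ?k) * indicator (sball (real (Suc i))) x)"
    proof -
      have "F i \<le> (\<Sum>i. F i)" for F :: "nat \<Rightarrow> ennreal"
        using sum_le_suminf[of F "{i}"] by simp
      then show ?thesis .
    qed
    finally show ?thesis .
  qed
  then have "(\<integral>\<^sup>+x. ennreal (1 / (1 + ssum x) ^ ?k) \<partial>lborel) \<le>
      (\<integral>\<^sup>+x. (\<Sum>i. ennreal (1 / real (Suc i) ^ ?k) * indicator (sball (real (Suc i))) x) \<partial>lborel)"
    by (intro nn_integral_mono)
  also have "\<dots> = (\<Sum>i. \<integral>\<^sup>+x. ennreal (1 / real (Suc i) ^ ?k) * indicator (sball (real (Suc i))) x \<partial>lborel)"
    by (rule nn_integral_suminf) simp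
  also have "\<dots> = (\<Sum>i. ennreal (vol * inverse (real (Suc i) ^ 2)))"
  proof (rule suminf_cong)
    fix i
    have "(\<integral>\<^sup>+x. ennreal (1 / real (Suc i) ^ ?k) * indicator (sball (real (Suc i))) x \<partial>lborel) =
        ennreal (1 / real (Suc i) ^ ?k) * ennreal (real (Suc i) ^ (2 * CARD('n)) * vol)"
      by (subst nn_integral_cmult_indicator) (simp_all only: emeasure_sball of_nat_0_less_iff zero_less_Suc, simp)
    also have "\<dots> = ennreal (1 / real (Suc i) ^ ?k * (real (Suc i) ^ (2 * CARD('n)) * vol))"
      by (rule ennreal_mult'[symmetric]) simp
    also have "1 / real (Suc i) ^ ?k * (real (Suc i) ^ (2 * CARD('n)) * vol) = vol * inverse (real (Suc i) ^ 2)"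
      by (simp add: power_add power2_eq_square field_simps del: of_nat_Suc)
    finally show "(\<integral>\<^sup>+x. ennreal (1 / real (Suc i) ^ ?k) * indicator (sball (real (Suc i))) x \<partial>lborel) =
      ennreal (vol * inverse (real (Suc i) ^ 2))" .
  qed
  also have "\<dots> = ennreal (\<Sum>i. vol * inverse (real (Suc i) ^ 2))"
    using vol_pos by (intro suminf_ennreal2 summable_mult sm) auto
  also have "(\<Sum>i. vol * inverse (real (Suc i) ^ 2)) = vol * (\<Sum>i. inverse (real (Suc i) ^ 2))"
    by (rule suminf_mult[OF sm])
  finally show ?thesis .
qed

text \<open>The witness for the lower bound of the kernel: value 1 at \<open>z\<close> with squared
  norm of the order of \<open>vol\<close>.\<close>

lemma low_energy_function:
  obtains f where "f \<in> L2h D" "f z = 1" "(L2norm D f)\<^sup>2 \<le> energy_const TYPE('n) * vol"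
proof -
  let ?k = "2 * CARD('n) + 2"
  let ?C = "(108 ^ CARD('n) * 2 ^ CARD('n)) ^ ?k :: real"
  obtain f where f: "holo_fun_on f D" "f z = 1"
    "\<And>w. w \<in> D \<Longrightarrow> (cmod (f w))\<^sup>2 \<le> ?C / (1 + ssum (w - z)) ^ ?k"
    by (rule decaying_function) (rule that)
  have "continuous_on UNIV (\<lambda>x. 1 / (1 + ssum x) ^ ?k)"
  proof (intro continuous_intros continuous_on_ssum ballI)
    fix x
    show "(1 + ssum x) ^ ?k \<noteq> 0" using ssum_nonneg[of x] by auto
  qed
  then have m: "(\<lambda>x. 1 / (1 + ssum x) ^ ?k) \<in> borel_measurable borel"
    by (rule borel_measurable_continuous_onI)
  have "(\<integral>\<^sup>+x. ennreal ((cmod (f x))\<^sup>2) * indicator D x \<partial>lborel) \<le>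
      (\<integral>\<^sup>+x. ennreal (?C * (1 / (1 + ssum (- z + x)) ^ ?k)) \<partial>lborel)"
    by (intro nn_integral_mono) (use f(3) in \<open>auto simp: indicator_def intro!: ennreal_leI\<close>)
  also have "\<dots> = (\<integral>\<^sup>+x. ennreal (?C * (1 / (1 + ssum x) ^ ?k)) \<partial>lborel)"
    by (rule nn_integral_lborel_shift[where g = "\<lambda>x. ennreal (?C * (1 / (1 + ssum x) ^ ?k))"])
      (intro measurable_compose[OF _ measurable_ennreal] borel_measurable_times m borel_measurable_const)
  also have "\<dots> = (\<integral>\<^sup>+x. ennreal ?C * ennreal (1 / (1 + ssum x) ^ ?k) \<partial>lborel)"
    by (intro nn_integral_cong ennreal_mult') simp
  also have "\<dots> = ennreal ?C * (\<integral>\<^sup>+x. ennreal (1 / (1 + ssum x) ^ ?k) \<partial>lborel)"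
    by (rule nn_integral_cmult) (intro measurable_compose[OF _ measurable_ennreal], simp add: m[simplified])
  also have "\<dots> \<le> ennreal ?C * ennreal (vol * (\<Sum>i. inverse (real (Suc i) ^ 2)))"
    by (intro mult_left_mono nn_integral_decay) simp
  also have "\<dots> = ennreal (?C * (vol * (\<Sum>i. inverse (real (Suc i) ^ 2))))"
    by (rule ennreal_mult'[symmetric]) simp
  also have "?C * (vol * (\<Sum>i. inverse (real (Suc i) ^ 2))) = energy_const TYPE('n) * vol"
    by (simp only: energy_const_def mult_ac)
  finally have int: "(\<integral>\<^sup>+x. ennreal ((cmod (f x))\<^sup>2) * indicator D x \<partial>lborel) \<le> ennreal (energy_const TYPE('n) * vol)" .
  have fL: "f \<in> L2h D" by (rule L2hI[OF f(1) open_D int])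
  moreover have "(L2norm D f)\<^sup>2 \<le> energy_const TYPE('n) * vol"
    using int energy_const_pos[where 'n = 'n] vol_pos unfolding L2h_nn_integral[OF fL]
    by (subst (asm) ennreal_le_iff) auto
  ultimately show ?thesis using f(2) that by blast
qed

lemma bergman_kernel_bounds:
  shows "1 / (energy_const TYPE('n) * vol) \<le> bergman_kernel D z"
    "\<And>h. h \<in> L2h D \<Longrightarrow> L2norm D h \<le> 1 \<Longrightarrow> (cmod (h z))\<^sup>2 \<le> bergman_kernel D z"
proof -
  let ?A = "{(cmod (f z))\<^sup>2 | f. f \<in> L2h D \<and> L2norm D f \<le> 1}"
  have "bdd_above ?A"
  proof (rule bdd_aboveI)
    fix y assume "y \<in> ?A"
    then obtain f where f: "f \<in> L2h D" "L2norm D f \<le> 1" "y = (cmod (f z))\<^sup>2" by blast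
    have "cmod (f z) \<le> 2 ^ CARD('n) / sqrt vol * L2norm D f"
      using point_estimate[OF f(1), of 0] ssum_scale[of 0 0] by simp
    also have "\<dots> \<le> 2 ^ CARD('n) / sqrt vol * 1"
      using f(2) vol_pos by (intro mult_left_mono) auto
    finally show "y \<le> (2 ^ CARD('n) / sqrt vol)\<^sup>2"
      unfolding f(3) by (intro power_mono) auto
  qed
  then show up: "(cmod (h z))\<^sup>2 \<le> bergman_kernel D z" if "h \<in> L2h D" "L2norm D h \<le> 1" for h
    unfolding bergman_kernel_def using that by (intro cSup_upper) auto
  obtain f where f: "f \<in> L2h D" "f z = 1" "(L2norm D f)\<^sup>2 \<le> energy_const TYPE('n) * vol"
    by (rule low_energy_function) (rule that)
  define E where "E = energy_const TYPE('n) * vol"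
  have E: "E > 0" using energy_const_pos[where 'n = 'n] vol_pos by (simp add: E_def)
  let ?h = "\<lambda>x. of_real (1 / sqrt E) * f x"
  have "L2norm D f \<le> sqrt E"
    using f(3) by (intro real_le_rsqrt) (simp add: E_def)
  then have "L2norm D ?h \<le> 1"
    using L2h_scale(2)[OF f(1), of "of_real (1 / sqrt E)"] E by (simp add: norm_divide)
  then have "(cmod (?h z))\<^sup>2 \<le> bergman_kernel D z"
    by (rule up[OF L2h_scale(1)[OF f(1)]])
  moreover have "(cmod (?h z))\<^sup>2 = 1 / E"
    using E by (simp add: f(2) norm_divide power_divide)
  ultimately show "1 / (energy_const TYPE('n) * vol) \<le> bergman_kernel D z"
    by (simp add: E_def)
qed

text \<open>For \<open>f\<close> vanishing at \<open>z\<close> the product \<open>f * h\<close> has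
  derivative \<open>f'(z) X * h z\<close> at \<open>z\<close> and norm at most that of
  \<open>h\<close>. Letting \<open>h\<close> run through the competitors for the kernel gives
  \<open>bergman_M\<close> at least \<open>c * sqrt K\<close>. The upper bound combines the
  derivative estimate with the low energy function.\<close>

lemma bergman_bounds:
  assumes X: "X \<noteq> 0"
  shows "ssum X / (40 * 2 ^ CARD('n)) \<le> bergman_metric D z X"
    "bergman_metric D z X \<le> 2 * 2 ^ CARD('n) * sqrt (energy_const TYPE('n)) * ssum X"
proof -
  let ?A = "{cmod (frechet_derivative f (at z) X) | f. f \<in> L2h D \<and> L2norm D f = 1 \<and> f z = 0}"
  define b where "b = 2 * ssum X * (2 ^ CARD('n) / sqrt vol)"
  define E where "E = energy_const TYPE('n) * vol"
  define c where "c = ssum X / (40 * 2 ^ CARD('n))"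
  let ?K = "bergman_kernel D z"
  have E: "E > 0" using energy_const_pos[where 'n = 'n] vol_pos by (simp add: E_def)
  have KE: "1 / E \<le> ?K" using bergman_kernel_bounds(1) by (simp add: E_def)
  moreover have "1 / E > 0" using E by simp
  ultimately have K: "?K > 0" by linarith
  have c: "c > 0" using ssum_pos[OF X] by (simp add: c_def)
  have upper: "y \<le> b" if "y \<in> ?A" for y
    using that derivative_estimate[OF _ X] by (fastforce simp: b_def)
  obtain f where f: "holo_fun_on f D" "f ` D \<subseteq> ball 0 1" "f z = 0"
    "ssum X / (40 * 2 ^ CARD('n)) \<le> cmod (frechet_derivative f (at z) X)"
    by (rule test_function) (rule that)
  have lower: "\<exists>y\<in>?A. c * cmod (h z) \<le> y" if h: "h \<in> L2h D" "L2norm D h \<le> 1" "h z \<noteq> 0" for h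
  proof -
    let ?g = "\<lambda>x. f x * h x"
    note g = L2h_bounded_mult[OF f(1,2) h(1) open_D]
    have hh: "holo_fun_on h D" using h(1) by (simp add: L2h_def)
    have dg: "(?g has_derivative (\<lambda>v. f z * frechet_derivative h (at z) v + frechet_derivative f (at z) v * h z)) (at z)"
      by (rule has_derivative_mult[OF holo_fun_on_frechet(1)[OF f(1) zD] holo_fun_on_frechet(1)[OF hh zD]])
    have "frechet_derivative ?g (at z) X = frechet_derivative f (at z) X * h z"
      using fun_cong[OF frechet_derivative_at[OF dg], of X] f(3) by simp
    then have gX: "c * cmod (h z) \<le> cmod (frechet_derivative ?g (at z) X)"
      using f(4)[folded c_def] by (simp add: norm_mult mult_right_mono)
    \<comment> \<open>Normalising \<open>?g\<close> requires a nonzero norm; a nonzero derivative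
      guarantees it through \<open>derivative_estimate\<close>.\<close>
    have "cmod (frechet_derivative ?g (at z) X) > 0"
      using gX c h(3) by (smt (verit) mult_pos_pos zero_less_norm_iff)
    then have "L2norm D ?g \<noteq> 0"
      using derivative_estimate[OF g(1) X] by auto
    then have N: "L2norm D ?g > 0" using L2norm_nonneg[of D ?g] by linarith
    have N1: "L2norm D ?g \<le> 1" using g(2) h(2) by linarith
    let ?u = "\<lambda>x. of_real (1 / L2norm D ?g) * ?g x"
    have u: "?u \<in> L2h D" "L2norm D ?u = 1"
      using L2h_scale[OF g(1), of "of_real (1 / L2norm D ?g)"] N by (simp_all add: norm_divide)
    have hg: "holo_fun_on ?g D" using g(1) by (simp add: L2h_def)
    have du: "(?u has_derivative (\<lambda>v. of_real (1 / L2norm D ?g) * frechet_derivative ?g (at z) v)) (at z)"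
      by (rule has_derivative_mult_right[OF holo_fun_on_frechet(1)[OF hg zD]])
    have "frechet_derivative ?u (at z) X = of_real (1 / L2norm D ?g) * frechet_derivative ?g (at z) X"
      using fun_cong[OF frechet_derivative_at[OF du], of X] by simp
    then have "cmod (frechet_derivative ?u (at z) X) = cmod (frechet_derivative ?g (at z) X) / L2norm D ?g"
      using N by (simp add: norm_mult norm_divide)
    also have "\<dots> \<ge> cmod (frechet_derivative ?g (at z) X)"
      using N N1 by (simp add: le_divide_eq mult_left_le)
    finally have "c * cmod (h z) \<le> cmod (frechet_derivative ?u (at z) X)" using gX by linarith
    moreover have "?u z = 0" using f(3) by simp
    ultimately show ?thesis using u by blast
  qed
  obtain f0 where f0: "f0 \<in> L2h D" "f0 z = 1" "(L2norm D f0)\<^sup>2 \<le> energy_const TYPE('n) * vol"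
    by (rule low_energy_function) (rule that)
  \<comment> \<open>Any scaling to norm at most 1 with nonzero value at \<open>z\<close> suffices to
    make \<open>?A\<close> nonempty; the summand 1 rules out division by zero.\<close>
  define r where "r = 1 / (L2norm D f0 + 1)"
  have r: "r > 0" "r * L2norm D f0 \<le> 1"
    using L2norm_nonneg[of D f0] by (auto simp: r_def divide_le_eq add_pos_nonneg intro: add_nonneg_pos)
  have "\<exists>y. y \<in> ?A"
    using lower[OF L2h_scale(1)[OF f0(1), of "of_real r"]] L2h_scale(2)[OF f0(1), of "of_real r"] r f0(2) by auto
  then have ne: "?A \<noteq> {}" by blast
  have bdd: "bdd_above ?A" using upper by (rule bdd_aboveI)
  have M_le: "bergman_M D z X \<le> b"
    unfolding bergman_M_def using ne upper by (rule cSup_least)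
  have M_ge: "c * cmod (h z) \<le> bergman_M D z X" if h: "h \<in> L2h D" "L2norm D h \<le> 1" "h z \<noteq> 0" for h
    using lower[OF h] cSup_upper[OF _ bdd] unfolding bergman_M_def by (meson order_trans)
  obtain y where y: "y \<in> ?A" using ne by blast
  then have "0 \<le> y" by auto
  then have M0: "0 \<le> bergman_M D z X"
    unfolding bergman_M_def using cSup_upper[OF y bdd] by linarith
  have "?K \<le> (bergman_M D z X / c)\<^sup>2"
    unfolding bergman_kernel_def
  proof (rule cSup_least)
    show "{(cmod (f z))\<^sup>2 |f. f \<in> L2h D \<and> L2norm D f \<le> 1} \<noteq> {}"
      using L2h_scale[OF f0(1), of 0] by (auto intro!: exI[of _ "\<lambda>x. 0 * f0 x"])
    fix k assume "k \<in> {(cmod (f z))\<^sup>2 |f. f \<in> L2h D \<and> L2norm D f \<le> 1}"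
    then obtain h where h: "h \<in> L2h D" "L2norm D h \<le> 1" "k = (cmod (h z))\<^sup>2" by blast
    have "cmod (h z) \<le> bergman_M D z X / c"
      using M_ge[OF h(1,2)] M0 c by (cases "h z = 0") (auto simp: pos_le_divide_eq mult.commute)
    then show "k \<le> (bergman_M D z X / c)\<^sup>2"
      unfolding h(3) by (intro power_mono) auto
  qed
  then have "sqrt ?K \<le> bergman_M D z X / c"
    using M0 c by (intro real_le_lsqrt) auto
  then have "c * sqrt ?K \<le> bergman_M D z X"
    using c by (simp add: pos_le_divide_eq mult.commute)
  then show "ssum X / (40 * 2 ^ CARD('n)) \<le> bergman_metric D z X"
    using K unfolding bergman_metric_def c_def[symmetric] by (simp add: pos_le_divide_eq)
  have "1 / sqrt E \<le> sqrt ?K"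
    using KE E by (metis real_sqrt_divide real_sqrt_le_mono real_sqrt_one)
  then have "1 \<le> sqrt E * sqrt ?K"
    using E by (simp add: pos_divide_le_eq mult.commute)
  then have "b * 1 \<le> b * (sqrt E * sqrt ?K)"
    using ssum_nonneg[of X] vol_pos by (intro mult_left_mono) (auto simp: b_def)
  then have "bergman_M D z X \<le> b * sqrt E * sqrt ?K" using M_le by (simp add: mult.assoc)
  then have "bergman_metric D z X \<le> b * sqrt E"
    using K unfolding bergman_metric_def by (simp add: pos_divide_le_eq)
  \<comment> \<open>The volume cancels here: \<open>b\<close> carries \<open>1 / sqrt vol\<close>
    and \<open>sqrt E\<close> carries \<open>sqrt vol\<close>.\<close>
  also have "b * sqrt E = 2 * 2 ^ CARD('n) * sqrt (energy_const TYPE('n)) * ssum X"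
    using vol_pos by (simp add: b_def E_def real_sqrt_mult)
  finally show "bergman_metric D z X \<le> 2 * 2 ^ CARD('n) * sqrt (energy_const TYPE('n)) * ssum X" .
qed

end

theorem proposition14:
  "\<exists>c::real. c > 1 \<and>
     (\<forall>(D :: (complex ^ 'n) set) z a X F.
        C_convex D \<and> contains_no_complex_lines D \<and> z \<in> D \<and> adapted D z a \<and> X \<noteq> 0 \<and>
        F \<in> {caratheodory_metric D, kobayashi_metric D, bergman_metric D} \<longrightarrow>
        inverse c \<le> F z X * inverse (\<Sum>j = 1..CARD('n). cmod (coord z a X j) / bd_dist D z a j) \<and>
        F z X * inverse (\<Sum>j = 1..CARD('n). cmod (coord z a X j) / bd_dist D z a j) \<le> c)"
proof (intro exI conjI allI impI)
  \<comment> \<open>The first summand of \<open>?c\<close> serves the common lower bound,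
    \<open>?u\<close> is the Bergman upper constant; the other two upper constants are 1.\<close>
  let ?u = "2 * 2 ^ CARD('n) * sqrt (energy_const TYPE('n))"
  let ?c = "40 * 2 ^ CARD('n) + ?u"
  have u: "?u \<ge> 0" using energy_const_pos[where 'n = 'n] by simp
  have p: "(1::real) \<le> 2 ^ CARD('n)" by simp
  show c1: "?c > 1" using u p by linarith
  fix D :: "(complex ^ 'n) set" and z a and X :: "complex ^ 'n" and F
  assume *: "C_convex D \<and> contains_no_complex_lines D \<and> z \<in> D \<and> adapted D z a \<and> X \<noteq> 0 \<and>
        F \<in> {caratheodory_metric D, kobayashi_metric D, bergman_metric D}"
  then interpret adapted_point D z a by unfold_locales auto
  have X: "X \<noteq> 0" using * by blast
  let ?S = "\<Sum>j = 1..CARD('n). cmod (coord z a X j) / bd_dist D z a j"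
  have S: "?S = ssum X" by (simp add: ssum_def)
  have S0: "ssum X > 0" by (rule ssum_pos[OF X])
  have lo: "ssum X / (40 * 2 ^ CARD('n)) \<le> F z X"
    using * caratheodory_bounds(1)[OF X] kobayashi_bounds(1)[OF X] bergman_bounds(1)[OF X] by auto
  have "ssum X \<le> ?c * ssum X" using c1 S0 by simp
  moreover have "?u * ssum X \<le> ?c * ssum X" using S0 by (intro mult_right_mono) auto
  ultimately have hi: "F z X \<le> ?c * ssum X"
    using * caratheodory_bounds(2)[OF X] kobayashi_bounds(2)[OF X] bergman_bounds(2)[OF X]
    by (auto intro: order_trans)
  have "ssum X / ?c \<le> ssum X / (40 * 2 ^ CARD('n))"
    using S0 u c1 by (intro divide_left_mono mult_pos_pos) auto
  then have "ssum X / ?c \<le> F z X" using lo by linarith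
  then show "inverse ?c \<le> F z X * inverse ?S"
    unfolding S using S0 c1 by (simp add: field_simps)
  show "F z X * inverse ?S \<le> ?c"
    unfolding S using hi S0 by (simp add: field_simps)
qed

end
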